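(* Let $F$ be an analytic function. The equation $$\ddot u\,u+\tfrac12\dot u^2+F'(u)=0$$ has cusped TWS if and only if there exists $m>0$ such that $F(m)-F(u)>0$ for all $u\in[0,m)$. These solutions are either (i) cusped periodic, with period $T=\dfrac{2}{\sqrt2}\displaystyle\int_0^m\sqrt{\frac{u}{F(m)-F(u)}}\,du$, if and only if in addition $F'(m)\neq0$, or (ii) cusped solitary, if and only if in addition $F'(m)=0$. These solutions are weak singular TWS and they are analytic except for a discontinuity in the first derivative at the cusps. Furthermore, the cusped solitary waves are symmetric with respect to their unique maximum and decay exponentially to zero at infinity. Cusped periodic solutions have a unique maximum and minimum per period and are symmetric with respect to these local extrema.
   Context: $F$ is a real-valued function of a real variable. Only solutions with values in $\{u\ge 0\}$ are considered, and the TWS considered are singular TWS in the sense below. Traveling wave solution (TWS): a bounded function $u\in H^1_{loc}(\mathbb{R})$ satisfying the equation $\ddot u\,u+\frac12\dot u^2+F'(u)=0$ in the sense of distributions, i.e. $$\int_{\mathbb{R}}(u^2)_t\phi_t+(u_t)^2\phi-2F'(u)\phi\,dt=0\quad\text{for all }\phi\in C_c^\infty(\mathbb{R}).$$ A non-constant TWS $u$ is a strong singular TWS if, for some constant $h\in\mathbb{R}$, it is a classical solution on $\mathbb{R}$ of $$\frac{u\dot u^2}{2}+F(u)=h;\qquad(\ast)$$ it is a weak singular TWS if it is a classical solution of $(\ast)$ on $\mathbb{R}\setminus\mathcal{S}$, where $\mathcal{S}$ is a set of countably many points $t_k$ such that $\lim_{t\to t_k}\big(\frac{u(t)\dot u(t)^2}{2}+F(u(t))\big)=h$.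 A singular TWS is one that is strong singular or weak singular. A TWS $u:\mathbb{R}\to\mathbb{R}$ is called cusped if it is smooth except at a finite or countable number of points (cusps) $\mathcal{S}=\{t_k\}$, where $$\lim_{t\to t_k^+}u'(t)=-\lim_{t\to t_k^-}u'(t)=\pm\infty.$$ It is cusped periodic if it is moreover periodic in $t$, and cusped solitary if it is a cusped solitary wave, i.e. it has a single cusp and tends to the same limit as $t\to+\infty$ and as $t\to-\infty$.
   Formalization: Cusped solitary waves have a minimum 0 at the cusp and tend to m>0, so "unique maximum" and "decay to zero" are stated for |u-m|; exponential decay is claimed only if F''(m)≠0, since otherwise it is algebraic (e.g. F(x)=(x-1)^3, m=1). *)

theory Defs
  imports "HOL-Analysis.Analysis"
begin

definition real_analytic_on :: "(real \<Rightarrow> real) \<Rightarrow> real set \<Rightarrow> bool" where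
  "real_analytic_on f A \<longleftrightarrow>
     (\<forall>x\<in>A. \<exists>r>0. \<exists>a :: nat \<Rightarrow> real. \<forall>y. \<bar>y - x\<bar> < r \<longrightarrow> (\<lambda>n. a n * (y - x) ^ n) sums f y)"

definition smooth_on :: "real set \<Rightarrow> (real \<Rightarrow> real) \<Rightarrow> bool" where
  "smooth_on A f \<longleftrightarrow> (\<forall>k. \<forall>x\<in>A. ((deriv ^^ k) f) differentiable (at x))"

definition test_function :: "(real \<Rightarrow> real) \<Rightarrow> bool" where
  "test_function \<phi> \<longleftrightarrow> smooth_on UNIV \<phi> \<and> (\<exists>a b. \<forall>t. t \<notin> {a..b} \<longrightarrow> \<phi> t = 0)"

definition L1_loc :: "(real \<Rightarrow> real) \<Rightarrow> bool" where
  "L1_loc f \<longleftrightarrow> f \<in> borel_measurable borel \<and> (\<forall>a b. set_integrable lborel {a..b} f)"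

definition L2_loc :: "(real \<Rightarrow> real) \<Rightarrow> bool" where
  "L2_loc f \<longleftrightarrow> f \<in> borel_measurable borel \<and> (\<forall>a b. set_integrable lborel {a..b} (\<lambda>t. (f t)\<^sup>2))"

definition weak_deriv :: "(real \<Rightarrow> real) \<Rightarrow> (real \<Rightarrow> real) \<Rightarrow> bool" where
  "weak_deriv u v \<longleftrightarrow> L1_loc u \<and> L1_loc v \<and>
     (\<forall>\<phi>. test_function \<phi> \<longrightarrow>
        (\<integral>t. u t * deriv \<phi> t \<partial>lborel) = - (\<integral>t. v t * \<phi> t \<partial>lborel))"

text \<open>An element of \<open>H\<^sup>1\<^sub>l\<^sub>o\<^sub>c(\<real>)\<close> is an a.e.-class of functions;
  it is represented here by its unique continuous member.\<close>

definition H1_loc :: "(real \<Rightarrow> real) \<Rightarrow> bool" where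
  "H1_loc u \<longleftrightarrow> continuous_on UNIV u \<and> L2_loc u \<and> (\<exists>v. L2_loc v \<and> weak_deriv u v)"

text \<open>Below, \<open>v\<close> and \<open>w\<close> are the weak derivatives of \<open>u\<close> and \<open>u\<^sup>2\<close>, which are unique almost
  everywhere. Only nonnegative solutions are considered.\<close>

definition TWS :: "(real \<Rightarrow> real) \<Rightarrow> (real \<Rightarrow> real) \<Rightarrow> bool" where
  "TWS F u \<longleftrightarrow> bounded (range u) \<and> H1_loc u \<and> (\<forall>t. 0 \<le> u t) \<and>
     (\<exists>v w. weak_deriv u v \<and> weak_deriv (\<lambda>t. (u t)\<^sup>2) w \<and>
        (\<forall>\<phi>. test_function \<phi> \<longrightarrow>
           (\<integral>t. w t * deriv \<phi> t + (v t)\<^sup>2 * \<phi> t - 2 * deriv F (u t) * \<phi> t \<partial>lborel) = 0))"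

definition energy :: "(real \<Rightarrow> real) \<Rightarrow> (real \<Rightarrow> real) \<Rightarrow> real \<Rightarrow> real" where
  "energy F u t = u t * (deriv u t)\<^sup>2 / 2 + F (u t)"

definition classical_energy_solution_on ::
    "real set \<Rightarrow> (real \<Rightarrow> real) \<Rightarrow> real \<Rightarrow> (real \<Rightarrow> real) \<Rightarrow> bool" where
  "classical_energy_solution_on A F h u \<longleftrightarrow>
     (\<forall>t\<in>A. u differentiable (at t)) \<and> continuous_on A (deriv u) \<and> (\<forall>t\<in>A. energy F u t = h)"

definition strong_singular_TWS :: "(real \<Rightarrow> real) \<Rightarrow> real \<Rightarrow> (real \<Rightarrow> real) \<Rightarrow> bool" where
  "strong_singular_TWS F h u \<longleftrightarrow>
     TWS F u \<and> \<not> u constant_on UNIV \<and> classical_energy_solution_on UNIV F h u"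

text \<open>The limit is taken along \<open>- S\<close>, where \<open>deriv u\<close> is meaningful.\<close>

definition weak_singular_TWS ::
    "(real \<Rightarrow> real) \<Rightarrow> real \<Rightarrow> real set \<Rightarrow> (real \<Rightarrow> real) \<Rightarrow> bool" where
  "weak_singular_TWS F h S u \<longleftrightarrow>
     TWS F u \<and> \<not> u constant_on UNIV \<and> countable S \<and>
     classical_energy_solution_on (- S) F h u \<and>
     (\<forall>s\<in>S. (energy F u \<longlongrightarrow> h) (at s within - S))"

definition singular_TWS :: "(real \<Rightarrow> real) \<Rightarrow> real \<Rightarrow> (real \<Rightarrow> real) \<Rightarrow> bool" where
  "singular_TWS F h u \<longleftrightarrow> strong_singular_TWS F h u \<or> (\<exists>S. weak_singular_TWS F h S u)"

definition cusp_at :: "(real \<Rightarrow> real) \<Rightarrow> real \<Rightarrow> bool" where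
  "cusp_at u s \<longleftrightarrow>
     (filterlim (deriv u) at_top (at_right s) \<and> filterlim (deriv u) at_bot (at_left s)) \<or>
     (filterlim (deriv u) at_bot (at_right s) \<and> filterlim (deriv u) at_top (at_left s))"

text \<open>\<open>h\<close> is the energy level of \<open>u\<close> and \<open>S\<close> its set of cusps, of which there is at least one.\<close>

definition cusped_TWS ::
    "(real \<Rightarrow> real) \<Rightarrow> real \<Rightarrow> real set \<Rightarrow> (real \<Rightarrow> real) \<Rightarrow> bool" where
  "cusped_TWS F h S u \<longleftrightarrow>
     singular_TWS F h u \<and> countable S \<and> S \<noteq> {} \<and> smooth_on (- S) u \<and> (\<forall>s\<in>S. cusp_at u s)"

definition has_period :: "(real \<Rightarrow> real) \<Rightarrow> real \<Rightarrow> bool" where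
  "has_period u T \<longleftrightarrow> 0 < T \<and> (\<forall>t. u (t + T) = u t)"

definition fundamental_period :: "(real \<Rightarrow> real) \<Rightarrow> real \<Rightarrow> bool" where
  "fundamental_period u T \<longleftrightarrow> has_period u T \<and> (\<forall>T'. has_period u T' \<longrightarrow> T \<le> T')"

definition cusped_periodic ::
    "(real \<Rightarrow> real) \<Rightarrow> real \<Rightarrow> real set \<Rightarrow> (real \<Rightarrow> real) \<Rightarrow> bool" where
  "cusped_periodic F h S u \<longleftrightarrow> cusped_TWS F h S u \<and> (\<exists>T. has_period u T)"

definition cusped_solitary ::
    "(real \<Rightarrow> real) \<Rightarrow> real \<Rightarrow> real set \<Rightarrow> (real \<Rightarrow> real) \<Rightarrow> bool" where
  "cusped_solitary F h S u \<longleftrightarrow> cusped_TWS F h S u \<and>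
     (\<exists>s. S = {s}) \<and> (\<exists>L. (u \<longlongrightarrow> L) at_top \<and> (u \<longlongrightarrow> L) at_bot)"

definition cusp_level :: "(real \<Rightarrow> real) \<Rightarrow> real \<Rightarrow> bool" where
  "cusp_level F m \<longleftrightarrow> 0 < m \<and> (\<forall>x\<in>{0..<m}. F m - F x > 0)"

definition local_max_at :: "(real \<Rightarrow> real) \<Rightarrow> real \<Rightarrow> bool" where
  "local_max_at u t \<longleftrightarrow> (\<forall>\<^sub>F s in nhds t. u s \<le> u t)"

definition local_min_at :: "(real \<Rightarrow> real) \<Rightarrow> real \<Rightarrow> bool" where
  "local_min_at u t \<longleftrightarrow> (\<forall>\<^sub>F s in nhds t. u t \<le> u s)"

definition symmetric_about :: "(real \<Rightarrow> real) \<Rightarrow> real \<Rightarrow> bool" where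
  "symmetric_about u t \<longleftrightarrow> (\<forall>s. u (t + s) = u (t - s))"

definition exponential_decay :: "(real \<Rightarrow> real) \<Rightarrow> bool" where
  "exponential_decay f \<longleftrightarrow> (\<exists>C>0. \<exists>c>0. \<forall>t. \<bar>f t\<bar> \<le> C * exp (- c * \<bar>t\<bar>))"

text \<open>A cusped solitary wave has the value \<open>0\<close> at its cusp, lies strictly below its limit \<open>m\<close> and
  never attains it. So its maximum and its decay to zero are those of its deviation from \<open>m\<close>.
  The deviation decays exponentially when \<open>m\<close> is a nondegenerate critical point of \<open>F\<close>; for
  \<open>F x = (x - 1) ^ 3\<close> and \<open>m = 1\<close> it decays only like \<open>1 / t\<^sup>2\<close>.\<close>

definition deviation :: "real \<Rightarrow> (real \<Rightarrow> real) \<Rightarrow> real \<Rightarrow> real" where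
  "deviation m u t = \<bar>u t - m\<bar>"

end

theory Submission
  imports Defs "HOL-Complex_Analysis.Conformal_Mappings"
begin

text \<open>The energy relation \<open>u * u'\<^sup>2 / 2 + F u = h\<close> is a first order equation, and the proof is a phase
line argument for it. It forces \<open>u\<close> to vanish wherever \<open>u'\<close> blows up, and it forces
\<open>F 0 < h\<close> at a cusp, since otherwise \<open>u'\<^sup>2 \<le> 2 * (F 0 - F u) / u\<close> would stay bounded. If \<open>F\<close>
never reached \<open>h\<close> on the half-line, \<open>u\<close> would rise for ever from a cusp with speed bounded below,
against its boundedness; the first \<open>m\<close> with \<open>F m = h\<close> is then a cusp level
(\<open>cusped_wave.level_exists\<close>).

Conversely, fix a cusp level \<open>m\<close>. A wave rising from \<open>0\<close> obeys \<open>u' = sqrt (2 * (F m - F u) / u)\<close>, so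
it reaches height \<open>x\<close> after the time \<open>\<integral>\<^sub>0\<^sup>x sqrt (y / (2 * (F m - F y))) dy\<close>, and its profile is the
inverse of this function. If \<open>F' m \<noteq> 0\<close>, the singularity at \<open>m\<close> is of inverse square root type, the
crest is reached in finite time, and reflecting the profile alternately at crests and zeros gives a
periodic wave. If \<open>F' m = 0\<close>, then \<open>F m - F y = O((m - y)\<^sup>2)\<close>, the crest is never reached, and one
reflection at \<open>0\<close> gives a solitary wave. Writing both as the profile evaluated at a folded time
treats the two cases together (\<open>wave\<close>).

This wave solves the weak equation because the flux \<open>u * u'\<close> is continuous, vanishing at zeros and
crests, and has derivative \<open>u'\<^sup>2 / 2 - F' u\<close> elsewhere (\<open>TWS_of_piecewise_classical\<close>,
\<open>wave_TWS\<close>). It is analytic away from its zeros: a solution of \<open>w' = g w\<close> with \<open>g\<close> analytic and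
nonzero is the inverse of a primitive of \<open>1 / g\<close>. On a rising or falling branch this
applies to \<open>u\<close> itself, at a crest to a signed square root of \<open>m - u\<close>, which crosses \<open>0\<close> with nonzero speed (\<open>wave_analytic_crest\<close>).

Finally every cusped solution at the level \<open>m\<close> is a translate of this wave (\<open>orbit_eq_wave\<close>): after
a zero the rising time determines it up to the crest, at a crest \<open>u'' < 0\<close> turns it downwards, and
the falling branch determines it down to the next zero. Hence all claims about cusped solutions are
claims about one explicit function.\<close>

section \<open>Analyticity on the real line through complex extensions\<close>

text \<open>Analyticity is encoded as agreement with a complex analytic germ, so that closure under
composition, square roots and local inversion is inherited from holomorphic functions.\<close>

definition real_analytic_at :: "(real \<Rightarrow> real) \<Rightarrow> real \<Rightarrow> bool" where
  "real_analytic_at f x \<longleftrightarrow>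
     (\<exists>\<phi>. \<phi> analytic_on {complex_of_real x} \<and>
        (\<forall>\<^sub>F y in nhds x. \<phi> (of_real y) = of_real (f y)))"

lemma eventually_nhds_of_real:
  assumes "\<forall>\<^sub>F z in nhds (complex_of_real x). P z"
  shows "\<forall>\<^sub>F y in nhds x. P (of_real y)"
proof -
  have "filterlim complex_of_real (nhds (of_real x)) (nhds x)"
    by (intro tendsto_intros filterlim_ident)
  then show ?thesis
    using assms by (auto simp: filterlim_iff)
qed

lemma real_analytic_at_cong:
  assumes "real_analytic_at f x" "\<forall>\<^sub>F y in nhds x. f y = g y"
  shows "real_analytic_at g x"
proof -
  obtain \<phi> where \<phi>: "\<phi> analytic_on {complex_of_real x}"
    "\<forall>\<^sub>F y in nhds x. \<phi> (of_real y) = of_real (f y)"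
    using assms(1) by (auto simp: real_analytic_at_def)
  have "\<forall>\<^sub>F y in nhds x. \<phi> (of_real y) = of_real (g y)"
    using \<phi>(2) assms(2) by eventually_elim auto
  then show ?thesis using \<phi>(1) by (auto simp: real_analytic_at_def)
qed

lemma real_analytic_at_const [simp]: "real_analytic_at (\<lambda>_. c) x"
  unfolding real_analytic_at_def
  by (rule exI[of _ "\<lambda>_. of_real c"]) auto

lemma real_analytic_at_ident [simp]: "real_analytic_at (\<lambda>y. y) x"
  unfolding real_analytic_at_def
  by (rule exI[of _ "\<lambda>z. z"]) auto

lemma real_analytic_at_add:
  assumes "real_analytic_at f x" "real_analytic_at g x"
  shows "real_analytic_at (\<lambda>y. f y + g y) x"
proof -
  obtain \<phi> \<psi> where
    *: "\<phi> analytic_on {complex_of_real x}" "\<psi> analytic_on {complex_of_real x}" and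
    ev: "\<forall>\<^sub>F y in nhds x. \<phi> (of_real y) = of_real (f y)"
        "\<forall>\<^sub>F y in nhds x. \<psi> (of_real y) = of_real (g y)"
    using assms by (auto simp: real_analytic_at_def)
  have "\<forall>\<^sub>F y in nhds x. \<phi> (of_real y) + \<psi> (of_real y) = of_real (f y + g y)"
    using ev by eventually_elim auto
  then show ?thesis unfolding real_analytic_at_def
    using analytic_on_add[OF *] by blast
qed

lemma real_analytic_at_mult:
  assumes "real_analytic_at f x" "real_analytic_at g x"
  shows "real_analytic_at (\<lambda>y. f y * g y) x"
proof -
  obtain \<phi> \<psi> where
    *: "\<phi> analytic_on {complex_of_real x}" "\<psi> analytic_on {complex_of_real x}" and
    ev: "\<forall>\<^sub>F y in nhds x. \<phi> (of_real y) = of_real (f y)"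
        "\<forall>\<^sub>F y in nhds x. \<psi> (of_real y) = of_real (g y)"
    using assms by (auto simp: real_analytic_at_def)
  have "\<forall>\<^sub>F y in nhds x. \<phi> (of_real y) * \<psi> (of_real y) = of_real (f y * g y)"
    using ev by eventually_elim auto
  then show ?thesis unfolding real_analytic_at_def
    using analytic_on_mult[OF *] by blast
qed

lemma real_analytic_at_diff:
  assumes "real_analytic_at f x" "real_analytic_at g x"
  shows "real_analytic_at (\<lambda>y. f y - g y) x"
  using real_analytic_at_add[OF assms(1)
      real_analytic_at_mult[OF real_analytic_at_const[of "-1"] assms(2)]] by simp

lemma real_analytic_at_divide:
  assumes "real_analytic_at f x" "real_analytic_at g x" "g x \<noteq> 0"
  shows "real_analytic_at (\<lambda>y. f y / g y) x"
proof -
  obtain \<phi> \<psi> where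
    *: "\<phi> analytic_on {complex_of_real x}" "\<psi> analytic_on {complex_of_real x}" and
    ev: "\<forall>\<^sub>F y in nhds x. \<phi> (of_real y) = of_real (f y)"
        "\<forall>\<^sub>F y in nhds x. \<psi> (of_real y) = of_real (g y)"
    using assms by (auto simp: real_analytic_at_def)
  have "\<psi> (of_real x) \<noteq> 0"
    using eventually_nhds_x_imp_x[OF ev(2)] assms(3) by simp
  moreover have "\<forall>\<^sub>F y in nhds x. \<phi> (of_real y) / \<psi> (of_real y) = of_real (f y / g y)"
    using ev by eventually_elim auto
  ultimately show ?thesis unfolding real_analytic_at_def
    using analytic_on_divide[OF *] by blast
qed

text \<open>The imaginary part of the extension vanishes on the real line, hence so does that of its complex
derivative; this makes analyticity pass to derivatives.\<close>

lemma real_analytic_at_deriv_aux: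
  assumes \<phi>: "\<phi> analytic_on {complex_of_real x}"
    and ev: "\<forall>\<^sub>F y in nhds x. \<phi> (of_real y) = of_real (f y)"
  shows "(f has_real_derivative Re (deriv \<phi> (of_real x))) (at x)"
    and "deriv \<phi> (of_real x) = of_real (deriv f x)"
proof -
  have "(\<phi> has_field_derivative deriv \<phi> (of_real x)) (at (of_real x))"
    using \<phi> by (simp add: analytic_on_imp_differentiable_at DERIV_deriv_iff_field_differentiable)
  then have v: "((\<lambda>y. \<phi> (of_real y)) has_vector_derivative deriv \<phi> (of_real x)) (at x)"
    by (rule has_vector_derivative_real_field)
  have re: "((\<lambda>y. Re (\<phi> (of_real y))) has_real_derivative Re (deriv \<phi> (of_real x))) (at x)"
    using bounded_linear.has_vector_derivative[OF bounded_linear_Re v]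
    by (simp add: has_real_derivative_iff_has_vector_derivative)
  have im: "((\<lambda>y. Im (\<phi> (of_real y))) has_real_derivative Im (deriv \<phi> (of_real x))) (at x)"
    using bounded_linear.has_vector_derivative[OF bounded_linear_Im v]
    by (simp add: has_real_derivative_iff_has_vector_derivative)
  have e1: "\<forall>\<^sub>F y in nhds x. Re (\<phi> (of_real y)) = f y"
    and e2: "\<forall>\<^sub>F y in nhds x. Im (\<phi> (of_real y)) = 0"
    using ev by (eventually_elim; simp)+
  show *: "(f has_real_derivative Re (deriv \<phi> (of_real x))) (at x)"
    using re DERIV_cong_ev[OF refl e1 refl] by simp
  have "((\<lambda>y. 0) has_real_derivative Im (deriv \<phi> (of_real x))) (at x)"
    using im DERIV_cong_ev[OF refl e2 refl] by simp
  then have "Im (deriv \<phi> (of_real x)) = 0"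
    using DERIV_unique[OF _ DERIV_const] by blast
  then show "deriv \<phi> (of_real x) = of_real (deriv f x)"
    using DERIV_imp_deriv[OF *] by (simp add: complex_eq_iff)
qed

lemma real_analytic_at_has_derivative:
  assumes "real_analytic_at f x"
  shows "(f has_real_derivative deriv f x) (at x)"
proof -
  obtain \<phi> where "\<phi> analytic_on {complex_of_real x}"
    "\<forall>\<^sub>F y in nhds x. \<phi> (of_real y) = of_real (f y)"
    using assms by (auto simp: real_analytic_at_def)
  then have *: "(f has_real_derivative Re (deriv \<phi> (of_real x))) (at x)"
    by (rule real_analytic_at_deriv_aux(1))
  then show ?thesis
    using DERIV_imp_deriv[OF *] by simp
qed

lemma real_analytic_at_isCont:
  assumes "real_analytic_at f x" shows "isCont f x"
  by (rule DERIV_isCont[OF real_analytic_at_has_derivative[OF assms]])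

text \<open>One extension serves all nearby points, which is what allows the derivative to be extended as a
function and not only at a single point.\<close>

lemma real_analytic_at_eventually_aux:
  assumes "\<phi> analytic_on {complex_of_real x}"
    and "\<forall>\<^sub>F y in nhds x. \<phi> (of_real y) = of_real (f y)"
  shows "\<forall>\<^sub>F y in nhds x. \<phi> analytic_on {complex_of_real y} \<and>
           (\<forall>\<^sub>F y' in nhds y. \<phi> (of_real y') = of_real (f y'))"
proof (rule eventually_conj)
  obtain A where A: "open A" "complex_of_real x \<in> A" "\<phi> analytic_on A"
    using assms(1) by (auto simp: analytic_at analytic_on_open)
  have "\<forall>\<^sub>F z in nhds (complex_of_real x). \<phi> analytic_on {z}"
    unfolding eventually_nhds
    by (intro exI[of _ A] conjI ballI A(1,2) analytic_on_subset[OF A(3)]) auto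
  then show "\<forall>\<^sub>F y in nhds x. \<phi> analytic_on {complex_of_real y}"
    by (rule eventually_nhds_of_real)
  show "\<forall>\<^sub>F y in nhds x. \<forall>\<^sub>F y' in nhds y. \<phi> (of_real y') = of_real (f y')"
    using assms(2) by (simp add: eventually_eventually)
qed

lemma real_analytic_at_eventually:
  assumes "real_analytic_at f x"
  shows "\<forall>\<^sub>F y in nhds x. real_analytic_at f y"
proof -
  obtain \<phi> where \<phi>: "\<phi> analytic_on {complex_of_real x}"
    "\<forall>\<^sub>F y in nhds x. \<phi> (of_real y) = of_real (f y)"
    using assms by (auto simp: real_analytic_at_def)
  show ?thesis
    using real_analytic_at_eventually_aux[OF \<phi>]
    by eventually_elim (auto simp: real_analytic_at_def)
qed

lemma real_analytic_at_deriv: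
  assumes "real_analytic_at f x"
  shows "real_analytic_at (deriv f) x"
proof -
  obtain \<phi> where \<phi>: "\<phi> analytic_on {complex_of_real x}"
    "\<forall>\<^sub>F y in nhds x. \<phi> (of_real y) = of_real (f y)"
    using assms by (auto simp: real_analytic_at_def)
  have "\<forall>\<^sub>F y in nhds x. deriv \<phi> (of_real y) = of_real (deriv f y)"
    using real_analytic_at_eventually_aux[OF \<phi>]
    by eventually_elim (auto intro: real_analytic_at_deriv_aux)
  then show ?thesis
    unfolding real_analytic_at_def using analytic_deriv[OF \<phi>(1)] by blast
qed

lemma real_analytic_at_imp_smooth_on:
  assumes "\<And>x. x \<in> A \<Longrightarrow> real_analytic_at f x"
  shows "smooth_on A f"
proof -
  have "real_analytic_at ((deriv ^^ k) f) x" if "x \<in> A" for k x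
    using assms[OF that] by (induction k) (auto intro: real_analytic_at_deriv)
  then show ?thesis
    unfolding smooth_on_def
    using real_analytic_at_has_derivative real_differentiable_def by blast
qed

lemma real_analytic_at_compose:
  assumes f: "real_analytic_at f (g x)" and g: "real_analytic_at g x"
  shows "real_analytic_at (\<lambda>y. f (g y)) x"
proof -
  obtain \<phi> where \<phi>: "\<phi> analytic_on {complex_of_real (g x)}"
    "\<forall>\<^sub>F y in nhds (g x). \<phi> (of_real y) = of_real (f y)"
    using f by (auto simp: real_analytic_at_def)
  obtain \<psi> where \<psi>: "\<psi> analytic_on {complex_of_real x}"
    "\<forall>\<^sub>F y in nhds x. \<psi> (of_real y) = of_real (g y)"
    using g by (auto simp: real_analytic_at_def)
  have x: "\<psi> (of_real x) = of_real (g x)"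
    using eventually_nhds_x_imp_x[OF \<psi>(2)] .
  have an: "(\<phi> \<circ> \<psi>) analytic_on {complex_of_real x}"
    by (rule analytic_on_compose_gen[OF \<psi>(1) \<phi>(1)]) (simp add: x)
  have "filterlim g (nhds (g x)) (nhds x)"
    using real_analytic_at_isCont[OF g] by (simp add: isCont_def tendsto_at_iff_tendsto_nhds)
  then have "\<forall>\<^sub>F y in nhds x. \<phi> (of_real (g y)) = of_real (f (g y))"
    using \<phi>(2) by (auto simp: filterlim_iff)
  then have "\<forall>\<^sub>F y in nhds x. (\<phi> \<circ> \<psi>) (of_real y) = of_real (f (g y))"
    using \<psi>(2) by eventually_elim auto
  then show ?thesis using an by (auto simp: real_analytic_at_def)
qed

lemma real_analytic_at_sqrt:
  assumes "x > 0" shows "real_analytic_at sqrt x"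
proof -
  have "csqrt analytic_on {complex_of_real x}"
    by (rule analytic_on_subset[OF analytic_on_csqrt])
      (use assms in \<open>auto simp: complex_nonpos_Reals_iff\<close>)
  moreover have "\<forall>\<^sub>F y in nhds x. y > 0"
    by (rule order_tendstoD(1)[OF filterlim_ident assms])
  then have "\<forall>\<^sub>F y in nhds x. csqrt (of_real y) = of_real (sqrt y)"
    by eventually_elim auto
  ultimately show ?thesis by (auto simp: real_analytic_at_def)
qed

lemma real_analytic_at_sqrt_compose:
  assumes "real_analytic_at f x" "f x > 0"
  shows "real_analytic_at (\<lambda>y. sqrt (f y)) x"
  using real_analytic_at_compose[OF real_analytic_at_sqrt[OF assms(2)] assms(1)] .

lemma real_analytic_on_imp_at:
  assumes "real_analytic_on f A" "x \<in> A"
  shows "real_analytic_at f x"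
proof -
  obtain r a where r: "r > 0"
    and a: "\<And>y. \<bar>y - x\<bar> < r \<Longrightarrow> (\<lambda>n. a n * (y - x) ^ n) sums f y"
    using assms unfolding real_analytic_on_def by blast
  define c where "c n = complex_of_real (a n)" for n
  have sm: "summable (\<lambda>n. c n * (z - of_real x) ^ n)" if "z \<in> ball (of_real x) r" for z
  proof -
    have "cmod (z - of_real x) < r"
      using that by (simp add: dist_norm norm_minus_commute)
    then obtain \<rho> where \<rho>: "cmod (z - of_real x) < \<rho>" "\<rho> < r"
      using dense by blast
    then have "0 \<le> \<rho>" using norm_ge_zero[of "z - of_real x"] by linarith
    then have "summable (\<lambda>n. c n * (of_real \<rho>) ^ n)"
      using summable_of_real[OF sums_summable[OF a[of "x + \<rho>"]], where ?'a = complex] \<rho>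
      by (simp add: c_def)
    then show ?thesis
      by (rule powser_inside) (use \<open>0 \<le> \<rho>\<close> \<rho> in simp)
  qed
  define \<phi> where "\<phi> z = (\<Sum>n. c n * (z - of_real x) ^ n)" for z
  have "\<phi> analytic_on ball (of_real x) r"
    by (rule power_series_analytic[where a = c])
      (unfold \<phi>_def, intro summable_sums sm)
  then have "\<phi> analytic_on {of_real x}"
    by (rule analytic_on_subset) (use r in auto)
  moreover have "\<forall>\<^sub>F y in nhds x. \<phi> (of_real y) = of_real (f y)"
    unfolding eventually_nhds_metric
  proof (intro exI conjI allI impI)
    fix y assume "dist y x < r"
    then have "(\<lambda>n. of_real (a n * (y - x) ^ n)) sums complex_of_real (f y)"
      by (intro sums_of_real a) (simp add: dist_real_def)
    then show "\<phi> (of_real y) = of_real (f y)"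
      unfolding \<phi>_def c_def by (simp add: sums_iff)
  qed (rule r)
  ultimately show ?thesis by (auto simp: real_analytic_at_def)
qed

text \<open>On the real line the powers of \<open>y - x\<close> are real, so the real parts of the complex Taylor coefficients
sum to the real part of the extension, which is \<open>f\<close>.\<close>

lemma real_analytic_onI:
  assumes "\<And>x. x \<in> A \<Longrightarrow> real_analytic_at f x"
  shows "real_analytic_on f A"
  unfolding real_analytic_on_def
proof
  fix x assume "x \<in> A"
  then obtain \<phi> where \<phi>: "\<phi> analytic_on {complex_of_real x}"
    "\<forall>\<^sub>F y in nhds x. \<phi> (of_real y) = of_real (f y)"
    using assms by (auto simp: real_analytic_at_def)
  obtain d where d: "d > 0" "\<And>y. dist y x < d \<Longrightarrow> \<phi> (of_real y) = of_real (f y)"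
    using \<phi>(2) unfolding eventually_nhds_metric by blast
  obtain e where e: "e > 0" "\<phi> holomorphic_on ball (of_real x) e"
    using \<phi>(1) by (auto simp: analytic_on_def)
  define r where "r = min d e"
  define b where "b n = (deriv ^^ n) \<phi> (of_real x) / fact n" for n
  have "(\<lambda>n. Re (b n) * (y - x) ^ n) sums f y" if y: "\<bar>y - x\<bar> < r" for y
  proof -
    have "complex_of_real y \<in> ball (of_real x) e"
      using y by (simp add: r_def dist_real_def abs_minus_commute)
    then have "(\<lambda>n. b n * (of_real y - of_real x) ^ n) sums \<phi> (of_real y)"
      unfolding b_def by (rule holomorphic_power_series[OF e(2)])
    then have "(\<lambda>n. Re (b n * (of_real y - of_real x) ^ n)) sums Re (\<phi> (of_real y))"
      by (rule sums_Re)
    moreover have "Re (b n * (of_real y - of_real x) ^ n) = Re (b n) * (y - x) ^ n" for n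
    proof -
      have "(complex_of_real y - of_real x) ^ n = of_real ((y - x) ^ n)" by simp
      then show ?thesis
        by (simp only: Re_complex_of_real Im_complex_of_real times_complex.sel mult_zero_right diff_zero)
    qed
    ultimately show ?thesis
      using d(2)[of y] y by (simp add: r_def dist_real_def)
  qed
  moreover have "r > 0" using d e by (simp add: r_def)
  ultimately show "\<exists>r>0. \<exists>a. \<forall>y. \<bar>y - x\<bar> < r \<longrightarrow> (\<lambda>n. a n * (y - x) ^ n) sums f y"
    by (intro exI[of _ r] conjI exI[of _ "\<lambda>n. Re (b n)"]) auto
qed

text \<open>The quotient has a removable singularity at \<open>m\<close>. It factors the simple zero of \<open>f m - f x\<close> out,
which turns the square root in the energy relation into an analytic function at a crest.\<close>

lemma real_analytic_at_divided_difference: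
  assumes "real_analytic_at f m"
  shows "real_analytic_at (\<lambda>x. if x = m then deriv f m else (f m - f x) / (m - x)) m"
proof -
  obtain \<phi> where \<phi>: "\<phi> analytic_on {complex_of_real m}"
    "\<forall>\<^sub>F y in nhds m. \<phi> (of_real y) = of_real (f y)"
    using assms by (auto simp: real_analytic_at_def)
  obtain A where A: "open A" "complex_of_real m \<in> A" "\<phi> holomorphic_on A"
    using \<phi>(1) by (auto simp: analytic_at)
  let ?k = "\<lambda>z. if z = of_real m then deriv \<phi> (of_real m)
                 else (\<phi> z - \<phi> (of_real m)) / (z - of_real m)"
  have "?k analytic_on {of_real m}"
    using pole_lemma_open[OF A(3,1)] A by (auto simp: analytic_at)
  moreover have "\<forall>\<^sub>F y in nhds m. ?k (of_real y) =
      of_real (if y = m then deriv f m else (f m - f y) / (m - y))"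
    using \<phi>(2)
  proof eventually_elim
    case (elim y)
    then show ?case
      using real_analytic_at_deriv_aux(2)[OF \<phi>] eventually_nhds_x_imp_x[OF \<phi>(2)]
      by (auto simp: divide_simps) (simp add: algebra_simps)
  qed
  ultimately show ?thesis unfolding real_analytic_at_def by blast
qed

text \<open>With \<open>H\<close> a primitive of \<open>1 / g\<close>, the equation says that \<open>H \<circ> w\<close> is a translation in \<open>t\<close>, so \<open>w\<close> is a
translate of the local holomorphic inverse of \<open>H\<close>. The equation is required only in a punctured
neighbourhood, because the variable used at a crest is differentiated only beside the crest.\<close>

lemma real_analytic_at_autonomous_ode:
  assumes g: "real_analytic_at g (w t0)" "g (w t0) \<noteq> 0"
    and cont: "isCont w t0"
    and ode: "\<forall>\<^sub>F t in at t0. (w has_real_derivative g (w t)) (at t)"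
  shows "real_analytic_at w t0"
proof -
  obtain \<gamma> where \<gamma>: "\<gamma> analytic_on {complex_of_real (w t0)}"
    "\<forall>\<^sub>F y in nhds (w t0). \<gamma> (of_real y) = of_real (g y)"
    using g by (auto simp: real_analytic_at_def)
  let ?z0 = "complex_of_real (w t0)"
  have \<gamma>0: "\<gamma> ?z0 \<noteq> 0"
    using eventually_nhds_x_imp_x[OF \<gamma>(2)] g(2) by simp
  then have "(\<lambda>z. 1 / \<gamma> z) analytic_on {?z0}"
    by (intro analytic_on_divide \<gamma>) auto
  then obtain e where e: "e > 0" "(\<lambda>z. 1 / \<gamma> z) holomorphic_on ball ?z0 e"
    by (auto simp: analytic_on_def)
  obtain H where H: "\<And>z. z \<in> ball ?z0 e \<Longrightarrow> (H has_field_derivative 1 / \<gamma> z) (at z)"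
    using holomorphic_convex_primitive'[OF convex_ball open_ball e(2)]
    by (metis at_within_open open_ball)
  have "H holomorphic_on ball ?z0 e"
    using H holomorphic_on_open by blast
  moreover have "deriv H ?z0 \<noteq> 0"
    using DERIV_imp_deriv[OF H[of ?z0]] e(1) \<gamma>0 by simp
  ultimately obtain r where r: "r > 0" "ball ?z0 r \<subseteq> ball ?z0 e" "inj_on H (ball ?z0 r)"
    using has_complex_derivative_locally_injective[of H "ball ?z0 e" ?z0] e(1) by auto
  have holH: "H holomorphic_on ball ?z0 r"
    using \<open>H holomorphic_on ball ?z0 e\<close> r(2) holomorphic_on_subset by blast
  obtain L where L: "L holomorphic_on H ` ball ?z0 r" "\<And>z. z \<in> ball ?z0 r \<Longrightarrow> L (H z) = z"
    using holomorphic_has_inverse[OF holH open_ball r(3)] by metis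
  have opn: "open (H ` ball ?z0 r)"
    by (rule open_mapping_thm3[OF holH open_ball r(3)])
  obtain d1 where d1: "d1 > 0" "\<And>y. dist y (w t0) < d1 \<Longrightarrow> \<gamma> (of_real y) = of_real (g y)"
    using \<gamma>(2) unfolding eventually_nhds_metric by blast
  define d where "d = min d1 r"
  have d: "d > 0" using d1 r by (simp add: d_def)
  have "\<forall>\<^sub>F t in nhds t0. dist (w t) (w t0) < d"
    using cont d unfolding isCont_def tendsto_at_iff_tendsto_nhds by (rule tendstoD)
  then obtain e1 where e1: "e1 > 0" "\<And>t. dist t t0 < e1 \<Longrightarrow> dist (w t) (w t0) < d"
    unfolding eventually_nhds_metric by blast
  obtain e2 where e2: "e2 > 0"
    "\<And>t. t \<noteq> t0 \<Longrightarrow> dist t t0 < e2 \<Longrightarrow> (w has_real_derivative g (w t)) (at t)"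
    using ode unfolding eventually_at by blast
  define e3 where "e3 = min e1 e2"
  have e3: "e3 > 0" using e1 e2 by (simp add: e3_def)
  define c where "c = H ?z0 - of_real t0"
  \<comment> \<open>\<open>H\<close> is a primitive of \<open>1 / g\<close>, so along the solution \<open>H \<circ> w\<close> advances at unit speed.\<close>
  have Hw: "H (of_real (w t)) = of_real t + c" if "dist t t0 < e3" for t
  proof -
    let ?f = "\<lambda>t. H (of_real (w t)) - of_real t"
    have inb: "complex_of_real (w t) \<in> ball ?z0 r" if "t \<in> ball t0 e3" for t
      using e1(2)[of t] that by (simp add: e3_def d_def dist_commute)
    have wc: "isCont w t" if "t \<in> ball t0 e3" for t
      using e2(2)[of t] cont that DERIV_isCont by (cases "t = t0") (auto simp: e3_def dist_commute)
    have Hc: "isCont H (of_real (w t))" if "t \<in> ball t0 e3" for t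
      using H[of "of_real (w t)"] inb[OF that] r(2) DERIV_isCont by blast
    have "?f t = c"
    proof (rule has_derivative_zero_unique_strong_convex[of "ball t0 e3" "{t0}" ?f t0 c t])
      have "isCont (\<lambda>t. H (of_real (w t))) t" if "t \<in> ball t0 e3" for t
        using isCont_o2[where f = "\<lambda>t. complex_of_real (w t)" and g = H and a = t] wc[OF that] Hc[OF that]
        by (simp add: continuous_of_real)
      then show "continuous_on (ball t0 e3) ?f"
        by (intro continuous_intros) (auto intro: continuous_at_imp_continuous_on)
    next
      fix t assume t: "t \<in> ball t0 e3 - {t0}"
      have w: "(w has_real_derivative g (w t)) (at t)"
        using e2(2)[of t] t by (simp add: e3_def dist_commute)
      have 1: "((\<lambda>t. complex_of_real (w t)) has_vector_derivative of_real (g (w t))) (at t)"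
        using w by (intro has_vector_derivative_of_real)
      have 2: "(H has_field_derivative 1 / \<gamma> (of_real (w t))) (at (of_real (w t)))"
        using H[of "of_real (w t)"] inb[of t] r(2) t by blast
      have 3: "((\<lambda>t. H (of_real (w t))) has_vector_derivative
          (of_real (g (w t)) * (1 / \<gamma> (of_real (w t))))) (at t)"
        using field_vector_diff_chain_at[OF 1 2] by (simp add: o_def)
      have 4: "\<gamma> (of_real (w t)) = of_real (g (w t))"
        using d1(2)[of "w t"] e1(2)[of t] t by (simp add: e3_def d_def dist_commute)
      have "1 / \<gamma> (of_real (w t)) \<noteq> 0"
      proof
        assume "1 / \<gamma> (of_real (w t)) = 0"
        moreover have "deriv H (of_real (w t)) \<noteq> 0"
          using holomorphic_injective_imp_regular[OF holH open_ball r(3)] inb[of t] t by auto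
        ultimately show False using DERIV_imp_deriv[OF 2] by simp
      qed
      then have "of_real (g (w t)) * (1 / \<gamma> (of_real (w t))) = 1"
        by (simp add: 4)
      then have "((\<lambda>t. H (of_real (w t))) has_vector_derivative 1) (at t)"
        using 3 by simp
      moreover have "((\<lambda>t. complex_of_real t) has_vector_derivative of_real 1) (at t)"
        by (intro has_vector_derivative_of_real DERIV_ident)
      ultimately have "(?f has_vector_derivative 1 - of_real 1) (at t)"
        by (rule has_vector_derivative_diff)
      then have "(?f has_vector_derivative 0) (at t within ball t0 e3)"
        by (simp add: has_vector_derivative_at_within)
      then show "(?f has_derivative (\<lambda>h. 0)) (at t within ball t0 e3)"
        by (simp add: has_vector_derivative_def)
    qed (use that e3 in \<open>auto simp: c_def dist_commute\<close>)
    then show ?thesis by (simp add: algebra_simps)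
  qed
  define \<psi> where "\<psi> z = L (z + c)" for z
  have "\<psi> analytic_on {of_real t0}"
  proof -
    have "of_real t0 + c \<in> H ` ball ?z0 r"
      using r(1) by (simp add: c_def)
    then have "L analytic_on {of_real t0 + c}"
      using L(1) opn by (auto simp: analytic_at)
    then have "(L \<circ> (\<lambda>z. z + c)) analytic_on {of_real t0}"
      by (intro analytic_on_compose analytic_intros) auto
    then show ?thesis by (simp add: \<psi>_def[abs_def] o_def)
  qed
  moreover have "\<forall>\<^sub>F t in nhds t0. \<psi> (of_real t) = of_real (w t)"
    unfolding eventually_nhds_metric
  proof (intro exI conjI allI impI)
    fix t assume t: "dist t t0 < e3"
    then have "dist (w t) (w t0) < r"
      using e1(2)[of t] by (simp add: e3_def d_def)
    then have "complex_of_real (w t) \<in> ball ?z0 r"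
      by (simp add: dist_commute)
    then show "\<psi> (of_real t) = of_real (w t)"
      using L(2) Hw[OF t] by (metis \<psi>_def)
  qed (rule e3)
  ultimately show ?thesis by (auto simp: real_analytic_at_def)
qed

section \<open>Weak solutions that are classical up to locally finitely many points\<close>

text \<open>The interval is enlarged so that the test function also vanishes at its end points, which kills the
boundary terms.\<close>

lemma test_functionE:
  assumes "test_function \<phi>"
  obtains a b where "a < b" "\<And>t. t \<notin> {a..b} \<Longrightarrow> \<phi> t = 0" "\<And>t. t \<notin> {a..b} \<Longrightarrow> deriv \<phi> t = 0"
    "\<And>t. (\<phi> has_real_derivative deriv \<phi> t) (at t)" "continuous_on UNIV \<phi>"
    "continuous_on UNIV (deriv \<phi>)" "\<phi> a = 0" "\<phi> b = 0"
proof -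
  obtain a0 b0 where ab: "\<And>t. t \<notin> {a0..b0} \<Longrightarrow> \<phi> t = 0"
    using assms by (auto simp: test_function_def)
  have diff: "((deriv ^^ k) \<phi>) differentiable (at t)" for k t
    using assms by (auto simp: test_function_def smooth_on_def)
  define a b where "a = min a0 b0 - 1" and "b = max a0 b0 + 1"
  have z: "\<phi> t = 0" if "t \<le> a \<or> t \<ge> b" for t
    by (rule ab) (use that in \<open>auto simp: a_def b_def\<close>)
  show ?thesis
  proof (rule that)
    show "a < b" by (simp add: a_def b_def)
    show "\<phi> t = 0" if "t \<notin> {a..b}" for t using that z[of t] by auto
    show "deriv \<phi> t = 0" if "t \<notin> {a..b}" for t
    proof -
      have "\<forall>\<^sub>F s in nhds t. s \<in> - {a..b}"
        by (rule eventually_nhds_in_open) (use that in auto)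
      then have "\<forall>\<^sub>F s in nhds t. \<phi> s = 0"
        by eventually_elim (use z in auto)
      then have "deriv \<phi> t = deriv (\<lambda>_. 0) t" by (rule deriv_cong_ev) simp
      then show ?thesis by simp
    qed
    show "(\<phi> has_real_derivative deriv \<phi> t) (at t)" for t
      using diff[of 0 t] by (simp add: DERIV_deriv_iff_real_differentiable)
    then show "continuous_on UNIV \<phi>"
      by (intro continuous_at_imp_continuous_on ballI DERIV_isCont)
    show "continuous_on UNIV (deriv \<phi>)"
      using diff[of 1]
        by (intro continuous_at_imp_continuous_on ballI differentiable_imp_continuous_within) auto
    show "\<phi> a = 0" "\<phi> b = 0" using z by auto
  qed
qed

lemma L1_loc_continuous:
  assumes "continuous_on UNIV f" shows "L1_loc f"
  unfolding L1_loc_def set_integrable_def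
proof (intro conjI allI)
  show "f \<in> borel_measurable borel"
    using assms by (rule borel_measurable_continuous_onI)
  show "integrable lborel (\<lambda>t. indicator {a..b} t *\<^sub>R f t)" for a b
    by (intro borel_integrable_compact continuous_on_subset[OF assms]) auto
qed

lemma L1_loc_nonneg:
  assumes "f \<in> borel_measurable borel" "\<And>t. 0 \<le> f t" "\<And>a b. f integrable_on {a..b}"
  shows "L1_loc f"
proof -
  have "set_integrable lborel {a..b} f" for a b
  proof -
    have "f absolutely_integrable_on {a..b}"
      by (subst absolutely_integrable_on_iff_nonneg) (use assms in auto)
    then show ?thesis
      unfolding set_integrable_def by (subst (asm) integrable_completion) (use assms in auto)
  qed
  then show ?thesis using assms by (simp add: L1_loc_def)
qed

text \<open>The fundamental theorem of calculus tolerates finitely many exceptional points for a continuous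
primitive, and the support of a test function meets only finitely many points of \<open>E\<close>.\<close>

lemma weak_integration_by_parts:
  assumes f: "continuous_on UNIV f"
    and E: "\<And>a b. finite (E \<inter> {a..b})"
    and der: "\<And>t. t \<notin> E \<Longrightarrow> (f has_real_derivative g t) (at t)"
    and g: "L1_loc g" and \<phi>: "test_function \<phi>"
  shows "integrable lborel (\<lambda>t. f t * deriv \<phi> t)"
    and "integrable lborel (\<lambda>t. g t * \<phi> t)"
    and "(\<integral>t. f t * deriv \<phi> t \<partial>lborel) = - (\<integral>t. g t * \<phi> t \<partial>lborel)"
proof -
  obtain a b where ab: "a < b"
    and z: "\<And>t. t \<notin> {a..b} \<Longrightarrow> \<phi> t = 0" "\<And>t. t \<notin> {a..b} \<Longrightarrow> deriv \<phi> t = 0"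
    and d\<phi>: "\<And>t. (\<phi> has_real_derivative deriv \<phi> t) (at t)"
    and c\<phi>: "continuous_on UNIV \<phi>" "continuous_on UNIV (deriv \<phi>)"
    and ze: "\<phi> a = 0" "\<phi> b = 0"
    by (rule test_functionE[OF \<phi>]) blast
  have "integrable lborel (\<lambda>t. indicator {a..b} t *\<^sub>R (f t * deriv \<phi> t))"
    by (intro borel_integrable_compact continuous_intros continuous_on_subset[OF f]
        continuous_on_subset[OF c\<phi>(2)]) auto
  also have "(\<lambda>t. indicator {a..b} t *\<^sub>R (f t * deriv \<phi> t)) = (\<lambda>t. f t * deriv \<phi> t)"
    using z by (auto simp: indicator_def fun_eq_iff)
  finally show 1: "integrable lborel (\<lambda>t. f t * deriv \<phi> t)" .
  have "bounded (\<phi> ` {a..b})"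
    by (intro compact_imp_bounded compact_continuous_image continuous_on_subset[OF c\<phi>(1)]) auto
  then obtain B where B: "\<And>t. t \<in> {a..b} \<Longrightarrow> \<bar>\<phi> t\<bar> \<le> B"
    unfolding bounded_iff by (metis imageI real_norm_def)
  have gm: "g \<in> borel_measurable borel" and gi: "integrable lborel (\<lambda>t. indicator {a..b} t *\<^sub>R g t)"
    using g by (auto simp: L1_loc_def set_integrable_def)
  have \<phi>m: "\<phi> \<in> borel_measurable borel" using c\<phi>(1) by (rule borel_measurable_continuous_onI)
  show 2: "integrable lborel (\<lambda>t. g t * \<phi> t)"
  proof (rule Bochner_Integration.integrable_bound)
    show "integrable lborel (\<lambda>t. B * (indicator {a..b} t *\<^sub>R g t))"
      by (intro integrable_mult_right gi)
    show "(\<lambda>t. g t * \<phi> t) \<in> borel_measurable lborel" using gm \<phi>m by measurable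
    have "norm (g t * \<phi> t) \<le> norm (B * (indicator {a..b} t *\<^sub>R g t))" for t
    proof (cases "t \<in> {a..b}")
      case True
      then have "\<bar>g t\<bar> * \<bar>\<phi> t\<bar> \<le> \<bar>g t\<bar> * \<bar>B\<bar>"
        by (intro mult_left_mono order_trans[OF B abs_ge_self]) auto
      then show ?thesis using True by (simp add: abs_mult mult.commute)
    qed (simp add: z)
    then show "AE t in lborel. norm (g t * \<phi> t) \<le> norm (B * (indicator {a..b} t *\<^sub>R g t))"
      by simp
  qed
  let ?h = "\<lambda>t. f t * deriv \<phi> t + g t * \<phi> t"
  have "(?h has_integral (\<integral>t. ?h t \<partial>lborel)) UNIV"
    by (intro has_integral_integral_lborel Bochner_Integration.integrable_add 1 2)
  moreover have "(?h has_integral (f b * \<phi> b - f a * \<phi> a)) {a..b}"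
  proof (rule fundamental_theorem_of_calculus_interior_strong[of "E \<inter> {a..b}"])
    fix t assume "t \<in> {a<..<b} - E \<inter> {a..b}"
    then have "(f has_real_derivative g t) (at t)" by (intro der) auto
    from DERIV_mult[OF this d\<phi>]
    show "((\<lambda>t. f t * \<phi> t) has_vector_derivative ?h t) (at t)"
      by (simp add: has_real_derivative_iff_has_vector_derivative algebra_simps)
  qed (use E ab f c\<phi> in \<open>auto intro!: continuous_intros intro: continuous_on_subset\<close>)
  then have "(?h has_integral 0) UNIV"
    using ze z by (intro has_integral_on_superset[of ?h 0 "{a..b}" UNIV]) auto
  ultimately have "(\<integral>t. ?h t \<partial>lborel) = 0" by (rule has_integral_unique)
  then show "(\<integral>t. f t * deriv \<phi> t \<partial>lborel) = - (\<integral>t. g t * \<phi> t \<partial>lborel)"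
    using Bochner_Integration.integral_add[OF 1 2] by simp
qed

lemma weak_derivI:
  assumes "continuous_on UNIV f" "\<And>a b. finite (E \<inter> {a..b})"
    and "\<And>t. t \<notin> E \<Longrightarrow> (f has_real_derivative g t) (at t)" "L1_loc g"
  shows "weak_deriv f g"
  unfolding weak_deriv_def using weak_integration_by_parts(3)[OF assms] L1_loc_continuous assms(1,4)
  by blast

text \<open>Continuity of the flux \<open>u * v\<close> is the whole content at an exceptional point. It makes
\<open>v\<^sup>2 - 2 * deriv F u\<close>, the derivative of twice the flux, integrable, and hence \<open>v\<^sup>2\<close> too, so \<open>u\<close> lies in
the local Sobolev space although \<open>v\<close> may be unbounded. Setting \<open>v\<close> to \<open>0\<close> at the zeros of \<open>u\<close> makes it
measurable as the quotient of the flux by \<open>u\<close>.\<close>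

lemma TWS_of_piecewise_classical:
  assumes u: "continuous_on UNIV u" "bounded (range u)" "\<And>t. 0 \<le> u t"
    and F: "continuous_on UNIV (deriv F)"
    and E: "\<And>a b. finite (E \<inter> {a..b})"
    and v: "\<And>t. t \<notin> E \<Longrightarrow> (u has_real_derivative v t) (at t)" "\<And>t. u t = 0 \<Longrightarrow> v t = 0"
    and flux: "continuous_on UNIV (\<lambda>t. u t * v t)"
    and flux': "\<And>t. t \<notin> E \<Longrightarrow>
      ((\<lambda>t. u t * v t) has_real_derivative (v t)\<^sup>2 / 2 - deriv F (u t)) (at t)"
  shows "TWS F u"
proof -
  have um: "u \<in> borel_measurable borel" and pm: "(\<lambda>t. u t * v t) \<in> borel_measurable borel"
    using u(1) flux by (auto intro: borel_measurable_continuous_onI)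
  have v_eq: "v = (\<lambda>t. (u t * v t) / u t)"
    using v(2) by (auto simp: fun_eq_iff)
  have vm: "v \<in> borel_measurable borel"
    by (subst v_eq) (intro borel_measurable_divide um pm)
  have Fu: "continuous_on UNIV (\<lambda>t. deriv F (u t))"
    using continuous_on_compose2[OF F u(1)] by simp
  define w where "w t = 2 * (u t * v t)" for t
  define g where "g t = (v t)\<^sup>2 - 2 * deriv F (u t)" for t
  have cw: "continuous_on UNIV w" unfolding w_def by (intro continuous_intros flux)
  have dw: "(w has_real_derivative g t) (at t)" if "t \<notin> E" for t
    using DERIV_cmult[OF flux'[OF that], of 2] by (simp add: w_def[abs_def] g_def algebra_simps)
  have "(\<lambda>t. (v t)\<^sup>2) integrable_on {a..b}" for a b
  proof (cases "a \<le> b")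
    case True
    have "(g has_integral (w b - w a)) {a..b}"
    proof (rule fundamental_theorem_of_calculus_interior_strong[of "E \<inter> {a..b}"])
      show "(w has_vector_derivative g t) (at t)" if "t \<in> {a<..<b} - E \<inter> {a..b}" for t
        using dw[of t] that by (auto simp: has_real_derivative_iff_has_vector_derivative)
    qed (use E True cw in \<open>auto intro: continuous_on_subset\<close>)
    moreover have "(\<lambda>t. 2 * deriv F (u t)) integrable_on {a..b}"
      by (intro integrable_continuous_interval continuous_intros continuous_on_subset[OF Fu]) auto
    ultimately have "(\<lambda>t. g t + 2 * deriv F (u t)) integrable_on {a..b}"
      by (intro integrable_add) (auto simp: integrable_on_def)
    then show ?thesis by (simp add: g_def)
  qed (auto intro!: integrable_on_empty)
  then have v2: "L1_loc (\<lambda>t. (v t)\<^sup>2)"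
    using borel_measurable_power[OF vm] by (intro L1_loc_nonneg) auto
  have "set_integrable lborel {a..b} v" for a b
  proof (rule set_integrable_bound)
    have "set_integrable lborel {a..b} (\<lambda>t. 1::real)" "set_integrable lborel {a..b} (\<lambda>t. (v t)\<^sup>2)"
      using L1_loc_continuous[of "\<lambda>_. 1"] v2 by (auto simp: L1_loc_def)
    then show "set_integrable lborel {a..b} (\<lambda>t. 1 + (v t)\<^sup>2)"
      by (rule set_integral_add)
    show "set_borel_measurable lborel {a..b} v"
      using vm by (simp add: set_borel_measurable_def)
    have "\<bar>x\<bar> \<le> 1 + x\<^sup>2" for x :: real
      using sum_squares_bound[of "\<bar>x\<bar>" 1] by (auto simp: power2_eq_square)
    then show "AE x in lborel. x \<in> {a..b} \<longrightarrow> norm (v x) \<le> norm (1 + (v x)\<^sup>2)"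
      by (intro AE_I2) (auto intro: order_trans[OF _ abs_ge_self])
  qed
  then have v1: "L1_loc v" using vm by (simp add: L1_loc_def)
  have g1: "L1_loc g"
  proof -
    have "L1_loc (\<lambda>t. 2 * deriv F (u t))"
      by (intro L1_loc_continuous continuous_intros Fu)
    then show ?thesis
      using v2
        by (auto simp: L1_loc_def g_def[abs_def] intro!: set_integral_diff borel_measurable_diff)
  qed
  have wd: "weak_deriv u v" by (rule weak_derivI[OF u(1) E v(1) v1])
  have wd2: "weak_deriv (\<lambda>t. (u t)\<^sup>2) w"
  proof (rule weak_derivI[OF _ E])
    show "((\<lambda>t. (u t)\<^sup>2) has_real_derivative w t) (at t)" if "t \<notin> E" for t
      using DERIV_power[OF v(1)[OF that], of 2] by (simp add: w_def algebra_simps)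
  qed (auto intro!: continuous_intros u L1_loc_continuous cw)
  have "L1_loc (\<lambda>t. (u t)\<^sup>2)"
    by (intro L1_loc_continuous continuous_intros u)
  then have H: "H1_loc u"
    using wd v2 um vm u(1) by (auto simp: H1_loc_def L2_loc_def L1_loc_def)
  have eq: "(\<integral>t. w t * deriv \<phi> t + (v t)\<^sup>2 * \<phi> t - 2 * deriv F (u t) * \<phi> t \<partial>lborel) = 0"
    if \<phi>: "test_function \<phi>" for \<phi>
  proof -
    note * = weak_integration_by_parts[OF cw E dw g1 \<phi>]
    have "(\<integral>t. w t * deriv \<phi> t + g t * \<phi> t \<partial>lborel) = 0"
      using Bochner_Integration.integral_add[OF *(1,2)] *(3) by simp
    then show ?thesis by (simp add: g_def algebra_simps)
  qed
  show ?thesis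
    unfolding TWS_def using u H wd wd2 eq by blast
qed

section \<open>The time needed to rise to a given height\<close>

locale analytic_cusp_level =
  fixes F :: "real \<Rightarrow> real" and m :: real
  assumes F_analytic: "real_analytic_at F x"
    and level: "cusp_level F m"
begin

lemma m_pos: "0 < m" and F_less: "0 \<le> x \<Longrightarrow> x < m \<Longrightarrow> F x < F m"
  using level by (auto simp: cusp_level_def)

lemma DERIV_F: "(F has_real_derivative deriv F x) (at x)"
  by (intro real_analytic_at_has_derivative F_analytic)

lemma continuous_F: "continuous_on A F"
  by (intro continuous_at_imp_continuous_on ballI real_analytic_at_isCont F_analytic)

lemma continuous_deriv_F: "continuous_on A (deriv F)"
  by (intro continuous_at_imp_continuous_on ballI real_analytic_at_isCont real_analytic_at_deriv
      F_analytic)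

text \<open>The difference quotient of \<open>F\<close> at \<open>m\<close>; its order of vanishing at \<open>m\<close> decides whether the crest is
reached in finite time.\<close>

definition slope :: "real \<Rightarrow> real" where
  "slope x = (if x = m then deriv F m else (F m - F x) / (m - x))"

text \<open>When \<open>m\<close> is a critical point of \<open>F\<close>, this is the second order quotient, completed at \<open>m\<close> by
continuity.\<close>

definition slope2 :: "real \<Rightarrow> real" where
  "slope2 x = (if x = m then - deriv slope m else slope x / (m - x))"

lemma slope_analytic: "real_analytic_at slope m"
  using real_analytic_at_divided_difference[OF F_analytic[of m]] by (simp add: slope_def[abs_def])

lemma F_eq_slope: "F m - F x = (m - x) * slope x"
  by (simp add: slope_def)

lemma isCont_slope: "isCont slope x"
proof (cases "x = m")
  case True
  then show ?thesis using real_analytic_at_isCont[OF slope_analytic] by simp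
next
  case False
  have "isCont (\<lambda>x. (F m - F x) / (m - x)) x"
    using False by (intro continuous_intros real_analytic_at_isCont F_analytic) auto
  moreover have "\<forall>\<^sub>F y in nhds x. y \<noteq> m"
    using False by (rule t1_space_nhds)
  then have "\<forall>\<^sub>F y in nhds x. slope y = (F m - F y) / (m - y)"
    by eventually_elim (simp add: slope_def)
  ultimately show ?thesis by (subst isCont_cong)
qed

lemma deriv_nonneg: "0 \<le> deriv F m"
proof (rule tendsto_lowerbound)
  show "(slope \<longlongrightarrow> deriv F m) (at_left m)"
    using isCont_slope[of m] by (auto simp: isCont_def slope_def intro: filterlim_mono at_le)
  have "\<forall>\<^sub>F x in at_left m. x \<in> {0<..<m}"
    using m_pos by (rule eventually_at_left_real)
  then show "\<forall>\<^sub>F x in at_left m. 0 \<le> slope x"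
  proof eventually_elim
    case (elim x)
    then show ?case using F_less[of x] by (auto simp: slope_def)
  qed
qed auto

lemma positive_lower_bound:
  assumes "continuous_on {0..m} r" "\<And>x. x \<in> {0..m} \<Longrightarrow> 0 < r x"
  obtains c :: real where "0 < c" "\<And>x. x \<in> {0..m} \<Longrightarrow> c \<le> r x"
proof -
  obtain y where "y \<in> {0..m}" "\<And>x. x \<in> {0..m} \<Longrightarrow> r y \<le> r x"
    using continuous_attains_inf[OF compact_Icc _ assms(1)] m_pos by auto
  then show ?thesis using that[of "r y"] assms(2) by auto
qed

lemma simple_level_lower_bound:
  assumes "deriv F m \<noteq> 0"
  obtains c where "0 < c" "\<And>x. x \<in> {0..m} \<Longrightarrow> c * (m - x) \<le> F m - F x"
proof -
  have pos: "0 < slope x" if "x \<in> {0..m}" for x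
    using that F_less[of x] assms deriv_nonneg by (cases "x = m") (auto simp: slope_def)
  obtain c where "0 < c" "\<And>x. x \<in> {0..m} \<Longrightarrow> c \<le> slope x"
    by (rule positive_lower_bound[of slope])
      (auto intro!: continuous_at_imp_continuous_on isCont_slope pos)
  then show ?thesis
    by (intro that[of c]) (auto simp: F_eq_slope mult.commute[of c] intro!: mult_left_mono)
qed

context
  assumes critical: "deriv F m = 0"
begin

lemma isCont_slope2: "isCont slope2 x"
proof (cases "x = m")
  case True
  have "slope m = 0" using critical by (simp add: slope_def)
  then have "(\<lambda>x. if x = m then deriv slope m else (slope m - slope x) / (m - x)) = (\<lambda>x. - slope2 x)"
    by (auto simp: slope2_def)
  then have "isCont (\<lambda>x. - slope2 x) m"
    using real_analytic_at_isCont[OF real_analytic_at_divided_difference[OF slope_analytic]] by simp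
  then have "isCont (\<lambda>x. - (- slope2 x)) m" by (rule isCont_minus)
  then show ?thesis using True by simp
next
  case False
  have "isCont (\<lambda>x. slope x / (m - x)) x"
    using False by (intro continuous_intros isCont_slope) auto
  moreover have "\<forall>\<^sub>F y in nhds x. y \<noteq> m"
    using False by (rule t1_space_nhds)
  then have "\<forall>\<^sub>F y in nhds x. slope2 y = slope y / (m - y)"
    by eventually_elim (simp add: slope2_def)
  ultimately show ?thesis by (subst isCont_cong)
qed

lemma F_eq_slope2: "F m - F x = (m - x)\<^sup>2 * slope2 x"
  by (simp add: F_eq_slope slope2_def power2_eq_square)

lemma critical_level_upper_bound:
  obtains C where "0 < C" "\<And>x. x \<in> {0..m} \<Longrightarrow> F m - F x \<le> C * (m - x)\<^sup>2"
proof -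
  have "continuous_on {0..m} slope2"
    by (intro continuous_at_imp_continuous_on ballI isCont_slope2)
  then obtain y where "y \<in> {0..m}" "\<forall>x\<in>{0..m}. slope2 x \<le> slope2 y"
    using continuous_attains_sup[OF compact_Icc, of 0 m slope2] m_pos by auto
  then have "F m - F x \<le> max 1 (slope2 y) * (m - x)\<^sup>2" if "x \<in> {0..m}" for x
    using that
      by (auto simp: F_eq_slope2 mult.commute[of "max 1 _"] intro!: mult_left_mono max.coboundedI2)
  then show ?thesis by (intro that[of "max 1 (slope2 y)"]) auto
qed

lemma second_deriv_F: "(deriv ^^ 2) F m = 2 * deriv slope m"
proof -
  have ev: "\<forall>\<^sub>F x in nhds m. real_analytic_at slope x"
    by (rule real_analytic_at_eventually[OF slope_analytic])
  have F_eq: "(\<lambda>x. F m - (m - x) * slope x) = F"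
    by (auto simp: F_eq_slope[symmetric])
  have dF: "(F has_real_derivative slope x - (m - x) * deriv slope x) (at x)"
    if "real_analytic_at slope x" for x
  proof -
    have "((\<lambda>x. F m - (m - x) * slope x) has_real_derivative
        slope x - (m - x) * deriv slope x) (at x)"
      by (auto intro!: derivative_eq_intros real_analytic_at_has_derivative[OF that])
    then show ?thesis by (simp only: F_eq)
  qed
  have "\<forall>\<^sub>F x in nhds m. deriv F x = slope x - (m - x) * deriv slope x"
    using ev by eventually_elim (rule DERIV_imp_deriv[OF dF])
  then have "deriv (deriv F) m = deriv (\<lambda>x. slope x - (m - x) * deriv slope x) m"
    by (rule deriv_cong_ev) simp
  also have "\<dots> = 2 * deriv slope m"
    by (rule DERIV_imp_deriv)
      (auto intro!: derivative_eq_intros real_analytic_at_has_derivative real_analytic_at_deriv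
        slope_analytic)
  finally show ?thesis by (simp add: numeral_2_eq_2)
qed

lemma nondegenerate_level_lower_bound:
  assumes "(deriv ^^ 2) F m \<noteq> 0"
  obtains c where "0 < c" "\<And>x. x \<in> {0..m} \<Longrightarrow> c * (m - x)\<^sup>2 \<le> F m - F x"
proof -
  have pos: "0 < slope2 x" if "0 \<le> x" "x < m" for x
  proof -
    have "0 < (m - x)\<^sup>2 * slope2 x"
      using F_less[OF that] by (simp add: F_eq_slope2[symmetric])
    then show ?thesis by (rule zero_less_mult_pos) (use that in simp)
  qed
  have "0 \<le> slope2 m"
  proof (rule tendsto_lowerbound)
    show "(slope2 \<longlongrightarrow> slope2 m) (at_left m)"
      using isCont_slope2[of m] by (auto simp: isCont_def intro: filterlim_mono at_le)
    have "\<forall>\<^sub>F x in at_left m. x \<in> {0<..<m}"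
      using m_pos by (rule eventually_at_left_real)
    then show "\<forall>\<^sub>F x in at_left m. 0 \<le> slope2 x"
      by eventually_elim (use pos in \<open>auto intro: less_imp_le\<close>)
  qed auto
  then have "0 < slope2 m" using assms second_deriv_F by (simp add: slope2_def)
  then have pos: "0 < slope2 x" if "x \<in> {0..m}" for x
    using that pos[of x] by (cases "x = m") auto
  obtain c where "0 < c" "\<And>x. x \<in> {0..m} \<Longrightarrow> c \<le> slope2 x"
    by (rule positive_lower_bound[of slope2])
      (auto intro!: continuous_at_imp_continuous_on isCont_slope2 pos)
  then show ?thesis
    by (intro that[of c]) (auto simp: F_eq_slope2 mult.commute[of c] intro!: mult_left_mono)
qed

end

definition speed :: "real \<Rightarrow> real" where
  "speed x = sqrt (2 * (F m - F x) / x)"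

text \<open>The reciprocal of the speed, in a form that stays continuous at height \<open>0\<close>. At the crest, division by
zero makes it \<open>0\<close>.\<close>

definition slowness :: "real \<Rightarrow> real" where
  "slowness x = sqrt (x / (2 * (F m - F x)))"

definition time :: "real \<Rightarrow> real" where
  "time x = integral {0..x} slowness"

lemma speed_pos: "0 < x \<Longrightarrow> x < m \<Longrightarrow> 0 < speed x"
  using F_less[of x] by (simp add: speed_def)

lemma slowness_speed: "0 < x \<Longrightarrow> x < m \<Longrightarrow> slowness x = inverse (speed x)"
  using F_less[of x] by (simp add: speed_def slowness_def real_sqrt_inverse[symmetric])

lemma slowness_nonneg: "0 \<le> x \<Longrightarrow> x \<le> m \<Longrightarrow> 0 \<le> slowness x"
  using F_less[of x] by (cases "x = m") (auto simp: slowness_def)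

lemma slowness_pos: "0 < x \<Longrightarrow> x < m \<Longrightarrow> 0 < slowness x"
  by (simp add: slowness_speed speed_pos)

lemma continuous_slowness: "b < m \<Longrightarrow> continuous_on {0..b} slowness"
  unfolding slowness_def using F_less
  by (intro continuous_intros continuous_F) fastforce

lemma slowness_measurable: "slowness \<in> borel_measurable borel"
proof -
  have "F \<in> borel_measurable borel"
    using continuous_F by (rule borel_measurable_continuous_onI)
  then show ?thesis unfolding slowness_def by measurable
qed

lemma slowness_integrable: "b < m \<Longrightarrow> slowness integrable_on {0..b}"
  by (intro integrable_continuous_interval continuous_slowness)

text \<open>At a simple zero of \<open>F m - F x\<close> the integrand has an inverse square root singularity, so the crest is
reached in finite time.\<close>

lemma slowness_integrable_crest:
  assumes "deriv F m \<noteq> 0"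
  shows "slowness integrable_on {0..m}"
proof -
  obtain c where c: "0 < c" "\<And>x. x \<in> {0..m} \<Longrightarrow> c * (m - x) \<le> F m - F x"
    by (rule simple_level_lower_bound[OF assms]) blast
  define C where "C = sqrt (m / (2 * c))"
  define g where "g x = C / sqrt (m - x)" for x
  have "(g has_integral ((\<lambda>x. - 2 * C * sqrt (m - x)) m - (\<lambda>x. - 2 * C * sqrt (m - x)) 0)) {0..m}"
  proof (rule fundamental_theorem_of_calculus_interior)
    show "continuous_on {0..m} (\<lambda>x. - 2 * C * sqrt (m - x))" by (intro continuous_intros)
    fix x assume "x \<in> {0<..<m}"
    then show "((\<lambda>x. - 2 * C * sqrt (m - x)) has_vector_derivative g x) (at x)"
      unfolding has_real_derivative_iff_has_vector_derivative[symmetric] g_def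
      by (auto intro!: derivative_eq_intros simp: field_simps)
  qed (use m_pos in auto)
  then have g: "g integrable_on {0..m}" by (auto simp: integrable_on_def)
  have bound: "norm (slowness x) \<le> g x" if x: "x \<in> {0..m}" for x
  proof (cases "x = m")
    case False
    then have "x / (2 * (F m - F x)) \<le> m / (2 * (c * (m - x)))"
      using x c(1) c(2)[OF x] False by (intro frac_le) auto
    then have "slowness x \<le> sqrt (m / (2 * (c * (m - x))))" by (simp add: slowness_def)
    also have "\<dots> = g x" by (simp add: g_def C_def real_sqrt_divide real_sqrt_mult)
    finally show ?thesis using slowness_nonneg[of x] x by simp
  qed (simp add: slowness_def g_def)
  have "slowness absolutely_integrable_on {0..m}"
  proof (rule measurable_bounded_by_integrable_imp_absolutely_integrable[OF _ _ g bound])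
    show "slowness \<in> borel_measurable (lebesgue_on {0..m})"
      using measurable_completion[of slowness lborel borel] slowness_measurable
      by (intro measurable_restrict_space1) auto
  qed auto
  then show ?thesis by (rule set_lebesgue_integral_eq_integral)
qed

text \<open>The heights reached in finite time; they include the crest exactly when \<open>m\<close> is not a critical point.\<close>

definition heights :: "real set" where
  "heights = (if deriv F m = 0 then {0..<m} else {0..m})"

lemma slowness_integrable': "b \<in> heights \<Longrightarrow> slowness integrable_on {0..b}"
  using slowness_integrable slowness_integrable_crest
  by (cases "b = m") (auto simp: heights_def split: if_splits)

lemma continuous_time: "b \<in> heights \<Longrightarrow> continuous_on {0..b} time"
  unfolding time_def
  by (intro indefinite_integral_continuous_1 slowness_integrable')

lemma time_0 [simp]: "time 0 = 0" by (simp add: time_def)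

lemma DERIV_time:
  assumes "0 < x" "x < m" shows "(time has_real_derivative slowness x) (at x)"
proof -
  define b where "b = (x + m) / 2"
  have b: "x < b" "b < m" using assms by (auto simp: b_def)
  have "(time has_real_derivative slowness x) (at x within {0..b})"
    unfolding time_def
    by (rule integral_has_real_derivative[OF continuous_slowness]) (use assms b in auto)
  then show ?thesis using assms b by (simp add: at_within_Icc_at)
qed

lemma time_less:
  assumes "0 \<le> x" "x < y" "y \<in> heights" shows "time x < time y"
proof (rule DERIV_pos_imp_increasing_open[OF assms(2)])
  show "\<exists>d. (time has_real_derivative d) (at z) \<and> 0 < d" if "x < z" "z < y" for z
    using DERIV_time[of z] slowness_pos[of z] that assms
    by (auto simp: heights_def split: if_splits)
  show "continuous_on {x..y} time"
    using continuous_time[OF assms(3)] by (rule continuous_on_subset) (use assms in auto)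
qed

lemma time_inj: "inj_on time heights"
proof (rule linorder_inj_onI')
  fix x y assume "x \<in> heights" "y \<in> heights" "x < y"
  then show "time x \<noteq> time y" using time_less[of x y] by (auto simp: heights_def split: if_splits)
qed

lemma range_setI: "0 \<le> x \<Longrightarrow> x < m \<Longrightarrow> x \<in> heights"
  by (simp add: heights_def)

lemma heights_nonneg: "x \<in> heights \<Longrightarrow> 0 \<le> x \<and> x \<le> m"
  by (auto simp: heights_def split: if_splits)

lemma time_image: assumes "b \<in> heights" shows "time ` {0..b} = {0..time b}"
proof -
  have b: "0 \<le> b" using heights_nonneg[OF assms] by simp
  have sub: "{0..b} \<subseteq> heights"
    using assms by (auto simp: heights_def split: if_splits)
  have mono: "time x \<le> time y" if "0 \<le> x" "x \<le> y" "y \<in> heights" for x y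
    using time_less[of x y] that by (cases "x = y") auto
  show ?thesis
  proof (intro equalityI subsetI)
    fix y assume "y \<in> time ` {0..b}"
    then obtain x where x: "0 \<le> x" "x \<le> b" "y = time x" by auto
    then show "y \<in> {0..time b}"
      using mono[of 0 x] mono[of x b] sub assms by (auto simp: subset_iff)
  next
    fix y assume "y \<in> {0..time b}"
    then obtain x where "0 \<le> x" "x \<le> b" "time x = y"
      using IVT'[of time 0 y b] continuous_time[OF assms] b by auto
    then show "y \<in> time ` {0..b}" by auto
  qed
qed

text \<open>Here \<open>F m - F x = O((m - x)\<^sup>2)\<close>, so the slowness is at least of order \<open>1 / (m - x)\<close> and the time to
approach the crest diverges logarithmically.\<close>

lemma time_unbounded:
  assumes "deriv F m = 0" obtains b where "0 < b" "b < m" "y < time b"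
proof -
  obtain C where C: "0 < C" "\<And>x. x \<in> {0..m} \<Longrightarrow> F m - F x \<le> C * (m - x)\<^sup>2"
    by (rule critical_level_upper_bound[OF assms]) blast
  define k where "k = sqrt (m / (4 * C))"
  have k: "0 < k" using m_pos C by (simp add: k_def)
  \<comment> \<open>The value at which the lower bound \<open>k * ln ((m / 2) / (m - b))\<close> of the rising time
    equals \<open>max y 0 + 1\<close>.\<close>
  define b where "b = m - m / 2 * exp (- (max y 0 + 1) / k)"
  have "exp (- (max y 0 + 1) / k) < 1" using k by (simp add: divide_neg_pos)
  then have b: "m / 2 < b" "b < m"
    using m_pos by (auto simp: b_def)
  have lower: "k / (m - x) \<le> slowness x" if "m / 2 \<le> x" "x < m" for x
  proof -
    have "(k / (m - x))\<^sup>2 = (m / 2) / (2 * (C * (m - x)\<^sup>2))"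
      using m_pos C by (simp add: k_def power_divide)
    also have "\<dots> \<le> x / (2 * (F m - F x))"
      using that C(2)[of x] F_less[of x] m_pos by (intro frac_le) auto
    finally show ?thesis unfolding slowness_def by (rule real_le_rsqrt)
  qed
  define A where "A x = time x + k * ln (m - x)" for x
  have "A (m/2) \<le> A b"
  proof (rule DERIV_nonneg_imp_nondecreasing[of "m / 2" b A])
    fix x assume x: "m / 2 \<le> x" "x \<le> b"
    have "(A has_real_derivative slowness x - k / (m - x)) (at x)"
      unfolding A_def[abs_def] using x b m_pos
      by (auto intro!: derivative_eq_intros DERIV_time)
    then show "\<exists>d. (A has_real_derivative d) (at x) \<and> 0 \<le> d"
      using lower[of x] x b by auto
  qed (use b in auto)
  then have "time (m/2) + k * ln (m - m/2) \<le> time b + k * ln (m - b)" by (simp add: A_def)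
  moreover have "0 < time (m/2)" using time_less[of 0 "m/2"] m_pos range_setI by simp
  moreover have "ln (m - b) = ln (m / 2) - (max y 0 + 1) / k"
  proof -
    have "m - b = m / 2 * exp (- (max y 0 + 1) / k)" by (simp add: b_def)
    also have "ln \<dots> = ln (m / 2) + (- (max y 0 + 1) / k)"
      using m_pos by (subst ln_mult_pos) auto
    finally show ?thesis by (simp only: minus_divide_left[symmetric] add_uminus_conv_diff)
  qed
  then have "k * ln (m - b) = k * ln (m / 2) - (max y 0 + 1)"
    using k by (simp add: field_simps)
  ultimately have "y < time b" by simp
  then show ?thesis using that[of b] b m_pos by simp
qed

text \<open>At a nondegenerate critical point the divergence is exactly logarithmic, which inverts to an
exponential approach to the crest.\<close>

lemma time_log_bound:
  assumes "deriv F m = 0" "(deriv ^^ 2) F m \<noteq> 0"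
  obtains k where "0 < k" "\<And>x. 0 \<le> x \<Longrightarrow> x < m \<Longrightarrow> time x \<le> k * (ln m - ln (m - x))"
proof -
  obtain c where c: "0 < c" "\<And>x. x \<in> {0..m} \<Longrightarrow> c * (m - x)\<^sup>2 \<le> F m - F x"
    by (rule nondegenerate_level_lower_bound[OF assms]) blast
  \<comment> \<open>The summand \<open>1\<close> makes the bound on the slowness strict, hence the comparison function
    strictly decreasing.\<close>
  define k where "k = sqrt (m / (2 * c)) + 1"
  have k: "0 < k" using m_pos c by (simp add: k_def add_nonneg_pos)
  have upper: "slowness x < k / (m - x)" if "0 < x" "x < m" for x
  proof -
    have "x / (2 * (F m - F x)) \<le> m / (2 * (c * (m - x)\<^sup>2))"
      using that c(1) c(2)[of x] m_pos by (intro frac_le) auto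
    then have "slowness x \<le> sqrt (m / (2 * (c * (m - x)\<^sup>2)))" by (simp add: slowness_def)
    also have "\<dots> = sqrt (m / (2 * c)) / (m - x)"
      using that by (simp add: real_sqrt_divide real_sqrt_mult)
    also have "\<dots> < k / (m - x)"
      using that by (simp add: k_def divide_strict_right_mono)
    finally show ?thesis .
  qed
  define A where "A x = time x + k * ln (m - x)" for x
  have "time b \<le> k * (ln m - ln (m - b))" if b: "0 \<le> b" "b < m" for b
  proof (cases "b = 0")
    case False
    have "A b < A 0"
    proof (rule DERIV_neg_imp_decreasing_open[of 0 b A])
      fix x assume x: "0 < x" "x < b"
      have "(A has_real_derivative slowness x - k / (m - x)) (at x)"
        unfolding A_def[abs_def] using x b
        by (auto intro!: derivative_eq_intros DERIV_time)
      then show "\<exists>d. (A has_real_derivative d) (at x) \<and> d < 0"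
        using upper[of x] x b by auto
    next
      show "continuous_on {0..b} A"
        unfolding A_def[abs_def] using b
        by (intro continuous_intros continuous_time range_setI) auto
    qed (use False b in auto)
    then show ?thesis by (simp add: A_def algebra_simps)
  qed simp
  then show ?thesis using that[of k] k by blast
qed

definition height :: "real \<Rightarrow> real" where
  "height = the_inv_into heights time"

lemma height_time [simp]: "x \<in> heights \<Longrightarrow> height (time x) = x"
  unfolding height_def by (rule the_inv_into_f_f[OF time_inj])

lemma height_0 [simp]: "height 0 = 0"
  using height_time[of 0] m_pos by (simp add: heights_def del: height_time split: if_splits)

lemma continuous_height: assumes "b \<in> heights" shows "continuous_on {0..time b} height"
proof -
  have "{0..b} \<subseteq> heights"
    using assms by (auto simp: heights_def split: if_splits)
  then have "continuous_on (time ` {0..b}) height"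
    by (intro continuous_on_inv continuous_time assms) auto
  then show ?thesis by (simp add: time_image assms)
qed

definition half_period :: real where "half_period = time m"

lemma time_pos: "x \<in> heights \<Longrightarrow> 0 < x \<Longrightarrow> 0 < time x"
  using time_less[of 0 x] by simp

lemma half_period_pos: "deriv F m \<noteq> 0 \<Longrightarrow> 0 < half_period"
  unfolding half_period_def using m_pos by (intro time_pos) (auto simp: heights_def)

text \<open>The open interval of times at which the rising profile lies strictly between zero and crest.\<close>

definition rise_times :: "real set" where
  "rise_times = (if deriv F m = 0 then {0<..} else {0<..<half_period})"

lemma rise_times_eq: "rise_times = time ` {0<..<m}"
proof (intro equalityI subsetI)
  fix y assume "y \<in> time ` {0<..<m}"
  then obtain x where "0 < x" "x < m" "y = time x" by auto
  then show "y \<in> rise_times"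
    using time_pos[of x] range_setI[of x] time_less[of x m]
    by (auto simp: rise_times_def half_period_def heights_def)
next
  fix y assume y: "y \<in> rise_times"
  show "y \<in> time ` {0<..<m}"
  proof (cases "deriv F m = 0")
    case True
    obtain b where b: "0 < b" "b < m" "y < time b" by (rule time_unbounded[OF True])
    then have "y \<in> time ` {0..b}"
      using y True time_image[of b] range_setI by (auto simp: rise_times_def)
    then obtain x where "0 \<le> x" "x \<le> b" "y = time x" by auto
    moreover have "x \<noteq> 0" using y calculation True by (auto simp: rise_times_def)
    ultimately show ?thesis using b by auto
  next
    case False
    then have "y \<in> time ` {0..m}"
      using y time_image[of m] m_pos by (auto simp: rise_times_def heights_def half_period_def)
    then obtain x where "0 \<le> x" "x \<le> m" "y = time x" by auto
    moreover have "x \<noteq> 0" "x \<noteq> m"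
      using y calculation False by (auto simp: rise_times_def half_period_def)
    ultimately show ?thesis by auto
  qed
qed

lemma height_rise_times: "y \<in> rise_times \<Longrightarrow> 0 < height y \<and> height y < m \<and> time (height y) = y"
  by (auto simp: rise_times_eq range_setI)

lemma DERIV_height:
  assumes "y \<in> rise_times" shows "(height has_real_derivative speed (height y)) (at y)"
proof -
  have h: "0 < height y" "height y < m" "time (height y) = y"
    using height_rise_times[OF assms] by auto
  define b where "b = (height y + m) / 2"
  have b: "height y < b" "b < m" using h by (auto simp: b_def)
  then have br: "b \<in> heights" using h by (intro range_setI) auto
  have y: "0 < y" "y < time b"
    using time_less[of "height y" b] time_pos[of "height y"] h b br range_setI by auto
  have "(height has_real_derivative inverse (slowness (height y))) (at y)"
  proof (rule DERIV_inverse_function)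
    show "(time has_real_derivative slowness (height y)) (at (height y))"
      by (rule DERIV_time[OF h(1,2)])
    show "time (height z) = z" if "0 < z" "z < time b" for z
      using that height_rise_times[of z] time_less[of b m] br b
      by (auto simp: rise_times_def half_period_def heights_def split: if_splits)
    have "continuous_on {0<..<time b} height"
      using continuous_height[OF br] by (rule continuous_on_subset) auto
    then show "isCont height y" using y by (auto simp: continuous_on_eq_continuous_at)
    show "slowness (height y) \<noteq> 0" using slowness_pos[OF h(1,2)] by simp
  qed (use y in auto)
  then show ?thesis using h by (simp add: slowness_speed)
qed

end

section \<open>The folded profile\<close>

context analytic_cusp_level
begin

text \<open>The distance in time to the nearest zero. The composition of arccos and
cos is a triangle wave, for which evenness, periodicity and continuity hold at once.\<close>

definition folded :: "real \<Rightarrow> real" where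
  "folded t = (if deriv F m = 0 then \<bar>t\<bar>
             else half_period / pi * arccos (cos (pi * t / half_period)))"

text \<open>The derivative of the folded time; it vanishes exactly at the turning points, where the folded
time has a corner.\<close>

definition dir :: "real \<Rightarrow> real" where
  "dir t = (if deriv F m = 0 then sgn t else sgn (sin (pi * t / half_period)))"

definition turning :: "real set" where
  "turning = {t. dir t = 0}"

definition wave :: "real \<Rightarrow> real" where
  "wave t = height (folded t)"

lemma folded_nonneg: "0 \<le> folded t"
  using half_period_pos by (auto simp: folded_def arccos_lbound intro!: mult_nonneg_nonneg)

lemma folded_le: "deriv F m \<noteq> 0 \<Longrightarrow> folded t \<le> half_period"
  using half_period_pos arccos_ubound[of "cos (pi * t / half_period)"]
  by (simp add: folded_def field_simps)

lemma folded_0 [simp]: "folded 0 = 0" by (simp add: folded_def)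

lemma folded_ident: "0 \<le> t \<Longrightarrow> (deriv F m \<noteq> 0 \<Longrightarrow> t \<le> half_period) \<Longrightarrow> folded t = t"
  using half_period_pos by (auto simp: folded_def arccos_cos field_simps)

lemma continuous_folded: "continuous_on A folded"
proof (cases "deriv F m = 0")
  case True
  then show ?thesis unfolding folded_def by (auto intro!: continuous_intros)
next
  case False
  then show ?thesis
    unfolding folded_def using half_period_pos by (auto intro!: continuous_intros)
qed

lemma dir_square: "t \<notin> turning \<Longrightarrow> dir t * dir t = 1"
  by (auto simp: turning_def dir_def sgn_if split: if_splits)

lemma abs_dir_le: "\<bar>dir t\<bar> \<le> 1"
  by (simp add: dir_def sgn_if)

lemma dir_locally_constant:
  assumes "t \<notin> turning" shows "\<forall>\<^sub>F s in nhds t. dir s = dir t"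
proof -
  define f where "f s = (if deriv F m = 0 then s else sin (pi * s / half_period))" for s
  have f: "dir s = sgn (f s)" for s by (simp add: dir_def f_def)
  have "isCont f t"
    using half_period_pos unfolding f_def[abs_def]
    by (cases "deriv F m = 0") (auto intro!: continuous_intros)
  then have lim: "(f \<longlongrightarrow> f t) (nhds t)" by (simp add: isCont_def tendsto_at_iff_tendsto_nhds)
  consider "f t > 0" | "f t < 0" using assms by (auto simp: turning_def f sgn_if split: if_splits)
  then show ?thesis
  proof cases
    case 1
    then have "\<forall>\<^sub>F s in nhds t. f s > 0" using lim by (rule order_tendstoD(1)[rotated])
    then show ?thesis by eventually_elim (use 1 in \<open>simp add: f\<close>)
  next
    case 2
    then have "\<forall>\<^sub>F s in nhds t. f s < 0" using lim by (rule order_tendstoD(2)[rotated])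
    then show ?thesis by eventually_elim (use 2 in \<open>simp add: f\<close>)
  qed
qed

lemma eventually_not_turning:
  "t \<notin> turning \<Longrightarrow> \<forall>\<^sub>F s in nhds t. s \<notin> turning"
  using dir_locally_constant[of t] by (auto elim!: eventually_mono simp: turning_def)

lemma turning_int:
  assumes "deriv F m \<noteq> 0"
  shows "t \<in> turning \<longleftrightarrow> (\<exists>i::int. t = of_int i * half_period)"
proof -
  have "t \<in> turning \<longleftrightarrow> sin (pi * t / half_period) = 0"
    using assms by (simp add: turning_def dir_def sgn_zero_iff)
  also have "\<dots> \<longleftrightarrow> (\<exists>i::int. pi * t / half_period = of_int i * pi)"
    by (simp add: sin_zero_iff_int2)
  also have "\<dots> \<longleftrightarrow> (\<exists>i::int. t = of_int i * half_period)"
    using half_period_pos[OF assms] by (auto simp: field_simps)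
  finally show ?thesis .
qed

lemma turning_critical: "deriv F m = 0 \<Longrightarrow> turning = {0}"
  by (auto simp: turning_def dir_def sgn_zero_iff)

lemma finite_turning: "finite (turning \<inter> {a..b})"
proof (cases "deriv F m = 0")
  case True
  then show ?thesis by (simp add: turning_critical)
next
  case False
  have "turning \<inter> {a..b} \<subseteq>
    (\<lambda>i::int. of_int i * half_period) ` {\<lfloor>a / half_period\<rfloor>..\<lceil>b / half_period\<rceil>}"
  proof
    fix t assume t: "t \<in> turning \<inter> {a..b}"
    then obtain i :: int where i: "t = of_int i * half_period"
      using turning_int[OF False] by auto
    have "a / half_period \<le> of_int i" "of_int i \<le> b / half_period"
      using t half_period_pos[OF False] by (auto simp: i field_simps)
    then have "i \<in> {\<lfloor>a / half_period\<rfloor>..\<lceil>b / half_period\<rceil>}"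
      by (auto simp: floor_le_iff le_ceiling_iff)
    then show "t \<in> (\<lambda>i::int. of_int i * half_period) ` {\<lfloor>a / half_period\<rfloor>..\<lceil>b / half_period\<rceil>}"
      using i by blast
  qed
  then show ?thesis by (rule finite_subset) auto
qed

lemma DERIV_folded:
  assumes "t \<notin> turning" shows "(folded has_real_derivative dir t) (at t)"
proof (cases "deriv F m = 0")
  case True
  have "\<forall>\<^sub>F s in nhds t. dir t * s = folded s"
    using dir_locally_constant[OF assms]
    by eventually_elim (use True in \<open>auto simp: dir_def folded_def sgn_if split: if_splits\<close>)
  then show ?thesis
    by (rule iffD1[OF DERIV_cong_ev[OF refl _ refl] DERIV_cmult_Id])
next
  case False
  note p = half_period_pos[OF False]
  let ?x = "pi * t / half_period"
  have s: "sin ?x \<noteq> 0" using assms False by (simp add: turning_def dir_def sgn_zero_iff)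
  then have "(cos ?x)\<^sup>2 < 1\<^sup>2" by (simp add: cos_squared_eq)
  then have c: "-1 < cos ?x" "cos ?x < 1"
    using abs_square_less_1[of "cos (pi * t / half_period)"] by (auto simp: abs_less_iff)
  have "1 - (cos ?x)\<^sup>2 = (sin ?x)\<^sup>2" by (simp add: cos_squared_eq)
  then have r: "sqrt (1 - (cos ?x)\<^sup>2) = \<bar>sin ?x\<bar>" by simp
  have "((\<lambda>t. arccos (cos (pi * t / half_period))) has_real_derivative
      inverse (- sqrt (1 - (cos ?x)\<^sup>2)) * (- sin ?x * (pi / half_period))) (at t)"
  proof (rule DERIV_chain2[where f = arccos and g = "\<lambda>t. cos (pi * t / half_period)"])
    show "(arccos has_real_derivative inverse (- sqrt (1 - (cos ?x)\<^sup>2))) (at (cos ?x))"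
      by (rule DERIV_arccos[OF c])
    show "((\<lambda>t. cos (pi * t / half_period)) has_real_derivative
        - sin ?x * (pi / half_period)) (at t)"
      using p by (auto intro!: derivative_eq_intros)
  qed
  from DERIV_cmult[OF this, of "half_period / pi"]
  have "(folded has_real_derivative half_period / pi *
     (inverse (- sqrt (1 - (cos ?x)\<^sup>2)) * (- sin ?x * (pi / half_period)))) (at t)"
    using False by (simp add: folded_def[abs_def])
  also have "half_period / pi * (inverse (- sqrt (1 - (cos ?x)\<^sup>2)) * (- sin ?x * (pi / half_period)))
      = sin ?x / \<bar>sin ?x\<bar>"
    unfolding r using p by (simp add: field_simps)
  also have "\<dots> = dir t" using False s by (simp add: dir_def sgn_if)
  finally show ?thesis .
qed

lemma folded_in_rise_times: "t \<notin> turning \<Longrightarrow> folded t \<in> rise_times"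
proof (cases "deriv F m = 0")
  case True
  then show "t \<notin> turning \<Longrightarrow> folded t \<in> rise_times"
    by (auto simp: turning_critical rise_times_def folded_def)
next
  case False
  assume t: "t \<notin> turning"
  note p = half_period_pos[OF False]
  let ?c = "cos (pi * t / half_period)"
  have "sin (pi * t / half_period) \<noteq> 0"
    using t False by (simp add: turning_def dir_def sgn_zero_iff)
  then have "?c\<^sup>2 < 1" by (simp add: cos_squared_eq)
  then have "\<bar>?c\<bar> < 1" by (rule abs_square_less_1[THEN iffD1])
  then have "0 < arccos ?c" "arccos ?c < pi" using arccos_lt_bounded[of ?c] by auto
  then show "folded t \<in> rise_times"
    using False p by (simp add: rise_times_def folded_def field_simps)
qed

lemma turning_folded:
  assumes "t \<in> turning" shows "folded t = 0 \<or> (deriv F m \<noteq> 0 \<and> folded t = half_period)"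
proof (cases "deriv F m = 0")
  case True
  then show ?thesis using assms by (simp add: turning_critical)
next
  case False
  then have "sin (pi * t / half_period) = 0"
    using assms by (simp add: turning_def dir_def sgn_zero_iff)
  then have "cos (pi * t / half_period) = 1 \<or> cos (pi * t / half_period) = - 1"
    using sin_zero_abs_cos_one by fastforce
  then show ?thesis using False by (auto simp: folded_def)
qed

lemma height_half_period: "deriv F m \<noteq> 0 \<Longrightarrow> height half_period = m"
  using height_time[of m] m_pos by (simp add: half_period_def heights_def)

lemma wave_not_turning:
  assumes "t \<notin> turning"
  shows "0 < wave t" "wave t < m" "time (wave t) = folded t"
    and "(wave has_real_derivative dir t * speed (wave t)) (at t)"
proof -
  note t = folded_in_rise_times[OF assms]
  show "0 < wave t" "wave t < m" "time (wave t) = folded t"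
    using height_rise_times[OF t] by (auto simp: wave_def)
  show "(wave has_real_derivative dir t * speed (wave t)) (at t)"
    unfolding wave_def[abs_def]
    using DERIV_chain2[OF DERIV_height[OF t] DERIV_folded[OF assms]] by (simp add: mult.commute)
qed

lemma wave_turning: "t \<in> turning \<Longrightarrow> wave t = 0 \<or> (deriv F m \<noteq> 0 \<and> wave t = m)"
  using turning_folded[of t] height_half_period by (auto simp: wave_def)

lemma wave_bounds: "0 \<le> wave t" "wave t \<le> m"
  using wave_not_turning[of t] wave_turning[of t] m_pos by (cases "t \<in> turning"; force)+

lemma wave_critical: "deriv F m = 0 \<Longrightarrow> wave t < m"
  using wave_not_turning[of t] wave_turning[of t] m_pos by (cases "t \<in> turning") auto

lemma continuous_wave: "continuous_on A wave"
proof -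
  have "isCont wave t" for t
  proof -
    have "\<exists>b\<in>heights. \<forall>s\<in>{t-1..t+1}. folded s \<le> time b"
    proof (cases "deriv F m = 0")
      case True
      obtain b where "0 < b" "b < m" "\<bar>t\<bar> + 1 < time b" by (rule time_unbounded[OF True])
      then show ?thesis using True range_setI[of b]
        by (intro bexI[of _ b]) (auto simp: folded_def)
    next
      case False
      then show ?thesis using folded_le m_pos
        by (intro bexI[of _ m]) (auto simp: half_period_def heights_def)
    qed
    then obtain b where b: "b \<in> heights" "\<And>s. s \<in> {t-1..t+1} \<Longrightarrow> folded s \<le> time b" by blast
    have "continuous_on {t-1..t+1} wave"
      unfolding wave_def[abs_def]
      by (rule continuous_on_compose2[OF continuous_height[OF b(1)] continuous_folded])
        (use b(2) folded_nonneg in auto)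
    then have "continuous_on {t-1<..<t+1} wave" by (rule continuous_on_subset) auto
    then show "isCont wave t" by (auto simp: continuous_on_eq_continuous_at)
  qed
  then show ?thesis by (simp add: continuous_at_imp_continuous_on)
qed

lemma wave_zero_turning: "wave t = 0 \<Longrightarrow> t \<in> turning"
  using wave_not_turning(1)[of t] by fastforce

lemma wave_crest_turning: "wave t = m \<Longrightarrow> t \<in> turning"
  using wave_not_turning(2)[of t] by fastforce

lemma wave_zero_iff: "wave t = 0 \<longleftrightarrow> folded t = 0"
  using wave_turning[of t] turning_folded[of t] wave_not_turning[of t] folded_in_rise_times[of t]
    half_period_pos height_half_period m_pos
  by (cases "t \<in> turning") (auto simp: wave_def rise_times_def split: if_splits)

lemma wave_0 [simp]: "wave 0 = 0" by (simp add: wave_def)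

lemma wave_minus [simp]: "wave (- t) = wave t"
  by (simp add: wave_def folded_def)

lemma speed_sq: "0 < x \<Longrightarrow> x < m \<Longrightarrow> (speed x)\<^sup>2 = 2 * (F m - F x) / x"
  using F_less[of x] by (simp add: speed_def)

text \<open>Away from the turning points the flux \<open>u * u'\<close> is \<open>dir t * sqrt (2 * u * (F m - F u))\<close>. This form also
makes sense at zeros and crests, where it vanishes.\<close>

lemma DERIV_flux:
  assumes "t \<notin> turning"
  shows "((\<lambda>t. dir t * sqrt (2 * wave t * (F m - F (wave t)))) has_real_derivative
     (speed (wave t))\<^sup>2 / 2 - deriv F (wave t)) (at t)"
proof -
  define x where "x = wave t"
  define p where "p = sqrt (2 * x * (F m - F x))"
  note w = wave_not_turning[OF assms, folded x_def]
  have Fx: "F x < F m" using w by (intro F_less) auto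
  have p: "0 < p" using Fx w by (simp add: p_def)
  have sp: "speed x = p / x"
  proof -
    have "2 * (F m - F x) / x = (2 * x * (F m - F x)) / x\<^sup>2"
      using w by (simp add: power2_eq_square field_simps)
    then show ?thesis using w by (simp add: speed_def p_def real_sqrt_divide)
  qed
  have dF: "((\<lambda>t. F (wave t)) has_real_derivative deriv F x * (dir t * speed x)) (at t)"
    using DERIV_chain2[OF DERIV_F[of "wave t"] wave_not_turning(4)[OF assms]] by (simp add: x_def)
  have in': "((\<lambda>t. 2 * wave t * (F m - F (wave t))) has_real_derivative
     2 * (dir t * speed x) * (F m - F x) - 2 * x * (deriv F x * (dir t * speed x))) (at t)"
    by (auto intro!: derivative_eq_intros dF wave_not_turning(4)[OF assms] simp: x_def algebra_simps)
  have "((\<lambda>t. sqrt (2 * wave t * (F m - F (wave t)))) has_real_derivative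
     (inverse (sqrt (2 * x * (F m - F x))) / 2) *
     (2 * (dir t * speed x) * (F m - F x) - 2 * x * (deriv F x * (dir t * speed x)))) (at t)"
    by (rule DERIV_chain2[where f = sqrt, OF _ in']) (use Fx w in \<open>auto simp: x_def intro!: DERIV_real_sqrt\<close>)
  then have "((\<lambda>s. dir t * sqrt (2 * wave s * (F m - F (wave s)))) has_real_derivative
     dir t * ((inverse p / 2) *
     (2 * (dir t * speed x) * (F m - F x) - 2 * x * (deriv F x * (dir t * speed x))))) (at t)"
    unfolding p_def by (rule DERIV_cmult)
  also have "dir t * ((inverse p / 2) *
     (2 * (dir t * speed x) * (F m - F x) - 2 * x * (deriv F x * (dir t * speed x))))
     = (dir t * dir t) * ((F m - F x) / x - deriv F x)"
    unfolding sp using w p by (simp add: field_simps)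
  also have "\<dots> = (speed x)\<^sup>2 / 2 - deriv F x"
    using dir_square[OF assms] w by (simp add: speed_sq) (simp add: field_simps)
  finally have *: "((\<lambda>s. dir t * sqrt (2 * wave s * (F m - F (wave s)))) has_real_derivative
      (speed x)\<^sup>2 / 2 - deriv F x) (at t)" .
  have "\<forall>\<^sub>F s in nhds t. dir s * sqrt (2 * wave s * (F m - F (wave s))) =
       dir t * sqrt (2 * wave s * (F m - F (wave s)))"
    using dir_locally_constant[OF assms] by eventually_elim simp
  from DERIV_cong_ev[OF refl this refl] show ?thesis using * by (simp only: x_def)
qed

lemma F_wave_le: "F (wave t) \<le> F m"
  using F_less[of "wave t"] wave_bounds[of t] by (cases "wave t = m") auto

lemma flux_nonneg: "0 \<le> wave t * (F m - F (wave t))"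
  using wave_bounds F_wave_le by (intro mult_nonneg_nonneg) auto

text \<open>All turning points, crests included, can be taken as exceptional, because the flux vanishes at zeros
and at crests alike.\<close>

lemma wave_TWS: "TWS F wave"
proof (rule TWS_of_piecewise_classical[where E = turning and v = "\<lambda>t. dir t * speed (wave t)"])
  show "continuous_on UNIV wave" by (rule continuous_wave)
  show "bounded (range wave)"
    unfolding bounded_iff using wave_bounds by (intro exI[of _ m]) auto
  show "0 \<le> wave t" for t by (rule wave_bounds)
  show "continuous_on UNIV (deriv F)" by (rule continuous_deriv_F)
  show "finite (turning \<inter> {a..b})" for a b by (rule finite_turning)
  show "(wave has_real_derivative dir t * speed (wave t)) (at t)" if "t \<notin> turning" for t
    by (rule wave_not_turning[OF that])
  show "dir t * speed (wave t) = 0" if "wave t = 0" for t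
    using wave_zero_turning[OF that] by (simp add: turning_def)
  let ?p = "\<lambda>t. dir t * sqrt (2 * wave t * (F m - F (wave t)))"
  have eq: "(\<lambda>t. wave t * (dir t * speed (wave t))) = ?p"
  proof
    fix t
    show "wave t * (dir t * speed (wave t)) = ?p t"
    proof (cases "t \<in> turning")
      case False
      note w = wave_not_turning[OF False]
      have "2 * wave t * (F m - F (wave t)) = (wave t)\<^sup>2 * (2 * (F m - F (wave t)) / wave t)"
        using w by (simp add: power2_eq_square)
      then have "sqrt (2 * wave t * (F m - F (wave t))) = wave t * speed (wave t)"
        using w by (simp only: real_sqrt_mult speed_def) simp
      then show ?thesis by simp
    qed (simp add: turning_def)
  qed
  have c: "continuous_on UNIV (\<lambda>t. sqrt (2 * wave t * (F m - F (wave t))))"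
    by (intro continuous_intros continuous_wave continuous_on_compose2[OF continuous_F continuous_wave]) auto
  have "isCont ?p t" for t
  proof (cases "t \<in> turning")
    case False
    then show ?thesis using DERIV_flux DERIV_isCont by blast
  next
    case True
    then have z: "sqrt (2 * wave t * (F m - F (wave t))) = 0" using wave_turning[OF True] by auto
    have "((\<lambda>t. sqrt (2 * wave t * (F m - F (wave t)))) \<longlongrightarrow> 0) (at t)"
      using c z by (metis (no_types, lifting) UNIV_I continuous_on_def)
    then have "(?p \<longlongrightarrow> 0) (at t)"
      by (rule Lim_null_comparison[rotated]) (auto simp: dir_def abs_mult sgn_if wave_bounds flux_nonneg)
    moreover have "?p t = 0" using z by (simp only: mult_zero_right)
    ultimately show ?thesis by (simp only: isCont_def)
  qed
  then show "continuous_on UNIV (\<lambda>t. wave t * (dir t * speed (wave t)))"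
    unfolding eq by (simp add: continuous_at_imp_continuous_on)
  show "((\<lambda>t. wave t * (dir t * speed (wave t))) has_real_derivative
      (dir t * speed (wave t))\<^sup>2 / 2 - deriv F (wave t)) (at t)" if "t \<notin> turning" for t
    unfolding eq using DERIV_flux[OF that] dir_square[OF that]
    by (simp add: power_mult_distrib power2_eq_square[of "dir t"])
qed

end

section \<open>Analyticity and cusps of the profile\<close>

context analytic_cusp_level
begin

lemma real_analytic_at_speed:
  assumes "0 < x" "x < m" shows "real_analytic_at speed x"
  unfolding speed_def[abs_def]
proof (rule real_analytic_at_sqrt_compose)
  show "real_analytic_at (\<lambda>y. 2 * (F m - F y) / y) x"
    by (rule real_analytic_at_divide[OF real_analytic_at_mult[OF real_analytic_at_const
        real_analytic_at_diff[OF real_analytic_at_const F_analytic]] real_analytic_at_ident])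
      (use assms in simp)
  show "0 < 2 * (F m - F x) / x" using F_less[of x] assms by simp
qed

lemma wave_analytic_not_turning:
  assumes "t \<notin> turning" shows "real_analytic_at wave t"
proof (rule real_analytic_at_autonomous_ode[where g = "\<lambda>x. dir t * speed x"])
  note w = wave_not_turning[OF assms]
  show "real_analytic_at (\<lambda>x. dir t * speed x) (wave t)"
    using w by (intro real_analytic_at_mult real_analytic_at_const real_analytic_at_speed)
  show "dir t * speed (wave t) \<noteq> 0"
    using speed_pos[OF w(1,2)] assms by (simp add: turning_def)
  show "isCont wave t" using w(4) by (rule DERIV_isCont)
  have "\<forall>\<^sub>F s in nhds t. (wave has_real_derivative dir t * speed (wave s)) (at s)"
    using dir_locally_constant[OF assms] eventually_not_turning[OF assms]
    by eventually_elim (metis wave_not_turning(4))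
  then show "\<forall>\<^sub>F s in at t. (wave has_real_derivative dir t * speed (wave s)) (at s)"
    by (simp add: eventually_at_filter eventually_mono)
qed

lemma eventually_at_not_turning: "\<forall>\<^sub>F s in at t. s \<notin> turning"
proof -
  have "\<not> t islimpt (turning \<inter> {t-1..t+1})"
    using islimpt_finite[OF finite_turning] by blast
  then have "\<forall>\<^sub>F s in at t. s \<notin> turning \<inter> {t-1..t+1}"
    by (simp add: islimpt_iff_eventually)
  moreover have "\<forall>\<^sub>F s in at t. s \<in> {t-1<..<t+1}"
    by (rule eventually_at_in_open') auto
  ultimately show ?thesis by eventually_elim auto
qed

text \<open>At a crest \<open>w = - dir * sqrt (m - wave)\<close> passes through \<open>0\<close> and satisfies
\<open>w' = sqrt (slope (m - w\<^sup>2) / (2 * (m - w\<^sup>2)))\<close>, where the factor \<open>m - x\<close> of \<open>F m - F x\<close> has cancelled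
against \<open>w\<^sup>2\<close>. The right hand side is analytic and nonzero at \<open>w = 0\<close>, so \<open>w\<close> is analytic, and so is
\<open>wave = m - w\<^sup>2\<close>.\<close>

lemma wave_analytic_crest:
  assumes t: "wave t = m" and nc: "deriv F m \<noteq> 0"
  shows "real_analytic_at wave t"
proof -
  define g where "g w = sqrt (slope (m - w\<^sup>2) / (2 * (m - w\<^sup>2)))" for w
  define w where "w s = - dir s * sqrt (m - wave s)" for s
  have w_t: "w t = 0" using t by (simp add: w_def)
  have cont: "isCont wave s" for s
    using continuous_wave[of UNIV] by (simp add: continuous_on_eq_continuous_at)
  have "\<forall>\<^sub>F s in nhds t. 0 < wave s"
    using cont[of t] t m_pos unfolding isCont_def tendsto_at_iff_tendsto_nhds
    by (metis order_tendstoD(1))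
  then have pos: "\<forall>\<^sub>F s in nhds t. s \<in> turning \<longrightarrow> wave s = m"
    by eventually_elim (use wave_turning in force)
  have w_sq: "m - (w s)\<^sup>2 = wave s" if "s \<in> turning \<longrightarrow> wave s = m" for s
  proof (cases "s \<in> turning")
    case False
    then show ?thesis
      using dir_square[OF False] wave_bounds[of s]
      by (simp add: w_def power_mult_distrib power2_eq_square[of "dir s"])
  qed (use that in \<open>simp add: w_def\<close>)
  have "real_analytic_at w t"
  proof (rule real_analytic_at_autonomous_ode[where g = g])
    have sq: "real_analytic_at (\<lambda>w. m - w * w) 0"
      by (intro real_analytic_at_diff real_analytic_at_mult real_analytic_at_const
          real_analytic_at_ident)
    have "real_analytic_at (\<lambda>w. slope (m - w * w)) 0"
      by (rule real_analytic_at_compose[OF _ sq]) (simp add: slope_analytic)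
    then show "real_analytic_at g (w t)"
      unfolding g_def[abs_def] w_t power2_eq_square using nc deriv_nonneg m_pos
      by (intro real_analytic_at_sqrt_compose real_analytic_at_divide sq
          real_analytic_at_mult[OF real_analytic_at_const]) (auto simp: slope_def)
    show "g (w t) \<noteq> 0" using nc m_pos by (simp add: w_t g_def slope_def)
    have "((\<lambda>s. sqrt (m - wave s)) \<longlongrightarrow> sqrt (m - wave t)) (at t)"
      using cont[of t] unfolding isCont_def by (intro tendsto_intros)
    moreover have "norm (w s) \<le> sqrt (m - wave s)" for s
      using mult_right_mono[OF abs_dir_le[of s], of "sqrt (m - wave s)"] wave_bounds[of s]
      by (simp add: w_def abs_mult)
    ultimately have "(w \<longlongrightarrow> 0) (at t)"
      by (intro Lim_null_comparison[where f = w and g = "\<lambda>s. sqrt (m - wave s)"])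
        (simp_all add: t)
    then show "isCont w t" by (simp add: isCont_def w_t)
    show "\<forall>\<^sub>F s in at t. (w has_real_derivative g (w s)) (at s)"
      using eventually_at_not_turning[of t]
    proof eventually_elim
      case (elim s)
      note x = wave_not_turning[OF elim]
      have "((\<lambda>r. sqrt (m - wave r)) has_real_derivative
          (inverse (sqrt (m - wave s)) / 2) * (- (dir s * speed (wave s)))) (at s)"
        by (rule DERIV_chain2[where f = sqrt])
          (use x in \<open>auto intro!: DERIV_real_sqrt derivative_eq_intros\<close>)
      from DERIV_cmult[OF this, of "- dir s"]
      have d: "((\<lambda>r. - dir s * sqrt (m - wave r)) has_real_derivative
          (dir s * dir s) * (speed (wave s) / (2 * sqrt (m - wave s)))) (at s)"
        by (simp add: field_simps)
      have "\<forall>\<^sub>F r in nhds s. - dir s * sqrt (m - wave r) = w r"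
        using dir_locally_constant[OF elim] by eventually_elim (simp add: w_def)
      from DERIV_cong_ev[OF refl this refl] d
      have d: "(w has_real_derivative speed (wave s) / (2 * sqrt (m - wave s))) (at s)"
        using dir_square[OF elim] by simp
      have "speed (wave s) / (2 * sqrt (m - wave s)) =
          sqrt (2 * (F m - F (wave s)) / wave s / (4 * (m - wave s)))"
        by (simp only: speed_def real_sqrt_divide real_sqrt_mult real_sqrt_four)
      also have "2 * (F m - F (wave s)) / wave s / (4 * (m - wave s)) =
          slope (wave s) / (2 * wave s)"
        using x by (simp add: slope_def field_simps)
      also have "sqrt \<dots> = g (w s)"
        using w_sq[of s] elim by (simp add: g_def)
      finally show ?case using d by simp
    qed
  qed
  then have "real_analytic_at (\<lambda>s. m - w s * w s) t"
    by (intro real_analytic_at_diff real_analytic_at_mult real_analytic_at_const)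
  moreover have "\<forall>\<^sub>F s in nhds t. m - w s * w s = wave s"
    using pos by eventually_elim (use w_sq in \<open>simp add: power2_eq_square\<close>)
  ultimately show ?thesis by (rule real_analytic_at_cong)
qed

lemma wave_analytic:
  assumes "wave t \<noteq> 0" shows "real_analytic_at wave t"
  using wave_turning[of t] assms wave_analytic_crest wave_analytic_not_turning by blast

lemma zero_shift:
  assumes "wave s = 0"
  shows "folded (t + s) = folded t" "dir (t + s) = dir t" "wave (t + s) = wave t"
proof -
  have fs: "folded s = 0" using assms by (simp add: wave_zero_iff)
  show 1: "folded (t + s) = folded t" and 2: "dir (t + s) = dir t"
  proof -
    have "folded (t + s) = folded t \<and> dir (t + s) = dir t"
    proof (cases "deriv F m = 0")
      case True
      then show ?thesis using fs by (simp add: folded_def)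
    next
      case False
      note p = half_period_pos[OF False]
      have "arccos (cos (pi * s / half_period)) = 0" using fs False p by (simp add: folded_def)
      then have c: "cos (pi * s / half_period) = 1"
        by (metis cos_arccos_abs abs_cos_le_one cos_zero)
      then have s: "sin (pi * s / half_period) = 0" by (simp add: cos_one_sin_zero)
      have "pi * (t + s) / half_period = pi * t / half_period + pi * s / half_period"
        by (simp add: field_simps add_divide_distrib)
      then show ?thesis using False c s by (simp add: folded_def dir_def cos_add sin_add)
    qed
    then show "folded (t + s) = folded t" "dir (t + s) = dir t" by auto
  qed
  show "wave (t + s) = wave t" by (simp add: wave_def 1)
qed

text \<open>In the periodic case the sine of the phase vanishes at a turning point, so the cosine is even about it.\<close>

lemma turning_symmetric:
  assumes "t \<in> turning" shows "wave (t + s) = wave (t - s)"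
proof (cases "deriv F m = 0")
  case True
  then show ?thesis using assms wave_minus[of s] by (simp add: turning_critical)
next
  case False
  then have s: "sin (pi * t / half_period) = 0"
    using assms by (simp add: turning_def dir_def sgn_zero_iff)
  have "pi * (t + s) / half_period = pi * t / half_period + pi * s / half_period"
    "pi * (t - s) / half_period = pi * t / half_period - pi * s / half_period"
    by (simp_all add: field_simps add_divide_distrib diff_divide_distrib)
  then have "folded (t + s) = folded (t - s)"
    using False s by (simp add: folded_def cos_add cos_diff)
  then show ?thesis by (simp add: wave_def)
qed

text \<open>Since \<open>F 0 < F m\<close>, the speed behaves like a multiple of \<open>1 / sqrt x\<close> at small heights.\<close>

lemma filterlim_speed_0: "filterlim speed at_top (at_right 0)"
proof -
  have "((\<lambda>x. 2 * (F m - F x)) \<longlongrightarrow> 2 * (F m - F 0)) (at_right 0)"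
  proof -
    have "(F \<longlongrightarrow> F 0) (at 0)"
      using real_analytic_at_isCont[OF F_analytic[of 0]] by (simp add: isCont_def)
    then have "(F \<longlongrightarrow> F 0) (at_right 0)"
      by (rule filterlim_mono) (auto simp: at_le)
    then show ?thesis by (intro tendsto_intros)
  qed
  moreover have "0 < 2 * (F m - F 0)" using F_less[of 0] m_pos by simp
  ultimately have "filterlim (\<lambda>x. 2 * (F m - F x) * inverse x) at_top (at_right 0)"
    by (rule filterlim_tendsto_pos_mult_at_top[OF _ _ filterlim_inverse_at_top_right])
  then show ?thesis
    unfolding speed_def[abs_def] divide_inverse by (rule filterlim_compose[OF sqrt_at_top])
qed

lemma wave_pos_near_zero:
  "\<forall>\<^sub>F t in at 0. 0 < wave t"
  using eventually_at_not_turning by eventually_elim (rule wave_not_turning(1))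

lemma filterlim_speed_wave: "filterlim (\<lambda>t. speed (wave t)) at_top (at 0)"
proof (rule filterlim_compose[OF filterlim_speed_0])
  have "isCont wave 0"
    using continuous_wave[of UNIV] by (simp add: continuous_on_eq_continuous_at)
  then have "(wave \<longlongrightarrow> 0) (at 0)" by (simp add: isCont_def)
  then show "filterlim wave (at_right 0) (at 0)"
    using wave_pos_near_zero by (simp add: filterlim_at greaterThan_iff)
      (auto elim: eventually_mono)
qed

lemma dir_pos_right: "\<forall>\<^sub>F t in at_right 0. dir t = 1"
proof -
  define d where "d = (if deriv F m = 0 then 1 else half_period)"
  have "0 < d" using half_period_pos by (simp add: d_def)
  then have "\<forall>\<^sub>F t in at_right 0. t \<in> {0<..<d}" by (rule eventually_at_right_real)
  then show ?thesis
  proof eventually_elim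
    case (elim t)
    have "0 < sin (pi * t / half_period)" if "deriv F m \<noteq> 0"
      using that elim half_period_pos by (intro sin_gt_zero) (auto simp: d_def field_simps)
    then show ?case using elim by (simp add: dir_def)
  qed
qed

lemma dir_minus: "dir (- t) = - dir t"
  by (simp add: dir_def sgn_minus)

lemma deriv_wave: "t \<notin> turning \<Longrightarrow> deriv wave t = dir t * speed (wave t)"
  by (rule DERIV_imp_deriv[OF wave_not_turning(4)])

lemma wave_cusp:
  assumes "wave s = 0" shows "cusp_at wave s"
proof -
  have nt: "\<forall>\<^sub>F t in at 0. t + s \<notin> turning"
    using eventually_at_not_turning[of 0]
    by eventually_elim (simp add: turning_def zero_shift[OF assms])
  have dw: "\<forall>\<^sub>F t in at 0. deriv wave (t + s) = dir t * speed (wave t)"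
    using nt by eventually_elim (simp add: deriv_wave zero_shift[OF assms])
  have "filterlim (\<lambda>t. deriv wave (t + s)) at_top (at_right 0)"
  proof (rule filterlim_cong[THEN iffD1, OF refl refl])
    show "\<forall>\<^sub>F t in at_right 0. speed (wave t) = deriv wave (t + s)"
      using dir_pos_right filter_leD[OF at_le[of "{0<..}" UNIV] dw, simplified]
      by eventually_elim simp
    show "filterlim (\<lambda>t. speed (wave t)) at_top (at_right 0)"
      using filterlim_speed_wave by (rule filterlim_mono) (auto simp: at_le)
  qed
  then have 1: "filterlim (deriv wave) at_top (at_right s)"
    by (subst filterlim_at_right_to_0)
  have nt': "\<forall>\<^sub>F t in at_right 0. - t + s \<notin> turning"
    using dir_pos_right
    by eventually_elim (auto simp: turning_def zero_shift(2)[OF assms] dir_minus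
        simp del: uminus_add_conv_diff)
  have "filterlim (\<lambda>t. deriv wave (- (t + - s))) at_bot (at_right 0)"
  proof (rule filterlim_cong[THEN iffD1, OF refl refl])
    show "\<forall>\<^sub>F t in at_right 0. - speed (wave t) = deriv wave (- (t + - s))"
      using dir_pos_right nt'
    proof eventually_elim
      case (elim t)
      have "- (t + - s) = - t + s" by simp
      then show ?case
        using elim zero_shift[OF assms, of "- t"] by (simp add: deriv_wave dir_minus)
    qed
    have "filterlim (\<lambda>t. speed (wave t)) at_top (at_right 0)"
      using filterlim_speed_wave by (rule filterlim_mono) (auto simp: at_le)
    then show "filterlim (\<lambda>t. - speed (wave t)) at_bot (at_right 0)"
      by (simp add: filterlim_uminus_at_bot)
  qed
  then have 2: "filterlim (deriv wave) at_bot (at_left s)"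
    by (subst filterlim_at_left_to_right, subst filterlim_at_right_to_0)
  show ?thesis using 1 2 by (simp add: cusp_at_def)
qed

end

section \<open>Every orbit through a zero is a translate of the profile\<close>

context analytic_cusp_level
begin

text \<open>The properties of a cusped solution that determine it. The derivative is carried as a second
function \<open>v\<close>, so that translation and reflection need no computation with \<open>deriv\<close> at cusps. Two
derivatives are required where \<open>u\<close> is positive, because the energy relation alone would let a solution
rest at a crest for some time.\<close>

definition orbit :: "(real \<Rightarrow> real) \<Rightarrow> (real \<Rightarrow> real) \<Rightarrow> bool" where
  "orbit u v \<longleftrightarrow> (\<forall>t. isCont u t) \<and> (\<forall>t. 0 \<le> u t) \<and>
     (\<forall>t. 0 < u t \<longrightarrow> (u has_real_derivative v t) (at t) \<and>
        (\<exists>D. (v has_real_derivative D) (at t)) \<and> u t * (v t)\<^sup>2 / 2 + F (u t) = F m) \<and>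
     (\<forall>s. u s = 0 \<longrightarrow> (\<exists>\<delta>>0. (\<forall>t\<in>{s<..<s+\<delta>}. 0 < u t \<and> 0 < v t) \<and>
        (\<forall>t\<in>{s-\<delta><..<s}. 0 < u t \<and> v t < 0)))"

lemma orbitD:
  assumes "orbit u v"
  shows "isCont u t" "0 \<le> u t"
    and "0 < u t \<Longrightarrow> (u has_real_derivative v t) (at t)"
    and "0 < u t \<Longrightarrow> \<exists>D. (v has_real_derivative D) (at t)"
    and "0 < u t \<Longrightarrow> u t * (v t)\<^sup>2 / 2 + F (u t) = F m"
    and "u s = 0 \<Longrightarrow> \<exists>\<delta>>0. (\<forall>t\<in>{s<..<s+\<delta>}. 0 < u t \<and> 0 < v t) \<and>
        (\<forall>t\<in>{s-\<delta><..<s}. 0 < u t \<and> v t < 0)"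
  using assms by (auto simp: orbit_def)

lemma orbit_shift:
  assumes "orbit u v" shows "orbit (\<lambda>t. u (t + c)) (\<lambda>t. v (t + c))"
proof -
  note o = orbitD[OF assms]
  have "\<exists>\<delta>>0. (\<forall>t\<in>{s<..<s+\<delta>}. 0 < u (t + c) \<and> 0 < v (t + c)) \<and>
        (\<forall>t\<in>{s-\<delta><..<s}. 0 < u (t + c) \<and> v (t + c) < 0)" if s: "u (s + c) = 0" for s
  proof -
    obtain \<delta> where d: "\<delta> > 0" "\<forall>t\<in>{s+c<..<s+c+\<delta>}. 0 < u t \<and> 0 < v t"
        "\<forall>t\<in>{s+c-\<delta><..<s+c}. 0 < u t \<and> v t < 0"
      using o(6)[OF s] by blast
    then show ?thesis by (intro exI[of _ \<delta>]) auto
  qed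
  moreover have "isCont (\<lambda>t. u (t + c)) t" for t
    by (rule isCont_o2[where g = u]) (auto intro!: continuous_intros o(1))
  moreover have "((\<lambda>t. u (t + c)) has_real_derivative v (t + c)) (at t)" if "0 < u (t + c)" for t
    using o(3)[OF that] by (simp add: DERIV_shift)
  moreover have "\<exists>D. ((\<lambda>t. v (t + c)) has_real_derivative D) (at t)" if "0 < u (t + c)" for t
    using o(4)[OF that] by (simp add: DERIV_shift)
  ultimately show ?thesis using o(2,5) by (simp add: orbit_def)
qed

lemma orbit_reflect:
  assumes "orbit u v" shows "orbit (\<lambda>t. u (- t)) (\<lambda>t. - v (- t))"
proof -
  note o = orbitD[OF assms]
  have "\<exists>\<delta>>0. (\<forall>t\<in>{s<..<s+\<delta>}. 0 < u (- t) \<and> 0 < - v (- t)) \<and>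
        (\<forall>t\<in>{s-\<delta><..<s}. 0 < u (- t) \<and> - v (- t) < 0)" if s: "u (- s) = 0" for s
  proof -
    obtain \<delta> where d: "\<delta> > 0" "\<forall>t\<in>{-s<..<-s+\<delta>}. 0 < u t \<and> 0 < v t"
        "\<forall>t\<in>{-s-\<delta><..<-s}. 0 < u t \<and> v t < 0"
      using o(6)[OF s] by blast
    then show ?thesis by (intro exI[of _ \<delta>]) auto
  qed
  moreover have "isCont (\<lambda>t. u (- t)) t" for t
    by (rule isCont_o2[where g = u]) (auto intro!: continuous_intros o(1))
  moreover have "((\<lambda>t. u (- t)) has_real_derivative - v (- t)) (at t)" if "0 < u (- t)" for t
    using o(3)[OF that] by (simp add: DERIV_mirror)
  moreover have "\<exists>D. ((\<lambda>t. - v (- t)) has_real_derivative D) (at t)" if pos: "0 < u (- t)" for t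
  proof -
    obtain D where "(v has_real_derivative D) (at (- t))" using o(4)[OF pos] by blast
    then have "((\<lambda>t. v (- t)) has_real_derivative - D) (at t)" by (simp add: DERIV_mirror)
    from DERIV_minus[OF this] show ?thesis by blast
  qed
  ultimately show ?thesis using o(2,5) by (simp add: orbit_def)
qed

lemma orbit_speed:
  assumes "orbit u v" "0 < u t" "u t < m" shows "\<bar>v t\<bar> = speed (u t)"
proof -
  have "(v t)\<^sup>2 = 2 * (F m - F (u t)) / u t"
    using orbitD(5)[OF assms(1,2)] assms by (simp add: field_simps)
  then show ?thesis unfolding speed_def by (metis real_sqrt_abs)
qed

text \<open>Strictly between zero and crest the speed does not vanish, so the direction is constant and the
rising time of the current height changes at unit rate.\<close>

lemma orbit_phase:
  assumes orb: "orbit u v" and ab: "a < b" and a: "u a \<in> heights"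
    and inside: "\<And>t. t \<in> {a<..<b} \<Longrightarrow> 0 < u t \<and> u t < m"
    and \<sigma>: "\<sigma> = 1 \<or> \<sigma> = - 1"
    and t0: "t0 \<in> {a<..<b}" "0 < \<sigma> * v t0"
    and t: "t \<in> {a<..<b}"
  shows "time (u t) = time (u a) + \<sigma> * (t - a)"
proof -
  note o = orbitD[OF orb]
  have vc: "isCont v s" if "s \<in> {a<..<b}" for s
    using o(4)[of s] inside[OF that] DERIV_isCont by blast
  have v_ne: "v s \<noteq> 0" if "s \<in> {a<..<b}" for s
    using orbit_speed[OF orb, of s] speed_pos[of "u s"] inside[OF that] by auto
  have v: "v s = \<sigma> * speed (u s)" if s: "s \<in> {a<..<b}" for s
  proof -
    have "0 < \<sigma> * v s"
    proof (rule ccontr)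
      assume "\<not> 0 < \<sigma> * v s"
      then have neg: "\<sigma> * v s \<le> 0" by simp
      have ivl: "{min s t0..max s t0} \<subseteq> {a<..<b}" using s t0 by auto
      have "connected ((\<lambda>r. \<sigma> * v r) ` {min s t0..max s t0})"
        using ivl by (intro connected_continuous_image continuous_at_imp_continuous_on ballI
            continuous_intros vc) auto
      then have "0 \<in> (\<lambda>r. \<sigma> * v r) ` {min s t0..max s t0}"
        using neg t0(2) by (rule_tac connectedD_interval[of _ "\<sigma> * v s" "\<sigma> * v t0"]) auto
      then show False using ivl v_ne \<sigma> by auto
    qed
    then show ?thesis
      using \<sigma> orbit_speed[OF orb, of s] inside[OF s] by (auto simp: abs_if split: if_splits)
  qed
  \<comment> \<open>\<open>time\<close> is continuous on the values taken on \<open>{a..t}\<close>, the left end included.\<close>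
  have "\<exists>b\<in>heights. \<forall>s\<in>{a..t}. u s \<le> b"
  proof -
    have "continuous_on {a..t} u" by (intro continuous_at_imp_continuous_on ballI o(1))
    then obtain s where s: "s \<in> {a..t}" "\<forall>r\<in>{a..t}. u r \<le> u s"
      using continuous_attains_sup[OF compact_Icc, of a t u] t by auto
    have "u s \<in> heights"
      using s t a inside[of s] range_setI[of "u s"] by (cases "s = a") auto
    then show ?thesis using s by blast
  qed
  then obtain b' where b': "b' \<in> heights" "\<And>s. s \<in> {a..t} \<Longrightarrow> u s \<le> b'" by blast
  define f where "f s = time (u s) - \<sigma> * (s - a)" for s
  have "f t = f a"
  proof (rule DERIV_isconst_end[of a t f])
    have "continuous_on {a..t} (\<lambda>s. time (u s))"
      by (rule continuous_on_compose2[OF continuous_time[OF b'(1)]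
            continuous_at_imp_continuous_on]) (use b'(2) o(1,2) in auto)
    then show "continuous_on {a..t} f" unfolding f_def[abs_def] by (intro continuous_intros)
    fix s assume "a < s" "s < t"
    then have s: "s \<in> {a<..<b}" using t by auto
    have "((\<lambda>s. time (u s)) has_real_derivative slowness (u s) * v s) (at s)"
      using inside[OF s] by (intro DERIV_chain2[where f = time and g = u] DERIV_time o(3)) auto
    then have "(f has_real_derivative slowness (u s) * v s - \<sigma>) (at s)"
      unfolding f_def[abs_def] by (auto intro!: derivative_eq_intros)
    moreover have "slowness (u s) * v s - \<sigma> = 0"
      using inside[OF s] speed_pos[of "u s"] by (simp add: v[OF s] slowness_speed)
    ultimately show "(f has_real_derivative 0) (at s)" by simp
  qed (use t in auto)
  then show ?thesis by (simp add: f_def)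
qed

text \<open>At the first time at which the orbit left the open strip between zero and crest, continuity would
still give it the height predicted by the profile, which lies inside the strip.\<close>

lemma orbit_launch:
  assumes orb: "orbit u v" and a: "u a \<in> heights"
    and range: "\<And>t. t \<in> {a<..<c} \<Longrightarrow> time (u a) + \<sigma> * (t - a) \<in> rise_times"
    and \<sigma>: "\<sigma> = 1 \<or> \<sigma> = - 1"
    and start: "0 < \<delta>" "\<And>t. t \<in> {a<..<a+\<delta>} \<Longrightarrow> 0 < u t \<and> u t < m \<and> 0 < \<sigma> * v t"
    and t: "t \<in> {a<..<c}"
  shows "u t = height (time (u a) + \<sigma> * (t - a))"
proof -
  note o = orbitD[OF orb]
  have cu: "continuous_on A u" for A by (intro continuous_at_imp_continuous_on ballI o(1))
  have phase: "time (u s) = time (u a) + \<sigma> * (s - a)"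
    if b: "\<And>s. s \<in> {a<..<b} \<Longrightarrow> 0 < u s \<and> u s < m" and s: "s \<in> {a<..<b}" for s b
  proof -
    define t0 where "t0 = a + min \<delta> (b - a) / 2"
    have "t0 \<in> {a<..<b}" "t0 \<in> {a<..<a+\<delta>}"
      using s start(1) by (auto simp: t0_def min_def field_simps)
    then show ?thesis using s start(2)[of t0] b
      by (intro orbit_phase[OF orb _ a _ \<sigma>, of b t0]) auto
  qed
  have good: "0 < u r \<and> u r < m" if r: "r \<in> {a<..<c}" for r
  proof (rule ccontr)
    assume bad: "\<not> (0 < u r \<and> u r < m)"
    define B where "B = {s \<in> {a+\<delta>/2..r}. u s \<le> 0} \<union> {s \<in> {a+\<delta>/2..r}. m \<le> u s}"
    have rd: "a + \<delta> \<le> r" using start(2)[of r] bad r by force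
    then have "r \<in> B" using bad start(1) by (auto simp: B_def)
    moreover have "compact B"
      unfolding B_def compact_eq_bounded_closed
      by (intro conjI closed_Un continuous_closed_preimage_constant
          continuous_on_closed_Collect_le[OF cu] continuous_on_closed_Collect_le[OF _ cu]
          bounded_subset[OF bounded_closed_interval[of "a+\<delta>/2" r]]) auto
    ultimately obtain b where b: "b \<in> B" "\<And>s. s \<in> B \<Longrightarrow> b \<le> s"
      using compact_attains_inf[of B] by blast
    have ab: "a < b" "b \<le> r" using b(1) start(1) by (auto simp: B_def)
    have in_b: "0 < u s \<and> u s < m" if "s \<in> {a<..<b}" for s
    proof (cases "s < a + \<delta>")
      case True
      then show ?thesis using start(2)[of s] that by auto
    next
      case False
      then have "s \<notin> B" using b(2)[of s] that by auto
      then show ?thesis using False that ab start(1) by (auto simp: B_def not_le)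
    qed
    define y where "y s = time (u a) + \<sigma> * (s - a)" for s
    have "(u \<longlongrightarrow> height (y b)) (at_left b)"
    proof (rule Lim_transform_eventually)
      have "y b \<in> rise_times" using range[of b] ab r by (simp add: y_def)
      then have "isCont height (y b)" using DERIV_height DERIV_isCont by blast
      then have "isCont (\<lambda>s. height (y s)) b"
        by (rule isCont_o2[where f = y and g = height, rotated])
          (auto simp: y_def[abs_def] intro!: continuous_intros)
      then show "((\<lambda>s. height (y s)) \<longlongrightarrow> height (y b)) (at_left b)"
        unfolding isCont_def by (rule filterlim_mono) (auto simp: at_le)
      show "\<forall>\<^sub>F s in at_left b. height (y s) = u s"
        using eventually_at_left_real[OF ab(1)]
      proof eventually_elim
        case (elim s)
        then show ?case using phase[OF in_b elim] in_b[OF elim] range_setI[of "u s"] height_time[of "u s"]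
          by (simp add: y_def)
      qed
    qed
    moreover have "(u \<longlongrightarrow> u b) (at_left b)"
      using o(1)[of b] unfolding isCont_def by (rule filterlim_mono) (auto simp: at_le)
    ultimately have "u b = height (y b)"
      using tendsto_unique[of "at_left b" u] by auto
    moreover have "y b \<in> rise_times" using range[of b] ab r by (simp add: y_def)
    ultimately have "0 < u b" "u b < m" using height_rise_times by auto
    then show False using b(1) by (auto simp: B_def)
  qed
  then show ?thesis
    using phase[OF good t] good[OF t] height_time[of "u t"] range_setI[of "u t"] by simp
qed

text \<open>Before the crest, \<open>v' = - (v\<^sup>2 / 2 + F' u) / u \<le> - \<kappa> < 0\<close>, so the derivative of \<open>v\<close> at the crest is
also negative. As \<open>v\<close> vanishes there, it is negative just after the crest, and the orbit turns back
instead of resting at the level \<open>m\<close>.\<close>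

lemma orbit_crest:
  assumes orb: "orbit u v" and nc: "deriv F m \<noteq> 0" and b: "u b = m" and ab: "a < b"
    and inside: "\<And>t. t \<in> {a<..<b} \<Longrightarrow> 0 < u t \<and> u t < m"
  obtains \<delta> where "0 < \<delta>" "\<And>t. t \<in> {b<..<b+\<delta>} \<Longrightarrow> 0 < u t \<and> u t < m \<and> v t < 0"
proof -
  note o = orbitD[OF orb]
  have F': "0 < deriv F m" using nc deriv_nonneg by simp
  define \<kappa> where "\<kappa> = deriv F m / (2 * m)"
  have \<kappa>: "0 < \<kappa>" using F' m_pos by (simp add: \<kappa>_def)
  have vb: "v b = 0" using o(5)[of b] b m_pos by simp
  obtain D where D: "(v has_real_derivative D) (at b)" using o(4)[of b] b m_pos by auto
  have v': "(v has_real_derivative - ((v t)\<^sup>2 / 2 + deriv F (u t)) / u t) (at t)"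
    if t: "0 < u t" "u t < m" for t
  proof -
    obtain E where E: "(v has_real_derivative E) (at t)" using o(4)[OF t(1)] by blast
    have "((\<lambda>t. u t * (v t)\<^sup>2 / 2 + F (u t)) has_real_derivative
        v t * ((v t)\<^sup>2 / 2 + u t * E + deriv F (u t))) (at t)"
      by (auto intro!: derivative_eq_intros o(3)[OF t(1)] E DERIV_chain2[OF DERIV_F]
          simp: power2_eq_square algebra_simps)
    moreover
    have "\<forall>\<^sub>F s in nhds t. 0 < u s"
      using o(1)[of t] t(1) unfolding isCont_def tendsto_at_iff_tendsto_nhds
      by (rule order_tendstoD(1))
    then have "\<forall>\<^sub>F s in nhds t. u s * (v s)\<^sup>2 / 2 + F (u s) = F m"
      by eventually_elim (rule o(5))
    from DERIV_cong_ev[OF refl this refl]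
    have "((\<lambda>t. u t * (v t)\<^sup>2 / 2 + F (u t)) has_real_derivative 0) (at t)"
      by simp
    ultimately have "v t * ((v t)\<^sup>2 / 2 + u t * E + deriv F (u t)) = 0"
      by (rule DERIV_unique)
    moreover have "v t \<noteq> 0" using orbit_speed[OF orb t] speed_pos[OF t] by auto
    ultimately have "(v t)\<^sup>2 / 2 + u t * E + deriv F (u t) = 0" by simp
    then have "E = - ((v t)\<^sup>2 / 2 + deriv F (u t)) / u t"
      using t by (simp add: field_simps)
    then show ?thesis using E by simp
  qed
  have "isCont (\<lambda>t. deriv F (u t)) b"
    by (rule isCont_o2[where g = "deriv F", OF o(1)])
      (intro real_analytic_at_isCont real_analytic_at_deriv F_analytic)
  then have "((\<lambda>t. deriv F (u t)) \<longlongrightarrow> deriv F m) (at_left b)"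
    unfolding isCont_def b by (rule filterlim_mono) (auto simp: at_le)
  then have "\<forall>\<^sub>F t in at_left b. deriv F m / 2 < deriv F (u t)"
    by (rule order_tendstoD(1)) (use F' in simp)
  then obtain b1 where b1: "b1 < b" "\<And>t. b1 < t \<Longrightarrow> t < b \<Longrightarrow> deriv F m / 2 < deriv F (u t)"
    by (auto simp: eventually_at_left_field)
  define a' where "a' = max a b1"
  have a': "a' < b" using ab b1 by (simp add: a'_def)
  have "D \<le> - \<kappa>"
  proof (rule tendsto_upperbound)
    show "((\<lambda>t. (v t - v b) / (t - b)) \<longlongrightarrow> D) (at_left b)"
      using D unfolding has_field_derivative_iff by (rule filterlim_mono) (auto simp: at_le)
    show "\<forall>\<^sub>F t in at_left b. (v t - v b) / (t - b) \<le> - \<kappa>"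
      using eventually_at_left_real[OF a']
    proof eventually_elim
      case (elim t)
      have "continuous_on {t..b} v"
      proof (intro continuous_at_imp_continuous_on ballI)
        fix s assume "s \<in> {t..b}"
        then have "0 < u s" using inside[of s] elim b m_pos by (cases "s = b") (auto simp: a'_def)
        then show "isCont v s" using o(4) DERIV_isCont by blast
      qed
      moreover have "\<exists>E. (v has_real_derivative E) (at s)" if "t < s" "s < b" for s
        using that elim inside[of s] v'[of s] by (auto simp: a'_def)
      ultimately obtain E \<xi> where E: "t < \<xi>" "\<xi> < b" "(v has_real_derivative E) (at \<xi>)"
          "v b - v t = (b - t) * E"
        using MVT[of t b v] elim by (auto simp: real_differentiable_def)
      have ux: "0 < u \<xi>" "u \<xi> < m" using inside[of \<xi>] E elim by (auto simp: a'_def)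
      have "E = - (((v \<xi>)\<^sup>2 / 2 + deriv F (u \<xi>)) / u \<xi>)"
        using DERIV_unique[OF E(3) v'[OF ux]] by (simp only: minus_divide_left)
      moreover have "\<kappa> \<le> ((v \<xi>)\<^sup>2 / 2 + deriv F (u \<xi>)) / u \<xi>"
      proof -
        have "deriv F m / 2 / m \<le> ((v \<xi>)\<^sup>2 / 2 + deriv F (u \<xi>)) / u \<xi>"
          using b1(2)[of \<xi>] E elim ux F'
            by (intro frac_le) (auto simp: a'_def intro: add_increasing)
        then show ?thesis by (simp add: \<kappa>_def)
      qed
      ultimately have "E \<le> - \<kappa>" by (simp only: neg_le_iff_le)
      moreover have "(v t - v b) / (t - b) = E" using E(1,2,4) by (simp add: field_simps)
      ultimately show ?case by simp
    qed
  qed auto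
  then have "D < 0" using \<kappa> by simp
  then obtain d1 where d1: "0 < d1" "\<And>h. 0 < h \<Longrightarrow> h < d1 \<Longrightarrow> v (b + h) < v b"
    using DERIV_neg_dec_right[OF D] by blast
  have "\<forall>\<^sub>F s in nhds b. 0 < u s"
    using o(1)[of b] m_pos b unfolding isCont_def tendsto_at_iff_tendsto_nhds
    by (metis order_tendstoD(1))
  then obtain d2 where d2: "0 < d2" "\<And>s. dist s b < d2 \<Longrightarrow> 0 < u s"
    unfolding eventually_nhds_metric by blast
  define \<delta> where "\<delta> = min d1 d2"
  have vneg: "v t < 0" "0 < u t" if "t \<in> {b<..<b+\<delta>}" for t
    using d1(2)[of "t - b"] d2(2)[of t] that vb by (auto simp: \<delta>_def dist_real_def)
  have "u t < m" if t: "t \<in> {b<..<b+\<delta>}" for t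
  proof -
    have "u t < u b"
    proof (rule DERIV_neg_imp_decreasing_open[of b t u])
      show "\<exists>y. (u has_real_derivative y) (at s) \<and> y < 0" if "b < s" "s < t" for s
        using vneg[of s] o(3)[of s] that t by auto
      show "continuous_on {b..t} u" by (intro continuous_at_imp_continuous_on ballI o(1))
    qed (use t in auto)
    then show ?thesis using b by simp
  qed
  then show ?thesis using that[of \<delta>] vneg d1 d2 by (auto simp: \<delta>_def)
qed

lemma isCont_eq_right_end:
  fixes f g :: "real \<Rightarrow> real"
  assumes "a < b" "isCont f b" "isCont g b" "\<And>t. t \<in> {a<..<b} \<Longrightarrow> f t = g t"
  shows "f b = g b"
proof (rule tendsto_unique[of "at_left b" f])
  show "(f \<longlongrightarrow> f b) (at_left b)"
    using assms(2) unfolding isCont_def by (rule filterlim_mono) (auto simp: at_le)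
  have "(g \<longlongrightarrow> g b) (at_left b)"
    using assms(3) unfolding isCont_def by (rule filterlim_mono) (auto simp: at_le)
  moreover have "\<forall>\<^sub>F t in at_left b. g t = f t"
    using eventually_at_left_real[OF assms(1)] by eventually_elim (use assms(4) in simp)
  ultimately show "(f \<longlongrightarrow> g b) (at_left b)" by (rule Lim_transform_eventually)
qed simp

lemma isCont_wave: "isCont wave t"
  using continuous_wave[of UNIV] by (simp add: continuous_on_eq_continuous_at)

lemma orbit_start:
  assumes orb: "orbit u v" and 0: "u 0 = 0"
  obtains \<delta> where "0 < \<delta>" "\<And>t. t \<in> {0<..<0+\<delta>} \<Longrightarrow> 0 < u t \<and> u t < m \<and> 0 < 1 * v t"
proof -
  obtain d1 where d1: "d1 > 0" "\<forall>t\<in>{0<..<0+d1}. 0 < u t \<and> 0 < v t"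
    using orbitD(6)[OF assms] by blast
  have "\<forall>\<^sub>F s in nhds 0. u s < m"
    using orbitD(1)[OF orb, of 0] m_pos 0 unfolding isCont_def tendsto_at_iff_tendsto_nhds
    by (metis order_tendstoD(2))
  then obtain d2 where d2: "0 < d2" "\<And>s. dist s 0 < d2 \<Longrightarrow> u s < m"
    unfolding eventually_nhds_metric by blast
  show ?thesis
    by (rule that[of "min d1 d2"]) (use d1 d2 in \<open>auto simp: dist_real_def\<close>)
qed

lemma orbit_half_period:
  assumes orb: "orbit u v" and 0: "u 0 = 0" and t: "0 < t" "deriv F m \<noteq> 0 \<Longrightarrow> t < half_period"
  shows "u t = wave t"
proof -
  obtain \<delta> where d: "0 < \<delta>" "\<And>t. t \<in> {0<..<0+\<delta>} \<Longrightarrow> 0 < u t \<and> u t < m \<and> 0 < 1 * v t"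
    using orbit_start[OF assms(1,2)] by blast
  define c where "c = (if deriv F m = 0 then t + 1 else half_period)"
  have "u t = height (time (u 0) + 1 * (t - 0))"
  proof (rule orbit_launch[OF orb _ _ _ d])
    show "time (u 0) + 1 * (s - 0) \<in> rise_times" if "s \<in> {0<..<c}" for s
      using that 0 by (auto simp: rise_times_def c_def split: if_splits)
    show "t \<in> {0<..<c}" using t by (auto simp: c_def)
  qed (use 0 m_pos in \<open>auto simp: heights_def\<close>)
  moreover have "folded t = t" using t by (intro folded_ident) auto
  ultimately show ?thesis using 0 by (simp add: wave_def)
qed

lemma wave_half_period: "deriv F m \<noteq> 0 \<Longrightarrow> wave half_period = m"
  using half_period_pos by (simp add: wave_def folded_ident height_half_period)

lemma wave_period_zero: "deriv F m \<noteq> 0 \<Longrightarrow> wave (2 * half_period) = 0"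
  using half_period_pos by (simp add: wave_zero_iff folded_def mult.commute[of pi])

text \<open>Rise, turn and fall: the orbit is launched upwards from the zero and downwards from the crest, and the
two branches agree with the profile up to their end points by continuity.\<close>

lemma orbit_period:
  assumes orb: "orbit u v" and 0: "u 0 = 0" and nc: "deriv F m \<noteq> 0"
    and t: "0 \<le> t" "t \<le> 2 * half_period"
  shows "u t = wave t"
proof -
  note p = half_period_pos[OF nc]
  note c = orbitD(1)[OF orb]
  have left: "u t = wave t" if "t \<in> {0<..<half_period}" for t
    using that orbit_half_period[OF orb 0] by auto
  have crest: "u half_period = m"
    using isCont_eq_right_end[OF p c isCont_wave left] wave_half_period[OF nc] by simp
  have inside: "0 < u t \<and> u t < m" if "t \<in> {0<..<half_period}" for t
    using left[OF that] that nc height_rise_times[of t]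
      by (simp add: wave_def folded_ident rise_times_def)
  obtain \<delta> where d: "0 < \<delta>"
    "\<And>t. t \<in> {half_period<..<half_period+\<delta>} \<Longrightarrow> 0 < u t \<and> u t < m \<and> v t < 0"
    using orbit_crest[OF orb nc crest p inside] by blast
  have wr: "wave t = height (2 * half_period - t)" if "t \<in> {half_period..2 * half_period}" for t
  proof -
    have "wave t = wave (- (t - 2 * half_period))"
      using zero_shift(3)[OF wave_period_zero[OF nc], of "t - 2 * half_period"]
        by (simp del: minus_diff_eq)
    then show ?thesis using that by (simp add: wave_def folded_ident)
  qed
  have right: "u t = wave t" if t: "t \<in> {half_period<..<2 * half_period}" for t
  proof -
    have "u t = height (time (u half_period) + (- 1) * (t - half_period))"
    proof (rule orbit_launch[OF orb _ _ _ d(1) _ t])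
      show "time (u half_period) + - 1 * (s - half_period) \<in> rise_times"
        if "s \<in> {half_period<..<2 * half_period}" for s
        using that nc by (auto simp: rise_times_def crest half_period_def[symmetric])
    qed (use d nc m_pos in \<open>auto simp: crest heights_def\<close>)
    then show ?thesis using wr[of t] t by (simp add: crest half_period_def[symmetric] algebra_simps)
  qed
  have "half_period < 2 * half_period" using p by simp
  then have fin: "u (2 * half_period) = wave (2 * half_period)"
    by (rule isCont_eq_right_end[OF _ c isCont_wave right])
  consider "t = 0" | "t \<in> {0<..<half_period}" | "t = half_period"
    | "t \<in> {half_period<..<2 * half_period}" | "t = 2 * half_period"
    using t by fastforce
  then show ?thesis
    by cases (auto simp: 0 left right fin crest wave_half_period[OF nc])
qed

lemma orbit_forward:
  assumes "orbit u v" "u 0 = 0" "0 \<le> t"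
  shows "u t = wave t"
proof (cases "deriv F m = 0")
  case True
  then show ?thesis using assms orbit_half_period[OF assms(1,2)] by (cases "t = 0") auto
next
  case False
  note p = half_period_pos[OF False]
  have "u t = wave t" if "0 \<le> t" "t \<le> of_nat n * (2 * half_period)" "orbit u v" "u 0 = 0" for n u v t
    using that
  proof (induction n arbitrary: u v t)
    case 0
    then show ?case by simp
  next
    case (Suc n)
    show ?case
    proof (cases "t \<le> 2 * half_period")
      case True
      then show ?thesis using orbit_period[OF Suc.prems(3,4) False] Suc.prems by simp
    next
      case gt: False
      let ?c = "2 * half_period"
      have z: "u ?c = 0"
        using orbit_period[OF Suc.prems(3,4) False, of ?c] wave_period_zero[OF False] p by simp
      have "u (t - ?c + ?c) = wave (t - ?c)"
        using Suc.IH[OF _ _ orbit_shift[OF Suc.prems(3)], of "t - ?c" ?c] z gt Suc.prems(2)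
        by (simp add: algebra_simps)
      also have "\<dots> = wave (t - ?c + ?c)"
        by (rule zero_shift(3)[OF wave_period_zero[OF False], symmetric])
      finally show ?thesis by simp
    qed
  qed
  moreover obtain n where "t / (2 * half_period) < of_nat n" using reals_Archimedean2 by blast
  then have "t \<le> of_nat n * (2 * half_period)" using p by (simp add: field_simps)
  ultimately show ?thesis using assms by blast
qed

text \<open>Translating the zero to the origin and reflecting reduces this to forward times.\<close>

lemma orbit_eq_wave:
  assumes orb: "orbit u v" and s: "u s = 0"
  shows "u t = wave (t - s)"
proof (cases "s \<le> t")
  case True
  then show ?thesis using orbit_forward[OF orbit_shift[OF orb, of s], of "t - s"] s by simp
next
  case False
  have "u (- (s - t) + s) = wave (s - t)"
    using orbit_forward[OF orbit_reflect[OF orbit_shift[OF orb, of s]], of "s - t"] s False by simp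
  then show ?thesis using wave_minus[of "s - t"] by simp
qed

end

section \<open>Consequences of the energy relation at a cusp\<close>

lemma islimpt_minus_countable:
  fixes t :: real assumes "countable S" shows "t islimpt - S"
proof (rule islimptI)
  fix T :: "real set" assume "t \<in> T" "open T"
  then obtain e where e: "e > 0" "ball t e \<subseteq> T" by (auto simp: open_contains_ball)
  have "\<not> {t<..<t+e} \<subseteq> S"
    using countable_subset[OF _ assms] uncountable_open_interval[of t "t + e"] e(1) by auto
  then obtain y where y: "y \<in> {t<..<t+e}" "y \<notin> S" by blast
  then have "y \<in> ball t e" by (simp add: dist_real_def)
  then show "\<exists>y\<in>-S. y \<in> T \<and> y \<noteq> t" using y e by (intro bexI[of _ y]) auto
qed

text \<open>Since \<open>deriv u\<close> takes both signs near a cusp, an interval on which it has one sign contains no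
cusp. This is how cusps are seen to be isolated.\<close>

lemma cusp_at_both_signs:
  assumes "cusp_at u s" "e > 0"
  shows "\<exists>t. \<bar>t - s\<bar> < e \<and> 0 < deriv u t" "\<exists>t. \<bar>t - s\<bar> < e \<and> deriv u t < 0"
proof -
  have r: "\<forall>\<^sub>F t in at_right s. \<bar>t - s\<bar> < e"
    using eventually_at_right_real[of s "s + e"] assms(2) by (auto elim: eventually_mono)
  have l: "\<forall>\<^sub>F t in at_left s. \<bar>t - s\<bar> < e"
    using eventually_at_left_real[of "s - e" s] assms(2) by (auto elim: eventually_mono)
  consider "filterlim (deriv u) at_top (at_right s)" "filterlim (deriv u) at_bot (at_left s)"
    | "filterlim (deriv u) at_bot (at_right s)" "filterlim (deriv u) at_top (at_left s)"
    using assms(1) by (auto simp: cusp_at_def)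
  then have "(\<exists>t. \<bar>t - s\<bar> < e \<and> 0 < deriv u t) \<and> (\<exists>t. \<bar>t - s\<bar> < e \<and> deriv u t < 0)"
  proof cases
    case 1
    have "\<forall>\<^sub>F t in at_right s. \<bar>t - s\<bar> < e \<and> 0 < deriv u t"
      using r 1(1)[unfolded filterlim_at_top_dense, rule_format, of 0] by eventually_elim simp
    moreover have "\<forall>\<^sub>F t in at_left s. \<bar>t - s\<bar> < e \<and> deriv u t < 0"
      using l 1(2)[unfolded filterlim_at_bot_dense, rule_format, of 0] by eventually_elim simp
    ultimately show ?thesis
      using eventually_happens'[OF trivial_limit_at_right_real[of s]]
        eventually_happens'[OF trivial_limit_at_left_real[of s]] by blast
  next
    case 2
    have "\<forall>\<^sub>F t in at_left s. \<bar>t - s\<bar> < e \<and> 0 < deriv u t"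
      using l 2(2)[unfolded filterlim_at_top_dense, rule_format, of 0] by eventually_elim simp
    moreover have "\<forall>\<^sub>F t in at_right s. \<bar>t - s\<bar> < e \<and> deriv u t < 0"
      using r 2(1)[unfolded filterlim_at_bot_dense, rule_format, of 0] by eventually_elim simp
    ultimately show ?thesis
      using eventually_happens'[OF trivial_limit_at_right_real[of s]]
        eventually_happens'[OF trivial_limit_at_left_real[of s]] by blast
  qed
  then show "\<exists>t. \<bar>t - s\<bar> < e \<and> 0 < deriv u t" "\<exists>t. \<bar>t - s\<bar> < e \<and> deriv u t < 0" by auto
qed

locale cusped_wave =
  fixes F :: "real \<Rightarrow> real" and h :: real and S :: "real set" and u :: "real \<Rightarrow> real"
  assumes F_an: "\<And>x. real_analytic_at F x"
    and cusped: "cusped_TWS F h S u"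
begin

lemma u_TWS: "TWS F u"
  using cusped by (auto simp: cusped_TWS_def singular_TWS_def strong_singular_TWS_def
      weak_singular_TWS_def)

lemma u_cont: "isCont u t"
  using u_TWS by (auto simp: TWS_def H1_loc_def continuous_on_eq_continuous_at)

lemma u_nonneg: "0 \<le> u t"
  using u_TWS by (auto simp: TWS_def)

lemma u_bounded: "\<exists>M. \<forall>t. u t \<le> M"
proof -
  have "bounded (range u)" using u_TWS by (simp add: TWS_def)
  then obtain M where "\<And>t. \<bar>u t\<bar> \<le> M" unfolding bounded_iff by auto
  then show ?thesis by (metis abs_le_D1)
qed

lemma S_countable: "countable S" and S_nonempty: "S \<noteq> {}"
  and S_cusp: "s \<in> S \<Longrightarrow> cusp_at u s" and u_smooth: "smooth_on (- S) u"
  using cusped by (auto simp: cusped_TWS_def)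

lemma u_deriv: "t \<notin> S \<Longrightarrow> (u has_real_derivative deriv u t) (at t)"
  using u_smooth[unfolded smooth_on_def, rule_format, of t 0]
  by (simp add: DERIV_deriv_iff_real_differentiable)

lemma u_deriv2: "t \<notin> S \<Longrightarrow> (deriv u has_real_derivative deriv (deriv u) t) (at t)"
  using u_smooth[unfolded smooth_on_def, rule_format, of t 1]
  by (simp add: DERIV_deriv_iff_real_differentiable)

lemma F_cont: "isCont F x"
  by (rule real_analytic_at_isCont[OF F_an])

lemma F_cont_on: "continuous_on A F"
  by (intro continuous_at_imp_continuous_on ballI F_cont)

text \<open>The exceptional set of the weak singular solution may differ from the set \<open>S\<close> of cusps. Off \<open>S\<close> the
energy is continuous, so its value is the limit along the complement of any countable set.\<close>

lemma u_energy: assumes t: "t \<notin> S" shows "energy F u t = h"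
proof -
  have "isCont (deriv u) t" using u_deriv2[OF t] by (rule DERIV_isCont)
  then have cont: "isCont (energy F u) t"
    unfolding energy_def[abs_def]
    by (intro continuous_intros u_cont isCont_o2[OF u_cont F_cont]) auto
  consider "strong_singular_TWS F h u" | S0 where "weak_singular_TWS F h S0 u"
    using cusped by (auto simp: cusped_TWS_def singular_TWS_def)
  then show ?thesis
  proof cases
    case 1
    then show ?thesis by (simp add: strong_singular_TWS_def classical_energy_solution_on_def)
  next
    case (2 S0)
    show ?thesis
    proof (cases "t \<in> S0")
      case False
      then show ?thesis
        using 2 by (simp add: weak_singular_TWS_def classical_energy_solution_on_def)
    next
      case True
      have "(energy F u \<longlongrightarrow> h) (at t within - S0)"
        using 2 True by (simp add: weak_singular_TWS_def)
      moreover have "(energy F u \<longlongrightarrow> energy F u t) (at t within - S0)"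
        using cont unfolding isCont_def by (rule filterlim_mono) (auto simp: at_le)
      moreover have "at t within - S0 \<noteq> bot"
        using islimpt_minus_countable[of S0 t] 2
        by (simp add: trivial_limit_within weak_singular_TWS_def)
      ultimately show ?thesis using tendsto_unique by blast
    qed
  qed
qed

lemma not_in_S_between: assumes "a < b" obtains t where "t \<in> {a<..<b}" "t \<notin> S"
proof -
  have "\<not> {a<..<b} \<subseteq> S"
    using countable_subset[OF _ S_countable] uncountable_open_interval[of a b] assms by auto
  then show ?thesis using that by blast
qed

text \<open>Where \<open>u\<close> is bounded below by a positive constant, the energy relation bounds its derivative.\<close>

lemma u_cusp_zero: assumes s: "s \<in> S" shows "u s = 0"
proof (rule ccontr)
  assume "u s \<noteq> 0"
  then have c: "0 < u s" using u_nonneg[of s] by simp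
  \<comment> \<open>The bound on \<open>u'\<^sup>2\<close> that the energy relation gives when \<open>u\<close> exceeds half its value at \<open>s\<close> and
    \<open>F u\<close> has dropped by at most \<open>1\<close>.\<close>
  define K where "K = 4 * (h - F (u s) + 1) / u s"
  have "\<forall>\<^sub>F t in at_right s. 1 + \<bar>K\<bar> < \<bar>deriv u t\<bar>"
  proof -
    from S_cusp[OF s] consider "filterlim (deriv u) at_top (at_right s)"
      | "filterlim (deriv u) at_bot (at_right s)" by (auto simp: cusp_at_def)
    then show ?thesis
    proof cases
      case 1
      then have "\<forall>\<^sub>F t in at_right s. 1 + \<bar>K\<bar> < deriv u t" by (simp add: filterlim_at_top_dense)
      then show ?thesis by eventually_elim auto
    next
      case 2
      then have "\<forall>\<^sub>F t in at_right s. deriv u t < - (1 + \<bar>K\<bar>)"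
        by (simp only: filterlim_at_bot_dense)
      then show ?thesis by eventually_elim auto
    qed
  qed
  moreover have "(u \<longlongrightarrow> u s) (at_right s)"
    using u_cont[of s] unfolding isCont_def by (rule filterlim_mono) (auto simp: at_le)
  then have "\<forall>\<^sub>F t in at_right s. u s / 2 < u t"
    by (rule order_tendstoD(1)) (use c in simp)
  moreover have "isCont (\<lambda>t. F (u t)) s" by (rule isCont_o2[OF u_cont F_cont])
  then have "((\<lambda>t. F (u t)) \<longlongrightarrow> F (u s)) (at_right s)"
    unfolding isCont_def by (rule filterlim_mono) (auto simp: at_le)
  then have "\<forall>\<^sub>F t in at_right s. F (u s) - 1 < F (u t)"
    by (rule order_tendstoD(1)) simp
  ultimately have "\<forall>\<^sub>F t in at_right s. 1 + \<bar>K\<bar> < \<bar>deriv u t\<bar> \<and> u s / 2 < u t \<and> F (u s) - 1 < F (u t)"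
    by eventually_elim simp
  then obtain b where b: "s < b" "\<And>t. s < t \<Longrightarrow> t < b \<Longrightarrow>
      1 + \<bar>K\<bar> < \<bar>deriv u t\<bar> \<and> u s / 2 < u t \<and> F (u s) - 1 < F (u t)"
    unfolding eventually_at_right_field by blast
  obtain t where t: "t \<in> {s<..<b}" "t \<notin> S" using not_in_S_between[OF b(1)] by blast
  have e: "u t * (deriv u t)\<^sup>2 / 2 + F (u t) = h" using u_energy[OF t(2)] by (simp add: energy_def)
  have "u s / 2 * (deriv u t)\<^sup>2 \<le> u t * (deriv u t)\<^sup>2"
    using b(2)[of t] t by (intro mult_right_mono) auto
  also have "\<dots> < 2 * (h - F (u s) + 1)" using e b(2)[of t] t by auto
  finally have "(deriv u t)\<^sup>2 < K" using c by (simp add: K_def field_simps)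
  moreover have "(1 + \<bar>K\<bar>)\<^sup>2 \<le> (deriv u t)\<^sup>2"
    using b(2)[of t] t by (intro abs_le_square_iff[THEN iffD1]) auto
  moreover have "K \<le> (1 + \<bar>K\<bar>)\<^sup>2"
    using self_le_power[of "1 + \<bar>K\<bar>" 2] by simp
  ultimately show False by simp
qed

text \<open>As \<open>u\<close> is nonnegative and vanishes at the cusp, it can only rise after the cusp and fall before it.\<close>

lemma u_cusp_right: assumes s: "s \<in> S"
  shows "filterlim (deriv u) at_top (at_right s)" "filterlim (deriv u) at_bot (at_left s)"
    and "\<exists>\<delta>>0. (\<forall>t\<in>{s<..<s+\<delta>}. 0 < u t \<and> 0 < deriv u t) \<and>
        (\<forall>t\<in>{s-\<delta><..<s}. 0 < u t \<and> deriv u t < 0)"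
proof -
  have "\<not> filterlim (deriv u) at_bot (at_right s)"
  proof
    assume "filterlim (deriv u) at_bot (at_right s)"
    then have "\<forall>\<^sub>F t in at_right s. deriv u t < 0" by (simp add: filterlim_at_bot_dense)
    then obtain b where b: "s < b" "\<And>t. s < t \<Longrightarrow> t < b \<Longrightarrow> deriv u t < 0"
      unfolding eventually_at_right_field by blast
    have nS: "t \<notin> S" if t: "s < t" "t < b" for t
    proof
      assume "t \<in> S"
      then obtain r where "\<bar>r - t\<bar> < min (t - s) (b - t)" "0 < deriv u r"
        using cusp_at_both_signs(1)[OF S_cusp, of t "min (t - s) (b - t)"] t by auto
      then show False using b(2)[of r] by (auto simp: abs_less_iff)
    qed
    define t where "t = (s + b) / 2"
    have t: "s < t" "t < b" using b(1) by (auto simp: t_def)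
    have "u t < u s"
    proof (rule DERIV_neg_imp_decreasing_open[of s t u])
      show "\<exists>y. (u has_real_derivative y) (at r) \<and> y < 0" if "s < r" "r < t" for r
        using u_deriv[of r] nS[of r] b(2)[of r] that t by auto
    qed (use t u_cont in \<open>auto intro: continuous_at_imp_continuous_on\<close>)
    then show False using u_cusp_zero[OF s] u_nonneg[of t] by simp
  qed
  then show right: "filterlim (deriv u) at_top (at_right s)"
    and left: "filterlim (deriv u) at_bot (at_left s)"
    using S_cusp[OF s] by (auto simp: cusp_at_def)
  have "\<forall>\<^sub>F t in at_right s. 0 < deriv u t" using right by (simp add: filterlim_at_top_dense)
  then obtain b where b: "s < b" "\<And>t. s < t \<Longrightarrow> t < b \<Longrightarrow> 0 < deriv u t"
    unfolding eventually_at_right_field by blast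
  have "\<forall>\<^sub>F t in at_left s. deriv u t < 0" using left by (simp add: filterlim_at_bot_dense)
  then obtain a where a: "a < s" "\<And>t. a < t \<Longrightarrow> t < s \<Longrightarrow> deriv u t < 0"
    unfolding eventually_at_left_field by blast
  have nSr: "t \<notin> S" if t: "s < t" "t < b" for t
  proof
    assume "t \<in> S"
    then obtain r where "\<bar>r - t\<bar> < min (t - s) (b - t)" "deriv u r < 0"
      using cusp_at_both_signs(2)[OF S_cusp, of t "min (t - s) (b - t)"] t by auto
    then show False using b(2)[of r] by (auto simp: abs_less_iff)
  qed
  have nSl: "t \<notin> S" if t: "a < t" "t < s" for t
  proof
    assume "t \<in> S"
    then obtain r where "\<bar>r - t\<bar> < min (t - a) (s - t)" "0 < deriv u r"
      using cusp_at_both_signs(1)[OF S_cusp, of t "min (t - a) (s - t)"] t by auto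
    then show False using a(2)[of r] by (auto simp: abs_less_iff)
  qed
  have posr: "0 < u t" if t: "s < t" "t < b" for t
  proof -
    have "u s < u t"
    proof (rule DERIV_pos_imp_increasing_open[of s t u])
      show "\<exists>y. (u has_real_derivative y) (at r) \<and> 0 < y" if "s < r" "r < t" for r
        using u_deriv[of r] nSr[of r] b(2)[of r] that t by auto
    qed (use t u_cont in \<open>auto intro: continuous_at_imp_continuous_on\<close>)
    then show ?thesis using u_cusp_zero[OF s] by simp
  qed
  have posl: "0 < u t" if t: "a < t" "t < s" for t
  proof -
    have "u s < u t"
    proof (rule DERIV_neg_imp_decreasing_open[of t s u])
      show "\<exists>y. (u has_real_derivative y) (at r) \<and> y < 0" if "t < r" "r < s" for r
        using u_deriv[of r] nSl[of r] a(2)[of r] that t by auto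
    qed (use t u_cont in \<open>auto intro: continuous_at_imp_continuous_on\<close>)
    then show ?thesis using u_cusp_zero[OF s] by simp
  qed
  show "\<exists>\<delta>>0. (\<forall>t\<in>{s<..<s+\<delta>}. 0 < u t \<and> 0 < deriv u t) \<and>
        (\<forall>t\<in>{s-\<delta><..<s}. 0 < u t \<and> deriv u t < 0)"
    by (rule exI[of _ "min (b - s) (s - a)"]) (use a b posr posl in auto)
qed

text \<open>If \<open>F 0 \<ge> h\<close>, then \<open>u * u'\<^sup>2 / 2 \<le> F 0 - F u = O(u)\<close>, and \<open>u'\<close> would stay bounded at a cusp.\<close>

lemma F_0_less: "F 0 < h"
proof (rule ccontr)
  assume "\<not> F 0 < h"
  then have hF: "h \<le> F 0" by simp
  obtain s where s: "s \<in> S" using S_nonempty by auto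
  define k where "k x = (if x = 0 then deriv F 0 else (F 0 - F x) / (0 - x))" for x
  have k: "F 0 - F x = - x * k x" for x by (simp add: k_def)
  have "isCont k 0"
    using real_analytic_at_isCont[OF real_analytic_at_divided_difference[OF F_an[of 0]]]
    by (simp add: k_def[abs_def])
  then have "isCont (\<lambda>t. k (u t)) s"
    using u_cusp_zero[OF s] by (simp add: isCont_o2[where f = u and g = k, OF u_cont])
  then have "((\<lambda>t. - k (u t)) \<longlongrightarrow> - k (u s)) (at_right s)"
    unfolding isCont_def by (intro tendsto_minus) (erule filterlim_mono, auto simp: at_le)
  then have ev1: "\<forall>\<^sub>F t in at_right s. - k (u t) < - k (u s) + 1"
    by (rule order_tendstoD(2)) simp
  \<comment> \<open>The energy relation bounds \<open>u'\<^sup>2\<close> by \<open>K\<close> near the cusp, while \<open>u' > K \<ge> 1\<close> gives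
    \<open>u'\<^sup>2 > K\<close>.\<close>
  define K where "K = 1 + 2 * \<bar>- k (u s) + 1\<bar>"
  have ev2: "\<forall>\<^sub>F t in at_right s. K < deriv u t"
    using u_cusp_right(1)[OF s] by (simp only: filterlim_at_top_dense)
  obtain \<delta> where d: "\<delta> > 0" "\<forall>t\<in>{s<..<s+\<delta>}. 0 < u t"
    using u_cusp_right(3)[OF s] by blast
  then have ev3: "\<forall>\<^sub>F t in at_right s. 0 < u t"
    using eventually_at_right_real[of s "s + \<delta>"] by (auto elim: eventually_mono)
  have "\<forall>\<^sub>F t in at_right s. - k (u t) < - k (u s) + 1 \<and> K < deriv u t \<and> 0 < u t"
    using ev1 ev2 ev3 by eventually_elim simp
  then obtain b where b: "s < b" "\<And>t. s < t \<Longrightarrow> t < b \<Longrightarrow>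
      - k (u t) < - k (u s) + 1 \<and> K < deriv u t \<and> 0 < u t"
    unfolding eventually_at_right_field by blast
  obtain t where t: "t \<in> {s<..<b}" "t \<notin> S" using not_in_S_between[OF b(1)] by blast
  have bt: "- k (u t) < - k (u s) + 1" "K < deriv u t" "0 < u t" using b(2)[of t] t by auto
  have "u t * (deriv u t)\<^sup>2 = 2 * (h - F (u t))"
    using u_energy[OF t(2)] by (simp add: energy_def)
  also have "\<dots> \<le> 2 * (F 0 - F (u t))" using hF by simp
  also have "\<dots> = u t * (2 * (- k (u t)))" by (simp add: k)
  finally have "u t * (deriv u t)\<^sup>2 \<le> u t * (2 * (- k (u t)))" .
  then have "(deriv u t)\<^sup>2 \<le> 2 * (- k (u t))"
    by (simp only: mult_le_cancel_left_pos[OF bt(3)])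
  also have "\<dots> < 2 * (- k (u s) + 1)" using bt(1) by simp
  also have "\<dots> \<le> 2 * \<bar>- k (u s) + 1\<bar>" by (intro mult_left_mono abs_ge_self) simp
  also have "\<dots> < K" by (simp add: K_def)
  also have "K \<le> K\<^sup>2" by (intro self_le_power) (auto simp: K_def)
  also have "K\<^sup>2 \<le> (deriv u t)\<^sup>2" using bt(2) by (intro power_mono) (auto simp: K_def)
  finally show False by simp
qed

lemma S_eq: "S = {t. u t = 0}"
proof
  show "S \<subseteq> {t. u t = 0}" using u_cusp_zero by auto
  show "{t. u t = 0} \<subseteq> S"
  proof
    fix t assume "t \<in> {t. u t = 0}"
    then show "t \<in> S" using u_energy[of t] F_0_less by (auto simp: energy_def)
  qed
qed

lemma u_critical: "0 < u t \<Longrightarrow> deriv u t = 0 \<Longrightarrow> F (u t) = h"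
  using u_energy[of t] by (auto simp: energy_def S_eq)

text \<open>If \<open>F\<close> stayed below \<open>h\<close>, then \<open>u\<close> would have no critical point at a positive height. After a cusp it
would rise for ever, with a speed bounded below on the compact range of its heights.\<close>

lemma level_reached: "\<exists>x\<ge>0. F x = h"
proof (rule ccontr)
  assume none: "\<not> (\<exists>x\<ge>0. F x = h)"
  have below: "F x < h" if x: "0 \<le> x" for x
  proof (rule ccontr)
    assume "\<not> F x < h"
    then obtain y where "0 \<le> y" "y \<le> x" "F y = h"
      using IVT'[of F 0 h x, OF _ _ _ F_cont_on] F_0_less x by auto
    then show False using none by auto
  qed
  have no_crit: "deriv u t \<noteq> 0" if "0 < u t" for t
    using u_critical[OF that] below[of "u t"] that by auto
  obtain s where s: "s \<in> S" using S_nonempty by auto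
  note us = u_cusp_zero[OF s]
  obtain \<delta> where d: "\<delta> > 0" "\<forall>t\<in>{s<..<s+\<delta>}. 0 < u t"
    using u_cusp_right(3)[OF s] by blast
  \<comment> \<open>No interior maximum at a positive height: the maximum over \<open>{s..b}\<close> sits at \<open>b\<close>.\<close>
  have max_end: "u t \<le> u b" if b: "s < b" and t: "t \<in> {s..b}" for b t
  proof -
    have "continuous_on {s..b} u"
      by (intro continuous_at_imp_continuous_on ballI u_cont)
    then obtain r where r: "r \<in> {s..b}" "\<forall>q\<in>{s..b}. u q \<le> u r"
      using continuous_attains_sup[OF compact_Icc, of s b u] b by auto
    have "0 < u (s + min \<delta> (b - s) / 2)"
      using d b by (intro d(2)[rule_format]) (auto simp: min_def field_simps)
    also have "\<dots> \<le> u r" using d b by (intro r(2)[rule_format]) (auto simp: min_def field_simps)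
    finally have ur: "0 < u r" .
    have "r = b"
    proof (rule ccontr)
      assume "r \<noteq> b"
      then have rr: "s < r" "r < b" using r(1) ur us by (auto simp: order_le_less)
      have "(u has_real_derivative deriv u r) (at r)" using ur by (intro u_deriv) (auto simp: S_eq)
      then have "deriv u r = 0"
        by (rule DERIV_local_max[of u _ r "min (r - s) (b - r)"]) (use rr r in \<open>auto simp: abs_if split: if_splits\<close>)
      then show False using no_crit[OF ur] by simp
    qed
    then show ?thesis using r t by auto
  qed
  have mono: "u t \<le> u b" if "s \<le> t" "t \<le> b" for t b
    using max_end[of b t] that by (cases "t = b") auto
  define a where "a = s + \<delta> / 2"
  have ua: "0 < u a" using d by (simp add: a_def)
  have sa: "s < a" using d by (simp add: a_def)
  have pos: "0 < u t" if "a \<le> t" for t using mono[of a t] ua sa that by simp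
  obtain M where M: "\<And>t. u t \<le> M" using u_bounded by blast
  define g where "g x = 2 * (h - F x) / x" for x
  have "continuous_on {u a..M} g"
    unfolding g_def[abs_def] using ua
    by (intro continuous_intros F_cont_on) auto
  then obtain y where y: "y \<in> {u a..M}" "\<forall>x\<in>{u a..M}. g y \<le> g x"
    using continuous_attains_inf[OF compact_Icc, of "u a" M g] M by auto
  have c: "0 < g y" using below[of y] y ua by (simp add: g_def)
  have dpos: "sqrt (g y) \<le> deriv u t" if t: "a \<le> t" for t
  proof -
    have tS: "t \<notin> S" using pos[of t] t by (simp add: S_eq)
    have "(deriv u t)\<^sup>2 = g (u t)"
      using u_energy[OF tS] pos[of t] t by (simp add: energy_def g_def field_simps)
    then have "g y \<le> (deriv u t)\<^sup>2" using y(2) M[of t] mono[of a t] sa t by auto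
    then have "sqrt (g y) \<le> \<bar>deriv u t\<bar>" using real_sqrt_le_mono by fastforce
    moreover have "0 \<le> deriv u t"
    proof (rule ccontr)
      assume "\<not> 0 \<le> deriv u t"
      then obtain e where e: "0 < e" "\<And>r. 0 < r \<Longrightarrow> r < e \<Longrightarrow> u (t + r) < u t"
        using DERIV_neg_dec_right[OF u_deriv[OF tS]] by auto
      have "u (t + e / 2) < u t" using e(1) by (intro e(2)) auto
      moreover have "u t \<le> u (t + e / 2)" using e(1) sa t by (intro mono) auto
      ultimately show False by simp
    qed
    ultimately show ?thesis by simp
  qed
  define t where "t = a + (M + 1) / sqrt (g y)"
  have "0 \<le> M" using M[of a] ua by simp
  then have at: "a < t" using c by (simp add: t_def)
  have "u a - sqrt (g y) * a \<le> u t - sqrt (g y) * t"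
  proof -
    define f where "f r = u r - sqrt (g y) * r" for r
    have "f a \<le> f t"
    proof (rule DERIV_nonneg_imp_nondecreasing[of a t f, OF less_imp_le[OF at]])
      fix r assume "a \<le> r" "r \<le> t"
      then have rS: "r \<notin> S" using pos[of r] by (simp add: S_eq)
      have "(f has_real_derivative deriv u r - sqrt (g y)) (at r)"
        unfolding f_def[abs_def] by (auto intro!: derivative_eq_intros u_deriv[OF rS])
      moreover have "sqrt (g y) \<le> deriv u r" using \<open>a \<le> r\<close> by (rule dpos)
      ultimately show "\<exists>d. (f has_real_derivative d) (at r) \<and> 0 \<le> d" by auto
    qed
    then show ?thesis by (simp add: f_def)
  qed
  then have "sqrt (g y) * (t - a) < u t" using ua by (simp add: algebra_simps)
  then have "M + 1 < u t" using c by (simp add: t_def)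
  then show False using M[of t] by simp
qed

lemma level_exists: "\<exists>m. cusp_level F m \<and> h = F m"
proof -
  define R where "R = {x \<in> {0..}. F x = h}"
  have "closed R"
    unfolding R_def by (intro continuous_closed_preimage_constant F_cont_on) auto
  moreover have "R \<noteq> {}" using level_reached by (auto simp: R_def)
  moreover have bdd: "bdd_below R" by (auto simp: R_def bdd_below_def)
  ultimately have R: "Inf R \<in> R" by (intro closed_contains_Inf)
  define m where "m = Inf R"
  have m: "0 \<le> m" "F m = h" using R by (auto simp: R_def m_def)
  then have mp: "0 < m" using F_0_less by (cases "m = 0") auto
  have "F x < h" if x: "0 \<le> x" "x < m" for x
  proof (rule ccontr)
    assume "\<not> F x < h"
    then obtain y where y: "0 \<le> y" "y \<le> x" "F y = h"
      using IVT'[of F 0 h x, OF _ _ _ F_cont_on] F_0_less x by auto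
    then have "m \<le> y" unfolding m_def by (intro cInf_lower bdd) (auto simp: R_def)
    then show False using y x by simp
  qed
  then have "cusp_level F m" using m mp by (auto simp: cusp_level_def)
  then show ?thesis using m by blast
qed

lemma u_not_differentiable: assumes s: "s \<in> S" shows "\<not> u differentiable (at s)"
proof
  assume "u differentiable (at s)"
  then obtain D where D: "(u has_real_derivative D) (at s)"
    by (auto simp: real_differentiable_def)
  have "((\<lambda>t. (u t - u s) / (t - s)) \<longlongrightarrow> D) (at_right s)"
    using D unfolding has_field_derivative_iff by (rule filterlim_mono) (auto simp: at_le)
  then have ev1: "\<forall>\<^sub>F t in at_right s. (u t - u s) / (t - s) < D + 1"
    by (rule order_tendstoD(2)) simp
  have "\<forall>\<^sub>F t in at_right s. D + 1 < deriv u t"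
    using u_cusp_right(1)[OF s] by (simp only: filterlim_at_top_dense)
  then obtain b where b: "s < b" "\<And>t. s < t \<Longrightarrow> t < b \<Longrightarrow> D + 1 < deriv u t"
    unfolding eventually_at_right_field by blast
  obtain \<delta> where d: "\<delta> > 0" "\<forall>t\<in>{s<..<s+\<delta>}. 0 < u t"
    using u_cusp_right(3)[OF s] by blast
  have "\<forall>\<^sub>F t in at_right s. t \<in> {s<..<min b (s+\<delta>)}"
    using b(1) d(1) by (intro eventually_at_right_real) auto
  with ev1 have "\<forall>\<^sub>F t in at_right s. (u t - u s) / (t - s) < D + 1 \<and> t \<in> {s<..<min b (s+\<delta>)}"
    by eventually_elim simp
  then obtain t where t: "(u t - u s) / (t - s) < D + 1" "t \<in> {s<..<min b (s+\<delta>)}"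
    using eventually_happens'[OF trivial_limit_at_right_real] by blast
  have nS: "r \<notin> S" if "s < r" "r < t" for r
  proof -
    have "0 < u r" using d(2) t that by auto
    then show ?thesis by (simp add: S_eq)
  qed
  have "continuous_on {s..t} u" by (intro continuous_at_imp_continuous_on ballI u_cont)
  moreover have "u differentiable (at r)" if "s < r" "r < t" for r
    using u_deriv[OF nS[OF that]] by (auto simp: real_differentiable_def)
  ultimately obtain l z where z: "s < z" "z < t" "(u has_real_derivative l) (at z)"
      "u t - u s = (t - s) * l"
    using MVT[of s t u] t by auto
  then have "u t - u s = (t - s) * deriv u z" by (simp add: DERIV_imp_deriv)
  then show False using t b(2)[of z] z by auto
qed

lemma u_orbit:
  assumes "analytic_cusp_level F m" "h = F m"
  shows "analytic_cusp_level.orbit F m u (deriv u)"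
proof -
  interpret analytic_cusp_level F m by fact
  show ?thesis unfolding orbit_def
  proof (intro conjI allI impI)
    fix t assume "0 < u t"
    then have t: "t \<notin> S" by (simp add: S_eq)
    show "(u has_real_derivative deriv u t) (at t)" by (rule u_deriv[OF t])
    show "\<exists>D. (deriv u has_real_derivative D) (at t)" using u_deriv2[OF t] by blast
    show "u t * (deriv u t)\<^sup>2 / 2 + F (u t) = F m"
      using u_energy[OF t] assms(2) by (simp add: energy_def)
  next
    fix s assume "u s = 0"
    then show "\<exists>\<delta>>0. (\<forall>t\<in>{s<..<s+\<delta>}. 0 < u t \<and> 0 < deriv u t) \<and>
        (\<forall>t\<in>{s-\<delta><..<s}. 0 < u t \<and> deriv u t < 0)"
      by (intro u_cusp_right(3)) (simp add: S_eq)
  qed (use u_cont u_nonneg in auto)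
qed

end

section \<open>Extrema, period and decay of the profile\<close>

lemma eventually_nhds_shift:
  fixes c t :: real
  shows "(\<forall>\<^sub>F s in nhds t. P (s - c)) \<longleftrightarrow> (\<forall>\<^sub>F s in nhds (t - c). P s)"
  using filtermap_nhds_shift[of c t] by (metis eventually_filtermap)

lemma ex1_in_period:
  fixes T :: real
  assumes "0 < T"
  shows "\<exists>!t. t \<in> {a..<a + T} \<and> (\<exists>k::int. t = c + of_int k * T)"
proof -
  define k where "k = \<lceil>(a - c) / T\<rceil>"
  have k: "(a - c) / T \<le> of_int k" "of_int k < (a - c) / T + 1"
    unfolding k_def by linarith+
  show ?thesis
  proof (rule ex1I[of _ "c + of_int k * T"])
    show "c + of_int k * T \<in> {a..<a + T} \<and> (\<exists>k'::int. c + of_int k * T = c + of_int k' * T)"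
      using k assms by (auto simp: field_simps)
    fix t assume "t \<in> {a..<a + T} \<and> (\<exists>k::int. t = c + of_int k * T)"
    then obtain j :: int where j: "t = c + of_int j * T" "a \<le> t" "t < a + T" by auto
    have "(a - c) / T \<le> of_int j" "of_int j < (a - c) / T + 1"
      using j assms by (auto simp: field_simps)
    then have "j = k" using k by linarith
    then show "t = c + of_int k * T" using j by simp
  qed
qed

lemma weak_singular_TWSI:
  assumes "TWS F u" "\<not> u constant_on UNIV" "countable S"
    and "\<And>t. t \<notin> S \<Longrightarrow> u differentiable (at t)" "\<And>t. t \<notin> S \<Longrightarrow> isCont (deriv u) t"
    and energy: "\<And>t. t \<notin> S \<Longrightarrow> energy F u t = h"
  shows "weak_singular_TWS F h S u"
proof -
  have "(energy F u \<longlongrightarrow> h) (at s within - S)" for s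
    by (rule tendsto_eventually) (auto simp: eventually_at_filter energy)
  then show ?thesis
    using assms by (auto simp: weak_singular_TWS_def classical_energy_solution_on_def
        intro!: continuous_at_imp_continuous_on)
qed

context analytic_cusp_level
begin

lemma deriv_wave_crest:
  assumes "wave t = m" "deriv F m \<noteq> 0" shows "deriv wave t = 0"
proof (rule DERIV_local_max[of wave _ t 1])
  show "(wave has_real_derivative deriv wave t) (at t)"
    using real_analytic_at_has_derivative[OF wave_analytic_crest[OF assms]] .
qed (use wave_bounds assms in auto)

lemma wave_energy:
  assumes "wave t \<noteq> 0" shows "energy F wave t = F m"
proof (cases "t \<in> turning")
  case True
  then have "wave t = m" "deriv F m \<noteq> 0" using wave_turning assms by auto
  then show ?thesis by (simp add: energy_def deriv_wave_crest)
next
  case False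
  then show ?thesis
    using wave_not_turning[OF False] dir_square[OF False]
    by (simp add: energy_def deriv_wave power_mult_distrib speed_sq power2_eq_square[of "dir t"])
      (simp add: field_simps)
qed

lemma wave_nonzero: "\<exists>t. wave t \<noteq> 0"
proof -
  obtain t where "0 < wave t"
    using eventually_happens'[OF _ wave_pos_near_zero] by auto
  then show ?thesis by (intro exI[of _ t]) simp
qed

lemma countable_zeros: "countable {t. wave t = 0}"
proof (rule countable_subset)
  show "{t. wave t = 0} \<subseteq> (\<Union>n::nat. turning \<inter> {- real n..real n})"
  proof
    fix t assume t: "t \<in> {t. wave t = 0}"
    obtain n :: nat where "\<bar>t\<bar> \<le> real n" using real_arch_simple by blast
    then show "t \<in> (\<Union>n::nat. turning \<inter> {- real n..real n})"
      using wave_zero_turning[of t] t by (intro UN_I[of n]) auto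
  qed
  show "countable (\<Union>n::nat. turning \<inter> {- real n..real n})"
    by (rule countable_UN) (auto intro: countable_finite finite_turning)
qed

lemma wave_cusped_TWS: "cusped_TWS F (F m) {t. wave t = 0} wave"
proof -
  have "\<not> wave constant_on UNIV"
    using wave_nonzero wave_0 by (metis UNIV_I constant_on_def)
  then have "weak_singular_TWS F (F m) {t. wave t = 0} wave"
    using wave_TWS countable_zeros wave_energy
      real_analytic_at_has_derivative[OF wave_analytic]
      real_analytic_at_isCont[OF real_analytic_at_deriv[OF wave_analytic]]
    by (intro weak_singular_TWSI) (auto simp: real_differentiable_def)
  moreover have "smooth_on (- {t. wave t = 0}) wave"
    by (rule real_analytic_at_imp_smooth_on) (simp add: wave_analytic)
  moreover have "{t. wave t = 0} \<noteq> {}" using wave_0 by blast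
  ultimately show ?thesis
    using wave_cusp countable_zeros unfolding cusped_TWS_def singular_TWS_def by blast
qed

lemma wave_moves: "t \<notin> turning \<Longrightarrow> deriv wave t \<noteq> 0"
  using speed_pos[of "wave t"] wave_not_turning[of t] by (auto simp: deriv_wave turning_def)

text \<open>Between turning points the derivative does not vanish, and a zero is not a local maximum because the
zeros are isolated.\<close>

lemma local_max_wave: "local_max_at wave t \<longleftrightarrow> wave t = m"
proof
  assume "wave t = m"
  then show "local_max_at wave t" by (simp add: local_max_at_def wave_bounds)
next
  assume max: "local_max_at wave t"
  then obtain d where d: "0 < d" "\<And>s. dist s t < d \<Longrightarrow> wave s \<le> wave t"
    unfolding local_max_at_def eventually_nhds_metric by blast
  have "t \<in> turning"
  proof (rule ccontr)
    assume t: "t \<notin> turning"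
    have "deriv wave t = 0"
    proof (rule DERIV_local_max[of wave _ t d])
      show "(wave has_real_derivative deriv wave t) (at t)"
        using wave_not_turning(4)[OF t] by (simp add: deriv_wave[OF t])
    qed (use d in \<open>auto simp: dist_real_def\<close>)
    then show False using wave_moves[OF t] by simp
  qed
  moreover have "wave t \<noteq> 0"
  proof
    assume "wave t = 0"
    then have "\<forall>\<^sub>F s in at t. wave s \<le> 0"
      using max by (simp add: local_max_at_def eventually_at_filter eventually_mono)
    then have "\<forall>\<^sub>F s in at t. False"
      using eventually_at_not_turning[of t] by eventually_elim (use wave_not_turning(1) in force)
    then show False by simp
  qed
  ultimately show "wave t = m" using wave_turning by blast
qed

lemma local_min_wave: "local_min_at wave t \<longleftrightarrow> wave t = 0"
proof
  assume "wave t = 0"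
  then show "local_min_at wave t" by (simp add: local_min_at_def wave_bounds)
next
  assume min: "local_min_at wave t"
  then obtain d where d: "0 < d" "\<And>s. dist s t < d \<Longrightarrow> wave t \<le> wave s"
    unfolding local_min_at_def eventually_nhds_metric by blast
  have "t \<in> turning"
  proof (rule ccontr)
    assume t: "t \<notin> turning"
    have "deriv wave t = 0"
    proof (rule DERIV_local_min[of wave _ t d])
      show "(wave has_real_derivative deriv wave t) (at t)"
        using wave_not_turning(4)[OF t] by (simp add: deriv_wave[OF t])
    qed (use d in \<open>auto simp: dist_real_def\<close>)
    then show False using wave_moves[OF t] by simp
  qed
  moreover have "wave t \<noteq> m"
  proof
    assume "wave t = m"
    then have "\<forall>\<^sub>F s in at t. m \<le> wave s"
      using min by (simp add: local_min_at_def eventually_at_filter eventually_mono)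
    then have "\<forall>\<^sub>F s in at t. False"
      using eventually_at_not_turning[of t] by eventually_elim (use wave_not_turning(2) in force)
    then show False by simp
  qed
  ultimately show "wave t = 0" using wave_turning by blast
qed

definition period :: real where "period = 2 * half_period"

lemma period_formula:
  assumes "deriv F m \<noteq> 0"
  shows "(\<lambda>x. sqrt (x / (F m - F x))) integrable_on {0..m}"
    and "period = 2 / sqrt 2 * integral {0..m} (\<lambda>x. sqrt (x / (F m - F x)))"
proof -
  have eq: "(\<lambda>x. sqrt (x / (F m - F x))) = (\<lambda>x. sqrt 2 * slowness x)"
  proof
    fix x
    have "x / y = 2 * (x / (2 * y))" for y :: real by simp
    from this[of "F m - F x"] show "sqrt (x / (F m - F x)) = sqrt 2 * slowness x"
      by (simp only: slowness_def real_sqrt_mult[symmetric])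
  qed
  show "(\<lambda>x. sqrt (x / (F m - F x))) integrable_on {0..m}"
    unfolding eq by (intro integrable_on_mult_right slowness_integrable_crest assms)
  show "period = 2 / sqrt 2 * integral {0..m} (\<lambda>x. sqrt (x / (F m - F x)))"
    unfolding eq by (simp add: period_def half_period_def time_def)
qed

text \<open>The turning points are the multiples of the half period; the even ones are zeros and the odd ones
crests.\<close>

lemma zero_crest_positions:
  assumes nc: "deriv F m \<noteq> 0"
  shows "wave t = 0 \<longleftrightarrow> (\<exists>k::int. t = 0 + of_int k * period)"
    and "wave t = m \<longleftrightarrow> (\<exists>k::int. t = half_period + of_int k * period)"
proof -
  note p = half_period_pos[OF nc]
  have even: "wave (of_int k * period) = 0" for k :: int
  proof -
    have "pi * (of_int k * period) / half_period = 2 * pi * of_int k"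
      using p by (simp add: period_def field_simps)
    then show ?thesis using nc by (simp add: wave_zero_iff folded_def)
  qed
  have odd: "wave (half_period + of_int k * period) = m" for k :: int
    using zero_shift(3)[OF even, of half_period k] wave_half_period[OF nc] by simp
  have cases: "(\<exists>k::int. t = of_int k * period) \<or> (\<exists>k::int. t = half_period + of_int k * period)"
    if t: "t \<in> turning"
  proof -
    obtain i :: int where i: "t = of_int i * half_period" using t turning_int[OF nc] by blast
    show ?thesis
    proof (cases "even i")
      case True
      then obtain k where "i = 2 * k" by blast
      then show ?thesis by (intro disjI1 exI[of _ k]) (simp add: i period_def)
    next
      case False
      then obtain k where "i = 2 * k + 1" by (elim oddE)
      then show ?thesis by (intro disjI2 exI[of _ k]) (simp add: i period_def algebra_simps)
    qed
  qed
  show "wave t = 0 \<longleftrightarrow> (\<exists>k::int. t = 0 + of_int k * period)"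
    using cases[OF wave_zero_turning] even odd m_pos by fastforce
  show "wave t = m \<longleftrightarrow> (\<exists>k::int. t = half_period + of_int k * period)"
    using cases[OF wave_crest_turning] even odd m_pos by fastforce
qed

text \<open>A period carries the zero at the origin to another zero, so it is a multiple of the distance between
zeros.\<close>

lemma wave_fundamental_period:
  assumes nc: "deriv F m \<noteq> 0" shows "fundamental_period wave period"
  unfolding fundamental_period_def
proof (intro conjI allI impI)
  note p = half_period_pos[OF nc]
  show "has_period wave period"
    using p zero_shift(3)[OF wave_period_zero[OF nc]] by (simp add: has_period_def period_def)
  fix T assume T: "has_period wave T"
  then have "wave (0 + T) = wave 0" "0 < T" unfolding has_period_def by blast+
  then obtain k :: int where k: "T = of_int k * period"
    using zero_crest_positions(1)[OF nc, of T] by auto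
  have pp: "0 < period" using p by (simp add: period_def)
  then have "0 < k" using \<open>0 < T\<close> by (simp add: k zero_less_mult_iff)
  then have "1 * period \<le> of_int k * period" using pp by (intro mult_right_mono) auto
  then show "period \<le> T" by (simp add: k)
qed

lemma critical_zero_iff: "deriv F m = 0 \<Longrightarrow> wave t = 0 \<longleftrightarrow> t = 0"
  using wave_zero_turning[of t] by (auto simp: turning_critical)

lemma critical_time_wave: "deriv F m = 0 \<Longrightarrow> time (wave t) = \<bar>t\<bar>"
  using wave_not_turning(3)[of t] by (cases "t = 0") (auto simp: turning_critical folded_def)

lemma critical_limit:
  assumes c: "deriv F m = 0" shows "(wave \<longlongrightarrow> m) at_top" "(wave \<longlongrightarrow> m) at_bot"
proof -
  show top: "(wave \<longlongrightarrow> m) at_top"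
  proof (rule order_tendstoI)
    fix a assume a: "a < m"
    define b where "b = max a 0"
    have b: "0 \<le> b" "b < m" using a m_pos by (auto simp: b_def)
    have "a < wave t" if "time b < t" for t
    proof (rule ccontr)
      assume "\<not> a < wave t"
      then have "wave t \<le> b" by (simp add: b_def)
      then have "time (wave t) \<le> time b"
        using time_less[of "wave t" b] b range_setI wave_bounds[of t]
        by (cases "wave t = b") auto
      then show False using critical_time_wave[OF c, of t] that by simp
    qed
    then show "\<forall>\<^sub>F t in at_top. a < wave t"
      by (rule eventually_mono[OF eventually_gt_at_top])
  next
    fix a assume "m < a"
    then show "\<forall>\<^sub>F t in at_top. wave t < a"
      using wave_bounds by (intro always_eventually allI) (meson order.strict_trans1)
  qed
  then show "(wave \<longlongrightarrow> m) at_bot"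
    by (simp add: filterlim_at_bot_mirror)
qed

lemma critical_decay:
  assumes "deriv F m = 0" "(deriv ^^ 2) F m \<noteq> 0"
  obtains k where "0 < k" "\<And>t. m - wave t \<le> m * exp (- \<bar>t\<bar> / k)"
proof -
  obtain k where k: "0 < k" "\<And>x. 0 \<le> x \<Longrightarrow> x < m \<Longrightarrow> time x \<le> k * (ln m - ln (m - x))"
    using time_log_bound[OF assms] by blast
  have "m - wave t \<le> m * exp (- \<bar>t\<bar> / k)" for t
  proof -
    have w: "0 < m - wave t" using wave_critical[OF assms(1), of t] by simp
    have "\<bar>t\<bar> \<le> k * (ln m - ln (m - wave t))"
      using k(2)[of "wave t"] critical_time_wave[OF assms(1), of t] wave_bounds[of t] w by simp
    then have "ln (m - wave t) \<le> ln m + (- \<bar>t\<bar> / k)" using k(1) by (simp add: field_simps)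
    then have "exp (ln (m - wave t)) \<le> exp (ln m + (- \<bar>t\<bar> / k))" by (simp only: exp_le_cancel_iff)
    then show ?thesis using w m_pos by (simp only: exp_add exp_ln)
  qed
  then show ?thesis using that k(1) by blast
qed

end

section \<open>The classification\<close>

lemma local_max_at_shift: "local_max_at (\<lambda>t. f (t - c)) t \<longleftrightarrow> local_max_at f (t - c)"
  unfolding local_max_at_def using eventually_nhds_shift[of "\<lambda>s. f s \<le> f (t - c)"] .

lemma local_min_at_shift: "local_min_at (\<lambda>t. f (t - c)) t \<longleftrightarrow> local_min_at f (t - c)"
  unfolding local_min_at_def using eventually_nhds_shift[of "\<lambda>s. f (t - c) \<le> f s"] .

lemma has_period_shift: "has_period (\<lambda>t. f (t - c)) T \<longleftrightarrow> has_period f T"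
proof -
  have "(\<forall>t. f (t + T - c) = f (t - c)) \<longleftrightarrow> (\<forall>t. f (t + T) = f t)"
  proof
    assume *: "\<forall>t. f (t + T - c) = f (t - c)"
    show "\<forall>t. f (t + T) = f t"
    proof
      fix t
      show "f (t + T) = f t" using *[rule_format, of "t + c"] by (simp add: algebra_simps)
    qed
  next
    assume *: "\<forall>t. f (t + T) = f t"
    show "\<forall>t. f (t + T - c) = f (t - c)"
    proof
      fix t
      show "f (t + T - c) = f (t - c)" using *[rule_format, of "t - c"] by (simp add: algebra_simps)
    qed
  qed
  then show ?thesis by (simp add: has_period_def)
qed

lemma fundamental_period_shift:
  "fundamental_period (\<lambda>t. f (t - c)) T \<longleftrightarrow> fundamental_period f T"
  by (simp add: fundamental_period_def has_period_shift)

lemma (in cusped_wave) u_weak_singular: "weak_singular_TWS F h S u"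
proof (rule weak_singular_TWSI[OF u_TWS])
  show "\<not> u constant_on UNIV"
    using cusped by (auto simp: cusped_TWS_def singular_TWS_def strong_singular_TWS_def
        weak_singular_TWS_def)
  show "u differentiable (at t)" if "t \<notin> S" for t
    using u_deriv[OF that] by (auto simp: real_differentiable_def)
  show "isCont (deriv u) t" if "t \<notin> S" for t
    using u_deriv2[OF that] by (rule DERIV_isCont)
qed (use S_countable u_energy in auto)

locale cusped_solution = analytic_cusp_level + cusped_wave F "F m" S u for S u

begin

text \<open>Any cusp serves as the origin of the translation; the choice fixes one.\<close>

definition cusp :: real where "cusp = (SOME s. s \<in> S)"

lemma cusp_in: "cusp \<in> S"
  unfolding cusp_def using S_nonempty by (simp add: some_in_eq)

lemma u_eq: "u = (\<lambda>t. wave (t - cusp))"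
  by (rule ext, rule orbit_eq_wave[OF u_orbit[OF analytic_cusp_level_axioms refl]])
    (rule u_cusp_zero[OF cusp_in])

lemma S_wave: "t \<in> S \<longleftrightarrow> wave (t - cusp) = 0"
proof -
  have "t \<in> S \<longleftrightarrow> u t = 0" by (subst S_eq) simp
  then show ?thesis using fun_cong[OF u_eq, of t] by simp
qed

lemma u_analytic: "real_analytic_on u (- S)"
proof (rule real_analytic_onI)
  fix t assume "t \<in> - S"
  then have "real_analytic_at wave (t - cusp)" by (intro wave_analytic) (simp add: S_wave)
  then show "real_analytic_at u t"
    unfolding u_eq
    by (rule real_analytic_at_compose)
      (intro real_analytic_at_diff real_analytic_at_ident real_analytic_at_const)
qed

lemma periodic_imp: "has_period u T \<Longrightarrow> deriv F m \<noteq> 0"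
proof
  assume T: "has_period u T" and c: "deriv F m = 0"
  have "has_period wave T" using T unfolding u_eq has_period_shift .
  then have "wave (0 + T) = wave 0" "0 < T" unfolding has_period_def by blast+
  then show False using critical_zero_iff[OF c, of T] by simp
qed

lemma cusped_periodic_iff: "cusped_periodic F (F m) S u \<longleftrightarrow> deriv F m \<noteq> 0"
proof
  assume "deriv F m \<noteq> 0"
  then have "has_period wave period"
    using wave_fundamental_period by (simp add: fundamental_period_def)
  then have "has_period u period" unfolding u_eq has_period_shift .
  then show "cusped_periodic F (F m) S u" using cusped by (auto simp: cusped_periodic_def)
qed (auto simp: cusped_periodic_def periodic_imp)

lemma solitary_S: "deriv F m = 0 \<Longrightarrow> S = {cusp}"
  by (auto simp: S_wave critical_zero_iff)

lemma solitary_limits: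
  assumes "deriv F m = 0" shows "(u \<longlongrightarrow> m) at_top" "(u \<longlongrightarrow> m) at_bot"
proof -
  have "filterlim (\<lambda>t. t - cusp) at_top at_top"
    unfolding filterlim_at_top eventually_at_top_linorder
    by (intro allI, rule_tac x = "Z + cusp" in exI) auto
  then show "(u \<longlongrightarrow> m) at_top"
    unfolding u_eq by (rule filterlim_compose[OF critical_limit(1)[OF assms]])
  have "filterlim (\<lambda>t. t - cusp) at_bot at_bot"
    unfolding filterlim_at_bot eventually_at_bot_linorder
    by (intro allI, rule_tac x = "Z + cusp" in exI) auto
  then show "(u \<longlongrightarrow> m) at_bot"
    unfolding u_eq by (rule filterlim_compose[OF critical_limit(2)[OF assms]])
qed

lemma cusped_solitary_iff: "cusped_solitary F (F m) S u \<longleftrightarrow> deriv F m = 0"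
proof
  assume "deriv F m = 0"
  then show "cusped_solitary F (F m) S u"
    unfolding cusped_solitary_def using cusped solitary_S solitary_limits by blast
next
  assume sol: "cusped_solitary F (F m) S u"
  show "deriv F m = 0"
  proof (rule ccontr)
    assume nc: "deriv F m \<noteq> 0"
    have "cusp + 2 * half_period \<in> S" using wave_period_zero[OF nc] by (simp add: S_wave)
    moreover obtain s where "S = {s}" using sol by (auto simp: cusped_solitary_def)
    ultimately show False using cusp_in half_period_pos[OF nc] by auto
  qed
qed

lemma solitary_deviation: "deviation m u t = m - wave (t - cusp)"
  using wave_bounds by (simp add: deviation_def u_eq)

text \<open>The deviation from \<open>m\<close> is largest where the wave is smallest, that is, at its only zero.\<close>

lemma solitary_shape:
  assumes c: "deriv F m = 0"
  shows "\<exists>s. S = {s} \<and> (\<forall>t. local_max_at (deviation m u) t \<longleftrightarrow> t = s)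
           \<and> (\<forall>t. t \<noteq> s \<longrightarrow> deviation m u t < deviation m u s) \<and> symmetric_about u s"
proof (intro exI[of _ cusp] conjI allI impI)
  show "S = {cusp}" by (rule solitary_S[OF c])
  show "local_max_at (deviation m u) t \<longleftrightarrow> t = cusp" for t
  proof -
    have "local_max_at (deviation m u) t \<longleftrightarrow> local_min_at (\<lambda>t. wave (t - cusp)) t"
      by (simp add: local_max_at_def local_min_at_def solitary_deviation)
    then show ?thesis
      by (simp add: local_min_at_shift local_min_wave critical_zero_iff[OF c])
  qed
  show "deviation m u t < deviation m u cusp" if "t \<noteq> cusp" for t
    using that wave_bounds(1)[of "t - cusp"] critical_zero_iff[OF c, of "t - cusp"]
    by (simp add: solitary_deviation less_le)
  show "symmetric_about u cusp"
    unfolding symmetric_about_def u_eq using wave_minus by simp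
qed

lemma deviation_limits:
  assumes "deriv F m = 0"
  shows "(deviation m u \<longlongrightarrow> 0) at_top" "(deviation m u \<longlongrightarrow> 0) at_bot"
proof -
  have "((\<lambda>t. \<bar>u t - m\<bar>) \<longlongrightarrow> \<bar>m - m\<bar>) at_top" "((\<lambda>t. \<bar>u t - m\<bar>) \<longlongrightarrow> \<bar>m - m\<bar>) at_bot"
    by (intro tendsto_intros solitary_limits[OF assms])+
  then show "(deviation m u \<longlongrightarrow> 0) at_top" "(deviation m u \<longlongrightarrow> 0) at_bot"
    by (simp_all add: deviation_def[abs_def])
qed

lemma deviation_decay:
  assumes "deriv F m = 0" "(deriv ^^ 2) F m \<noteq> 0"
  shows "exponential_decay (deviation m u)"
proof -
  obtain k where k: "0 < k" "\<And>t. m - wave t \<le> m * exp (- \<bar>t\<bar> / k)"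
    using critical_decay[OF assms] by blast
  have "\<bar>deviation m u t\<bar> \<le> (m * exp (\<bar>cusp\<bar> / k)) * exp (- (1 / k) * \<bar>t\<bar>)" for t
  proof -
    have "\<bar>deviation m u t\<bar> \<le> m * exp (- \<bar>t - cusp\<bar> / k)"
      using k(2)[of "t - cusp"] wave_bounds(2)[of "t - cusp"] by (simp add: solitary_deviation)
    also have "- \<bar>t - cusp\<bar> / k \<le> \<bar>cusp\<bar> / k + - (1 / k) * \<bar>t\<bar>"
      using k(1) abs_triangle_ineq[of "t - cusp" cusp] by (simp add: field_simps)
    then have "m * exp (- \<bar>t - cusp\<bar> / k) \<le> m * exp (\<bar>cusp\<bar> / k + - (1 / k) * \<bar>t\<bar>)"
      using m_pos by (intro mult_left_mono) auto
    also have "\<dots> = (m * exp (\<bar>cusp\<bar> / k)) * exp (- (1 / k) * \<bar>t\<bar>)"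
      by (simp only: exp_add mult.assoc)
    finally show ?thesis .
  qed
  then show ?thesis unfolding exponential_decay_def
    using m_pos k(1) by (intro exI[of _ "m * exp (\<bar>cusp\<bar> / k)"] conjI exI[of _ "1 / k"]) auto
qed

lemma periodic_extrema:
  assumes nc: "deriv F m \<noteq> 0"
  shows "\<exists>!t. t \<in> {a..<a + period} \<and> local_max_at u t"
    and "\<exists>!t. t \<in> {a..<a + period} \<and> local_min_at u t"
proof -
  have p: "0 < period" using half_period_pos[OF nc] by (simp add: period_def)
  have "local_max_at u t \<longleftrightarrow> (\<exists>k::int. t = (cusp + half_period) + of_int k * period)" for t
    unfolding u_eq local_max_at_shift local_max_wave zero_crest_positions(2)[OF nc]
    by (simp add: algebra_simps)
  then show "\<exists>!t. t \<in> {a..<a + period} \<and> local_max_at u t"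
    using ex1_in_period[OF p] by simp
  have "local_min_at u t \<longleftrightarrow> (\<exists>k::int. t = cusp + of_int k * period)" for t
    unfolding u_eq local_min_at_shift local_min_wave zero_crest_positions(1)[OF nc]
    by (simp add: algebra_simps)
  then show "\<exists>!t. t \<in> {a..<a + period} \<and> local_min_at u t"
    using ex1_in_period[OF p] by simp
qed

lemma extremum_symmetric:
  assumes "local_max_at u t \<or> local_min_at u t"
  shows "symmetric_about u t"
proof -
  have "wave (t - cusp) = m \<or> wave (t - cusp) = 0"
    using assms unfolding u_eq local_max_at_shift local_min_at_shift local_max_wave local_min_wave .
  then have "t - cusp \<in> turning" using wave_crest_turning wave_zero_turning by blast
  then show ?thesis
    unfolding symmetric_about_def u_eq
    using turning_symmetric[of "t - cusp"] by (simp add: algebra_simps)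
qed

lemma u_fundamental_period:
  "deriv F m \<noteq> 0 \<Longrightarrow> fundamental_period u period"
  using wave_fundamental_period unfolding u_eq fundamental_period_shift .

end

theorem proposition12:
  fixes F :: "real \<Rightarrow> real"
  assumes analytic: "real_analytic_on F UNIV"
  shows "((\<exists>h S u. cusped_TWS F h S u) \<longleftrightarrow> (\<exists>m. cusp_level F m))
    \<and> (\<forall>m. cusp_level F m \<longrightarrow> (\<exists>S u. cusped_TWS F (F m) S u))
    \<and> (\<forall>h S u. cusped_TWS F h S u \<longrightarrow> (\<exists>m. cusp_level F m \<and> h = F m))
    \<and> (\<forall>m S u. cusp_level F m \<and> cusped_TWS F (F m) S u \<longrightarrow>
          (cusped_periodic F (F m) S u \<longleftrightarrow> deriv F m \<noteq> 0)
        \<and> (cusped_solitary F (F m) S u \<longleftrightarrow> deriv F m = 0)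
        \<and> weak_singular_TWS F (F m) S u
        \<and> real_analytic_on u (- S)
        \<and> (\<forall>s\<in>S. \<not> u differentiable (at s))
        \<and> (cusped_solitary F (F m) S u \<longrightarrow>
            (\<exists>s. S = {s}
               \<and> (\<forall>t. local_max_at (deviation m u) t \<longleftrightarrow> t = s)
               \<and> (\<forall>t. t \<noteq> s \<longrightarrow> deviation m u t < deviation m u s)
               \<and> symmetric_about u s)
          \<and> (deviation m u \<longlongrightarrow> 0) at_top \<and> (deviation m u \<longlongrightarrow> 0) at_bot
          \<and> ((deriv ^^ 2) F m \<noteq> 0 \<longrightarrow> exponential_decay (deviation m u)))
        \<and> (cusped_periodic F (F m) S u \<longrightarrow>
            (\<lambda>x. sqrt (x / (F m - F x))) integrable_on {0..m}
          \<and> (\<exists>T. T = 2 / sqrt 2 * integral {0..m} (\<lambda>x. sqrt (x / (F m - F x)))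
               \<and> fundamental_period u T
               \<and> (\<forall>a. \<exists>!t. t \<in> {a..<a + T} \<and> local_max_at u t)
               \<and> (\<forall>a. \<exists>!t. t \<in> {a..<a + T} \<and> local_min_at u t))
          \<and> (\<forall>t. local_max_at u t \<or> local_min_at u t \<longrightarrow> symmetric_about u t)))"
proof -
  have F: "real_analytic_at F x" for x
    using real_analytic_on_imp_at[OF analytic] by simp
  have existence: "\<exists>S u. cusped_TWS F (F m) S u" if "cusp_level F m" for m
  proof -
    interpret analytic_cusp_level F m by unfold_locales (use F that in auto)
    show ?thesis using wave_cusped_TWS by blast
  qed
  have level: "\<exists>m. cusp_level F m \<and> h = F m" if "cusped_TWS F h S u" for h S u
  proof -
    interpret cusped_wave F h S u by unfold_locales (use F that in auto)
    show ?thesis by (rule level_exists)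
  qed
  show ?thesis
  proof (intro conjI allI impI; (elim conjE)?)
    show "(\<exists>h S u. cusped_TWS F h S u) \<longleftrightarrow> (\<exists>m. cusp_level F m)"
      using existence level by blast
    show "\<exists>S u. cusped_TWS F (F m) S u" if "cusp_level F m" for m by (rule existence[OF that])
    show "\<exists>m. cusp_level F m \<and> h = F m" if "cusped_TWS F h S u" for h S u by (rule level[OF that])
  next
    fix m S u assume "cusp_level F m" "cusped_TWS F (F m) S u"
    then interpret cusped_solution F m S u by unfold_locales (use F in auto)
    show "cusped_periodic F (F m) S u \<longleftrightarrow> deriv F m \<noteq> 0" by (rule cusped_periodic_iff)
    show "cusped_solitary F (F m) S u \<longleftrightarrow> deriv F m = 0" by (rule cusped_solitary_iff)
    show "weak_singular_TWS F (F m) S u" by (rule u_weak_singular)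
    show "real_analytic_on u (- S)" by (rule u_analytic)
    show "\<forall>s\<in>S. \<not> u differentiable (at s)" using u_not_differentiable by blast
    {
      assume "cusped_solitary F (F m) S u"
      then have c: "deriv F m = 0" by (simp add: cusped_solitary_iff)
      show "\<exists>s. S = {s}
               \<and> (\<forall>t. local_max_at (deviation m u) t \<longleftrightarrow> t = s)
               \<and> (\<forall>t. t \<noteq> s \<longrightarrow> deviation m u t < deviation m u s)
               \<and> symmetric_about u s" by (rule solitary_shape[OF c])
      show "(deviation m u \<longlongrightarrow> 0) at_top" "(deviation m u \<longlongrightarrow> 0) at_bot"
        by (rule deviation_limits[OF c])+
      show "exponential_decay (deviation m u)" if "(deriv ^^ 2) F m \<noteq> 0"
        by (rule deviation_decay[OF c that])
    next
      assume "cusped_periodic F (F m) S u"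
      then have nc: "deriv F m \<noteq> 0" by (simp add: cusped_periodic_iff)
      show "(\<lambda>x. sqrt (x / (F m - F x))) integrable_on {0..m}" by (rule period_formula(1)[OF nc])
      show "\<exists>T. T = 2 / sqrt 2 * integral {0..m} (\<lambda>x. sqrt (x / (F m - F x)))
               \<and> fundamental_period u T
               \<and> (\<forall>a. \<exists>!t. t \<in> {a..<a + T} \<and> local_max_at u t)
               \<and> (\<forall>a. \<exists>!t. t \<in> {a..<a + T} \<and> local_min_at u t)"
        using period_formula(2)[OF nc] u_fundamental_period[OF nc] periodic_extrema[OF nc]
        by (intro exI[of _ period]) blast
      show "symmetric_about u t" if "local_max_at u t \<or> local_min_at u t" for t
        by (rule extremum_symmetric[OF that])
    }
  qed
qed

end
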